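(* Let $b$ be a fixed, arbitrary, real number and let $t\in(0,1)$ be a fixed level. Let $\hat\varphi_t^{s}$ be the $s$-value multiple testing procedure at level $t$ with horseshoe parameter chosen as the marginal maximum likelihood estimator $\hat\tau$ (all defined in the context). Then, as $n,s_n\to\infty$ with $s_n/n\to 0$, \[ \sup_{\theta_0\in\mathcal{L}_0[s_n;b]}\left\{\mathrm{FDR}(\theta_0,\hat\varphi_t^{s})+\mathrm{FNR}(\theta_0,\hat\varphi_t^{s})\right\}=\bar\Phi(b)+o(1). \]
   Context: Model: one observes $X=(X_1,\dots,X_n)$ with $X_i=\theta_i+\varepsilon_i$, $\varepsilon_i$ i.i.d. $\mathcal N(0,1)$, $\theta\in\mathbb R^n$; $P_\theta$ and $E_\theta$ denote the law of $X$ and its expectation. $\phi$ is the standard normal density and $\bar\Phi(u)=P[\mathcal N(0,1)>u]$. Sparse classes: $1\le s_n\le n$ are integers; $\ell_0[s_n]=\{\theta\in\mathbb R^n: |\{i:\theta_i\ne0\}|\le s_n\}$; $S_\theta=\{i:\theta_i\neq0\}$; $\mathcal{L}_0[s_n;b]=\{\theta\in\ell_0[s_n]: |\theta_i|\ge\sqrt{2\log(n/s_n)}+b \text{ for all } i\in S_\theta,\ |S_\theta|=s_n\}$. Horseshoe prior with parameter $\tau>0$: $\Pi_\tau$ is the law of $\theta_1$ when $\theta_1\mid\lambda\sim\mathcal N(0,\lambda^2\tau^2)$ and $\lambda\sim C^+(0,1)$ (standard half-Cauchy, density $\frac{2}{\pi(1+\lambda^2)}$ on $(0,\infty)$); $h_\tau$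 is its Lebesgue density. $\Pi_\tau(\cdot\mid X_1=x)$ denotes the conditional (posterior) law of $\theta_1$ given $X_1=x$ in the Bayesian model $\theta_1\sim\Pi_\tau$, $X_1\mid\theta_1\sim\mathcal N(\theta_1,1)$. $s$-value: $s(x;\tau)=2\min\left(\Pi_\tau(\theta_1<0\mid X_1=x),\ \Pi_\tau(\theta_1>0\mid X_1=x)\right)$. Marginal maximum likelihood estimator: $\hat\tau=\hat\tau(X)=\operatorname{argmax}_{\tau\in[1/n,1]}\prod_{i=1}^n\int\phi(X_i-\theta)h_\tau(\theta)\,d\theta$. Procedure: $\hat\varphi^s_t(X)=(\mathbf 1\{s(X_i;\hat\tau)<t\})_{1\le i\le n}\in\{0,1\}^n$. Errors: for a procedure $\varphi=\varphi(X)\in\{0,1\}^n$, \[\mathrm{FDR}(\theta,\varphi)=E_\theta\left[\frac{\sum_{i=1}^n\mathbf 1\{\theta_i=0,\varphi_i=1\}}{\max(1,\sum_{i=1}^n\mathbf 1\{\varphi_i=1\})}\right],\qquad \mathrm{FNR}(\theta,\varphi)=E_\theta\left[\frac{\sum_{i=1}^n\mathbf 1\{\theta_i\ne0\}(1-\varphi_i(X))}{\max(1,\sum_{i=1}^n\mathbf 1\{\theta_i\neq0\})}\right].\] *)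

theory Defs
  imports "HOL-Probability.Probability"
begin

text \<open>Gaussian sequence model. Vectors in \<open>\<real>\<^sup>n\<close> are extensional functions on \<open>{..<n}\<close>, so that
  the dimension can vary. The second argument of \<open>normal_law\<close> is the standard deviation.\<close>

definition normal_law :: "real \<Rightarrow> real \<Rightarrow> real measure" where
  "normal_law m \<sigma> = density lborel (\<lambda>x. ennreal (normal_density m \<sigma> x))"

definition seq_law :: "nat \<Rightarrow> (nat \<Rightarrow> real) \<Rightarrow> (nat \<Rightarrow> real) measure" where
  "seq_law n \<theta> = distr (\<Pi>\<^sub>M i\<in>{..<n}. normal_law 0 1) (\<Pi>\<^sub>M i\<in>{..<n}. borel)
     (\<lambda>\<epsilon>. \<lambda>i\<in>{..<n}. \<theta> i + \<epsilon> i)"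

definition Phi_bar :: "real \<Rightarrow> real" where
  "Phi_bar u = measure (normal_law 0 1) {u<..}"

definition supp :: "nat \<Rightarrow> (nat \<Rightarrow> real) \<Rightarrow> nat set" where
  "supp n \<theta> = {i. i < n \<and> \<theta> i \<noteq> 0}"

definition ell0 :: "nat \<Rightarrow> nat \<Rightarrow> (nat \<Rightarrow> real) set" where
  "ell0 n s = {\<theta> \<in> {..<n} \<rightarrow>\<^sub>E UNIV. card (supp n \<theta>) \<le> s}"

definition L0 :: "nat \<Rightarrow> nat \<Rightarrow> real \<Rightarrow> (nat \<Rightarrow> real) set" where
  "L0 n s b = {\<theta> \<in> ell0 n s.
     (\<forall>i\<in>supp n \<theta>. \<bar>\<theta> i\<bar> \<ge> sqrt (2 * ln (real n / real s)) + b) \<and> card (supp n \<theta>) = s}"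

definition half_cauchy :: "real measure" where
  "half_cauchy = density lborel (\<lambda>l. ennreal (indicator {0<..} l * (2 / (pi * (1 + l\<^sup>2)))))"

definition horseshoe :: "real \<Rightarrow> real measure" where
  "horseshoe \<tau> = half_cauchy \<bind> (\<lambda>l. normal_law 0 (l * \<tau>))"

text \<open>The density is \<open>ennreal\<close>-valued because it is infinite at \<open>0\<close>.\<close>

definition horseshoe_density :: "real \<Rightarrow> real \<Rightarrow> ennreal" where
  "horseshoe_density \<tau> \<theta> = (\<integral>\<^sup>+ l. ennreal (normal_density 0 (l * \<tau>) \<theta>) \<partial>half_cauchy)"

definition marginal :: "real \<Rightarrow> real \<Rightarrow> ennreal" where
  "marginal \<tau> x = (\<integral>\<^sup>+ \<theta>. ennreal (std_normal_density (x - \<theta>)) * horseshoe_density \<tau> \<theta> \<partial>lborel)"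

text \<open>The version of the conditional law given by Bayes' formula, defined for every \<open>x\<close>;
  see \<open>posterior_disintegration\<close> below.\<close>

definition posterior :: "real \<Rightarrow> real \<Rightarrow> real measure" where
  "posterior \<tau> x = density (horseshoe \<tau>) (\<lambda>\<theta>. ennreal (std_normal_density (x - \<theta>)) / marginal \<tau> x)"

definition s_value :: "real \<Rightarrow> real \<Rightarrow> real" where
  "s_value x \<tau> = 2 * min (measure (posterior \<tau> x) {..<0}) (measure (posterior \<tau> x) {0<..})"

text \<open>A maximizer need not be unique, so an MMLE is any measurable choice of a maximizer
  (measurability is needed for the risks below to be genuine expectations).\<close>

definition is_mmle :: "nat \<Rightarrow> ((nat \<Rightarrow> real) \<Rightarrow> real) \<Rightarrow> bool" where
  "is_mmle n \<tau>h \<longleftrightarrow>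
     \<tau>h \<in> borel_measurable (\<Pi>\<^sub>M i\<in>{..<n}. borel) \<and>
     (\<forall>X\<in>{..<n} \<rightarrow>\<^sub>E UNIV.
        is_arg_max (\<lambda>\<tau>. \<Prod>i<n. marginal \<tau> (X i)) (\<lambda>\<tau>. \<tau> \<in> {1 / real n..1}) (\<tau>h X))"

definition s_procedure :: "((nat \<Rightarrow> real) \<Rightarrow> real) \<Rightarrow> real \<Rightarrow> (nat \<Rightarrow> real) \<Rightarrow> nat \<Rightarrow> bool" where
  "s_procedure \<tau>h t X i \<longleftrightarrow> s_value (X i) (\<tau>h X) < t"

definition FDR :: "nat \<Rightarrow> (nat \<Rightarrow> real) \<Rightarrow> ((nat \<Rightarrow> real) \<Rightarrow> nat \<Rightarrow> bool) \<Rightarrow> real" where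
  "FDR n \<theta> \<phi> = (\<integral>X. real (card {i. i < n \<and> \<theta> i = 0 \<and> \<phi> X i})
       / max 1 (real (card {i. i < n \<and> \<phi> X i})) \<partial>seq_law n \<theta>)"

definition FNR :: "nat \<Rightarrow> (nat \<Rightarrow> real) \<Rightarrow> ((nat \<Rightarrow> real) \<Rightarrow> nat \<Rightarrow> bool) \<Rightarrow> real" where
  "FNR n \<theta> \<phi> = (\<integral>X. real (card {i. i < n \<and> \<theta> i \<noteq> 0 \<and> \<not> \<phi> X i})
       / max 1 (real (card {i. i < n \<and> \<theta> i \<noteq> 0})) \<partial>seq_law n \<theta>)"

lemma normal_density_measurable2 [measurable]:
  "(\<lambda>(s, x). normal_density m (s * \<tau>) x) \<in> borel_measurable (borel \<Otimes>\<^sub>M borel)"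
  unfolding normal_density_def by measurable

lemma sets_half_cauchy [measurable_cong, simp]: "sets half_cauchy = sets borel"
  and space_half_cauchy [simp]: "space half_cauchy = UNIV"
  by (simp_all add: half_cauchy_def)

lemma sets_normal_law [measurable_cong, simp]: "sets (normal_law m \<sigma>) = sets borel"
  and space_normal_law [simp]: "space (normal_law m \<sigma>) = UNIV"
  by (simp_all add: normal_law_def)

lemma prob_space_half_cauchy: "prob_space half_cauchy"
proof
  have lim: "((\<lambda>l. 2 / pi * arctan l) \<longlongrightarrow> 1) at_top"
    using tendsto_mult[OF tendsto_const[of "2 / pi"] tendsto_arctan_at_top] by simp
  have deriv: "((\<lambda>l. 2 / pi * arctan l) has_real_derivative 2 / (pi * (1 + x\<^sup>2))) (at x)" for x
  proof -
    have "2 / (pi * (1 + x\<^sup>2)) = 2 / pi * inverse (1 + x\<^sup>2)"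
      by (simp only: divide_inverse inverse_mult_distrib mult.assoc)
    with DERIV_cmult[OF DERIV_arctan[of x], of "2 / pi"] show ?thesis
      by (simp only:)
  qed
  have meas: "(\<lambda>l::real. 2 / (pi * (1 + l\<^sup>2))) \<in> borel_measurable borel"
    by measurable
  have nonneg: "0 \<le> 2 / (pi * (1 + l\<^sup>2))" for l :: real
    by simp
  have "emeasure half_cauchy (space half_cauchy)
      = (\<integral>\<^sup>+ l. ennreal (indicator {0<..} l * (2 / (pi * (1 + l\<^sup>2)))) \<partial>lborel)"
    by (simp add: half_cauchy_def emeasure_density)
  also have "\<dots> = (\<integral>\<^sup>+ l. ennreal (2 / (pi * (1 + l\<^sup>2))) * indicator {0..} l \<partial>lborel)"
  proof (rule nn_integral_cong_AE, rule eventually_mono[OF AE_lborel_singleton[of "0::real"]])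
    fix l :: real
    assume "l \<noteq> 0"
    then show "ennreal (indicator {0<..} l * (2 / (pi * (1 + l\<^sup>2))))
        = ennreal (2 / (pi * (1 + l\<^sup>2))) * indicator {0..} l"
      by (cases "l > 0") auto
  qed
  also have "\<dots> = ennreal (1 - 2 / pi * arctan 0)"
    by (rule nn_integral_FTC_atLeast[OF meas deriv nonneg lim])
  finally show "emeasure half_cauchy (space half_cauchy) = 1"
    by simp
qed

text \<open>At \<open>l = 0\<close> the kernel is the zero measure, hence only subprobability; this is a null set.\<close>

lemma normal_kernel: "(\<lambda>l. normal_law 0 (l * \<tau>)) \<in> half_cauchy \<rightarrow>\<^sub>M subprob_algebra borel"
proof (rule measurable_subprob_algebra)
  fix l :: real
  show "subprob_space (normal_law 0 (l * \<tau>))"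
  proof (cases "l * \<tau> = 0")
    case True
    then show ?thesis
      by (intro subprob_spaceI) (auto simp: normal_law_def emeasure_density normal_density_def)
  next
    case False
    have "normal_density 0 (l * \<tau>) = normal_density 0 \<bar>l * \<tau>\<bar>"
      by (simp add: normal_density_def fun_eq_iff)
    with False show ?thesis
      using prob_space_normal_density[of "\<bar>l * \<tau>\<bar>" 0]
      by (simp add: normal_law_def prob_space_imp_subprob_space)
  qed
next
  fix A :: "real set" assume [measurable]: "A \<in> sets borel"
  show "(\<lambda>l. emeasure (normal_law 0 (l * \<tau>)) A) \<in> borel_measurable half_cauchy"
    by (simp add: normal_law_def emeasure_density)
qed simp

lemma horseshoe_density_measurable [measurable]: "horseshoe_density \<tau> \<in> borel_measurable borel"
proof -
  interpret prob_space half_cauchy by (rule prob_space_half_cauchy)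
  show ?thesis
    unfolding horseshoe_density_def by measurable
qed

lemma horseshoe_eq_density: "horseshoe \<tau> = density lborel (horseshoe_density \<tau>)"
proof (rule measure_eqI)
  show sets: "sets (horseshoe \<tau>) = sets (density lborel (horseshoe_density \<tau>))"
    unfolding horseshoe_def by (subst sets_bind[where N = borel]) auto
  interpret C: prob_space half_cauchy by (rule prob_space_half_cauchy)
  interpret pair_sigma_finite half_cauchy lborel ..
  fix A assume "A \<in> sets (horseshoe \<tau>)"
  with sets have [measurable]: "A \<in> sets borel" by simp
  have "emeasure (horseshoe \<tau>) A = (\<integral>\<^sup>+ l. emeasure (normal_law 0 (l * \<tau>)) A \<partial>half_cauchy)"
    unfolding horseshoe_def by (rule emeasure_bind[OF _ normal_kernel]) auto
  also have "\<dots> = (\<integral>\<^sup>+ l. \<integral>\<^sup>+ x. ennreal (normal_density 0 (l * \<tau>) x) * indicator A x \<partial>lborel \<partial>half_cauchy)"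
    by (simp add: normal_law_def emeasure_density)
  also have "\<dots> = (\<integral>\<^sup>+ x. \<integral>\<^sup>+ l. ennreal (normal_density 0 (l * \<tau>) x) * indicator A x \<partial>half_cauchy \<partial>lborel)"
    by (rule Fubini'[symmetric]) measurable
  also have "\<dots> = emeasure (density lborel (horseshoe_density \<tau>)) A"
    by (simp add: emeasure_density horseshoe_density_def nn_integral_multc)
  finally show "emeasure (horseshoe \<tau>) A = emeasure (density lborel (horseshoe_density \<tau>)) A" .
qed

lemma sets_horseshoe [measurable_cong, simp]: "sets (horseshoe \<tau>) = sets borel"
  and space_horseshoe [simp]: "space (horseshoe \<tau>) = UNIV"
  by (simp_all add: horseshoe_eq_density)

lemma prob_space_horseshoe:
  assumes "\<tau> > 0"
  shows "prob_space (horseshoe \<tau>)"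
proof
  have "AE l in half_cauchy. 0 < l"
    unfolding half_cauchy_def by (subst AE_density) (auto simp: indicator_def)
  then have "AE l in half_cauchy. emeasure (normal_law 0 (l * \<tau>)) UNIV = 1"
  proof (rule eventually_mono)
    fix l :: real assume "0 < l"
    with assms have "prob_space (normal_law 0 (l * \<tau>))"
      unfolding normal_law_def by (intro prob_space_normal_density) simp
    from prob_space.emeasure_space_1[OF this]
    show "emeasure (normal_law 0 (l * \<tau>)) UNIV = 1" by simp
  qed
  then have "(\<integral>\<^sup>+ l. emeasure (normal_law 0 (l * \<tau>)) UNIV \<partial>half_cauchy) = (\<integral>\<^sup>+ l. 1 \<partial>half_cauchy)"
    by (rule nn_integral_cong_AE)
  also have "\<dots> = 1"
    using prob_space.emeasure_space_1[OF prob_space_half_cauchy] by simp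
  finally have *: "(\<integral>\<^sup>+ l. emeasure (normal_law 0 (l * \<tau>)) UNIV \<partial>half_cauchy) = 1" .
  have "emeasure (horseshoe \<tau>) UNIV = (\<integral>\<^sup>+ l. emeasure (normal_law 0 (l * \<tau>)) UNIV \<partial>half_cauchy)"
    unfolding horseshoe_def by (rule emeasure_bind[OF _ normal_kernel]) auto
  with * show "emeasure (horseshoe \<tau>) (space (horseshoe \<tau>)) = 1" by simp
qed

lemma marginal_eq: "marginal \<tau> x = (\<integral>\<^sup>+ \<theta>. ennreal (std_normal_density (x - \<theta>)) \<partial>horseshoe \<tau>)"
  by (simp add: marginal_def horseshoe_eq_density nn_integral_density mult.commute)

lemma marginal_pos_finite:
  assumes "\<tau> > 0"
  shows "marginal \<tau> x \<noteq> 0" "marginal \<tau> x \<noteq> \<infinity>"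
proof -
  interpret prob_space "horseshoe \<tau>" by (rule prob_space_horseshoe[OF assms])
  have "std_normal_density y \<le> 1" for y
  proof -
    have "1 \<le> sqrt (2 * pi)" using pi_gt3 by simp
    then have "1 / sqrt (2 * pi) * exp (- y\<^sup>2 / 2) \<le> 1 * 1"
      by (intro mult_mono) (auto simp: divide_le_eq)
    then show ?thesis
      unfolding std_normal_density_def by simp
  qed
  then have "marginal \<tau> x \<le> (\<integral>\<^sup>+ \<theta>. 1 \<partial>horseshoe \<tau>)"
    unfolding marginal_eq by (intro nn_integral_mono) simp
  also have "\<dots> = 1" using emeasure_space_1 by simp
  finally show "marginal \<tau> x \<noteq> \<infinity>" by (auto simp: top_unique)
  show "marginal \<tau> x \<noteq> 0"
  proof
    assume "marginal \<tau> x = 0"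
    then have "AE \<theta> in horseshoe \<tau>. ennreal (std_normal_density (x - \<theta>)) = 0"
      unfolding marginal_eq by (subst (asm) nn_integral_0_iff_AE) auto
    then have "AE \<theta> in horseshoe \<tau>. False"
    proof (rule eventually_mono)
      fix \<theta>
      have "0 < std_normal_density (x - \<theta>)" by (rule normal_density_pos) simp
      moreover assume "ennreal (std_normal_density (x - \<theta>)) = 0"
      ultimately show False by (simp add: ennreal_eq_0_iff)
    qed
    then show False by simp
  qed
qed

text \<open>Hence \<open>marginal \<tau>\<close> is the density of \<open>X\<^sub>1\<close> in the Bayesian model and \<open>posterior \<tau>\<close> is a
  regular conditional distribution of the parameter given \<open>X\<^sub>1\<close>.\<close>

lemma posterior_disintegration:
  assumes "\<tau> > 0" and [measurable]: "A \<in> sets borel" "B \<in> sets borel"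
  shows "(\<integral>\<^sup>+ \<theta>. emeasure (normal_law \<theta> 1) A * indicator B \<theta> \<partial>horseshoe \<tau>)
    = (\<integral>\<^sup>+ x. emeasure (posterior \<tau> x) B * indicator A x * marginal \<tau> x \<partial>lborel)"
proof -
  interpret P: prob_space "horseshoe \<tau>" by (rule prob_space_horseshoe[OF assms(1)])
  interpret pair_sigma_finite "horseshoe \<tau>" lborel ..
  have law: "emeasure (normal_law \<theta> 1) A
      = (\<integral>\<^sup>+ x. ennreal (std_normal_density (x - \<theta>)) * indicator A x \<partial>lborel)" for \<theta>
    by (simp add: normal_law_def emeasure_density normal_density_def)
  have post: "emeasure (posterior \<tau> x) B * marginal \<tau> x
      = (\<integral>\<^sup>+ \<theta>. ennreal (std_normal_density (x - \<theta>)) * indicator B \<theta> \<partial>horseshoe \<tau>)" for x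
  proof -
    have "a / marginal \<tau> x * c * marginal \<tau> x = a * c" for a c
    proof -
      have "a / marginal \<tau> x * c * marginal \<tau> x = a * c * (inverse (marginal \<tau> x) * marginal \<tau> x)"
        by (simp add: divide_ennreal_def mult_ac)
      also have "inverse (marginal \<tau> x) * marginal \<tau> x = marginal \<tau> x / marginal \<tau> x"
        unfolding divide_ennreal_def by (rule mult.commute)
      also have "\<dots> = 1"
        using marginal_pos_finite[OF assms(1), of x] by (intro ennreal_divide_self) (auto simp: less_top)
      finally show ?thesis by simp
    qed
    moreover have "emeasure (posterior \<tau> x) B * marginal \<tau> x
      = (\<integral>\<^sup>+ \<theta>. ennreal (std_normal_density (x - \<theta>)) / marginal \<tau> x * indicator B \<theta> * marginal \<tau> x \<partial>horseshoe \<tau>)"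
      unfolding posterior_def by (subst emeasure_density) (auto simp: nn_integral_multc)
    ultimately show ?thesis by simp
  qed
  have "(\<integral>\<^sup>+ \<theta>. emeasure (normal_law \<theta> 1) A * indicator B \<theta> \<partial>horseshoe \<tau>)
     = (\<integral>\<^sup>+ \<theta>. \<integral>\<^sup>+ x. ennreal (std_normal_density (x - \<theta>)) * indicator A x * indicator B \<theta> \<partial>lborel \<partial>horseshoe \<tau>)"
    by (simp add: law nn_integral_multc)
  also have "\<dots> = (\<integral>\<^sup>+ x. \<integral>\<^sup>+ \<theta>. ennreal (std_normal_density (x - \<theta>)) * indicator A x * indicator B \<theta> \<partial>horseshoe \<tau> \<partial>lborel)"
    by (rule Fubini'[symmetric]) measurable
  also have "\<dots> = (\<integral>\<^sup>+ x. (\<integral>\<^sup>+ \<theta>. ennreal (std_normal_density (x - \<theta>)) * indicator B \<theta> \<partial>horseshoe \<tau>) * indicator A x \<partial>lborel)"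
  proof (rule nn_integral_cong)
    fix x :: real
    show "(\<integral>\<^sup>+ \<theta>. ennreal (std_normal_density (x - \<theta>)) * indicator A x * indicator B \<theta> \<partial>horseshoe \<tau>)
        = (\<integral>\<^sup>+ \<theta>. ennreal (std_normal_density (x - \<theta>)) * indicator B \<theta> \<partial>horseshoe \<tau>) * indicator A x"
      by (subst nn_integral_multc[symmetric]) (simp_all add: mult_ac)
  qed
  also have "\<dots> = (\<integral>\<^sup>+ x. emeasure (posterior \<tau> x) B * indicator A x * marginal \<tau> x \<partial>lborel)"
    by (intro nn_integral_cong) (subst post[symmetric], simp add: mult_ac)
  finally show ?thesis .
qed

end

theory Submission
  imports Defs "HOL-Real_Asymp.Real_Asymp"
begin

text \<open>
  Write \<open>L = ln (n / s)\<close>, \<open>T = sqrt (2 * L)\<close>, and let \<open>g \<tau> x\<close> be the marginal density of an observation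
  divided by the standard normal density. It suffices to show that, with high probability and uniformly
  over the class, the estimated scale lies between \<open>s / n\<close> times a constant and \<open>s / n\<close> times
  \<open>R = L powr (3 / 4)\<close>. Since \<open>g \<tau> x\<close> is comparable to \<open>1 + \<tau> / (x\<^sup>2 * \<phi> x)\<close> and the
  \<open>s\<close>-value is close to \<open>1 / g \<tau> x\<close>, the rejection threshold then lies between \<open>T\<close> and \<open>T + \<delta>\<close> for every
  \<open>\<delta> > 0\<close>: at most about \<open>s / T\<close> nulls and a positive fraction of the signals are rejected, and a signal
  of size \<open>T + b\<close> is missed with probability tending to \<open>Phi_bar b\<close>.

  The lower bound on the scale is deterministic given a positive fraction of large signals, because
  \<open>\<tau> \<mapsto> exp (150 * \<tau>) * g \<tau> x\<close> is nondecreasing for every \<open>x\<close>. The upper bound compares with the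
  scale \<open>s / n\<close>: the mean of \<open>sqrt (g \<tau> X)\<close> under the null is at most \<open>exp (- c * \<tau> / sqrt L)\<close>, so
  a Chernoff bound applies at each multiple of \<open>s / n\<close>, and the same monotonicity makes this grid fine enough.
\<close>

section \<open>The marginal density as a scale mixture\<close>

text \<open>Any exponent strictly between 1/2 and 1 would serve for \<open>R\<close>. At scale j * s
  / n the nulls lose about s * j / sqrt L in log-likelihood, while the signals may gain s * ln j; so
  \<open>R\<close> has to exceed a constant times sqrt L * ln L. On the other side, x^2 * \<phi> x
  is of order L * s / n at x = T, so a scale up to a small multiple of L * s / n still leaves every
  |x| \<le> T unrejected. This gap is why a crude localisation of the maximiser suffices. The false
  discovery rate then vanishes because the threshold stays above T; it is not held at a value
  determined by t.

  The marginal has tails of order 1 / x^2, so under the null g has mean 1 but no finite moment of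
  order above 1. This forces an exponent below 1 in the Chernoff bound, whence the square root. No
  score equation is studied: the maximiser is compared only with the scale s / n and with a constant
  fraction of it, through inequalities between scales that hold for every single
  observation.\<close>

definition half_cauchy_density :: "real \<Rightarrow> real \<Rightarrow> real" where
  "half_cauchy_density \<tau> v = (if 0 < v then 2 * \<tau> / (pi * (\<tau>\<^sup>2 + v\<^sup>2)) else 0)"

text \<open>The likelihood ratio at \<open>x\<close> of N(0, 1 + v^2) against N(0, 1).\<close>

definition scale_ratio :: "real \<Rightarrow> real \<Rightarrow> real" where
  "scale_ratio x v = exp (x\<^sup>2 * v\<^sup>2 / (2 * (1 + v\<^sup>2))) / sqrt (1 + v\<^sup>2)"

text \<open>The Bayes factor of the horseshoe model against the null. It is a real number although
  the prior density is infinite at 0, so ordinary real inequalities apply to it.\<close>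

definition marginal_ratio :: "real \<Rightarrow> real \<Rightarrow> real" where
  "marginal_ratio \<tau> x = (\<integral>v. half_cauchy_density \<tau> v * scale_ratio x v \<partial>lborel)"

lemma half_cauchy_density_measurable [measurable]:
  "(\<lambda>(\<tau>, v). half_cauchy_density \<tau> v) \<in> borel_measurable (borel \<Otimes>\<^sub>M borel)"
  unfolding half_cauchy_density_def by measurable

lemma half_cauchy_density_nonneg: "0 \<le> \<tau> \<Longrightarrow> 0 \<le> half_cauchy_density \<tau> v"
  by (simp add: half_cauchy_density_def)

lemma scale_ratio_measurable [measurable]:
  "(\<lambda>(x, v). scale_ratio x v) \<in> borel_measurable (borel \<Otimes>\<^sub>M borel)"
  unfolding scale_ratio_def by measurable

lemma one_plus_square_pos: "0 < 1 + v\<^sup>2" for v :: real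
  by (simp add: add_pos_nonneg)

lemma scale_ratio_pos: "0 < scale_ratio x v"
  by (simp add: scale_ratio_def one_plus_square_pos)

lemma scale_ratio_le: "scale_ratio x v \<le> exp (x\<^sup>2 / 2)"
proof -
  have "x\<^sup>2 * v\<^sup>2 / (2 * (1 + v\<^sup>2)) \<le> x\<^sup>2 / 2"
    using one_plus_square_pos[of v] by (simp add: field_simps)
  moreover have "1 \<le> sqrt (1 + v\<^sup>2)" by simp
  ultimately have "scale_ratio x v \<le> exp (x\<^sup>2 / 2) / 1"
    unfolding scale_ratio_def by (intro frac_le) auto
  then show ?thesis by simp
qed

lemma normal_density_scale_ratio:
  "normal_density 0 (sqrt (1 + v\<^sup>2)) x = std_normal_density x * scale_ratio x v"
proof -
  have "- x\<^sup>2 / (2 * (1 + v\<^sup>2)) = - x\<^sup>2 / 2 + x\<^sup>2 * v\<^sup>2 / (2 * (1 + v\<^sup>2))"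
    using one_plus_square_pos[of v] by (simp add: field_simps)
  then show ?thesis
    by (simp add: normal_density_def scale_ratio_def real_sqrt_mult flip: exp_add)
qed

lemma half_cauchy_density_rescale:
  assumes "0 < \<tau>"
  shows "\<tau> * half_cauchy_density \<tau> (l * \<tau>) = indicator {0<..} l * (2 / (pi * (1 + l\<^sup>2)))"
proof -
  have "\<tau>\<^sup>2 + (l * \<tau>)\<^sup>2 = \<tau> * (\<tau> * (1 + l\<^sup>2))" by (simp add: power2_eq_square algebra_simps)
  then show ?thesis
    using assms one_plus_square_pos[of l]
    by (simp add: half_cauchy_density_def zero_less_mult_iff indicator_def)
qed

lemma nn_integral_half_cauchy_rescale:
  assumes "0 < \<tau>" and [measurable]: "f \<in> borel_measurable borel"
  shows "(\<integral>\<^sup>+ l. f (l * \<tau>) \<partial>half_cauchy) = (\<integral>\<^sup>+ v. ennreal (half_cauchy_density \<tau> v) * f v \<partial>lborel)"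
proof -
  have "(\<integral>\<^sup>+ v. ennreal (half_cauchy_density \<tau> v) * f v \<partial>lborel)
      = ennreal \<bar>\<tau>\<bar> * (\<integral>\<^sup>+ l. ennreal (half_cauchy_density \<tau> (0 + \<tau> * l)) * f (0 + \<tau> * l) \<partial>lborel)"
    using assms by (intro nn_integral_real_affine) auto
  also have "\<dots> = (\<integral>\<^sup>+ l. ennreal (\<tau> * half_cauchy_density \<tau> (l * \<tau>)) * f (l * \<tau>) \<partial>lborel)"
    using assms half_cauchy_density_nonneg[of \<tau>]
    by (subst nn_integral_cmult[symmetric]) (simp_all add: ennreal_mult mult_ac)
  also have "\<dots> = (\<integral>\<^sup>+ l. f (l * \<tau>) \<partial>half_cauchy)"
    by (simp add: half_cauchy_density_rescale[OF assms(1)] half_cauchy_def nn_integral_density mult.commute)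
  finally show ?thesis by simp
qed

lemma nn_integral_half_cauchy_density:
  assumes "0 < \<tau>"
  shows "(\<integral>\<^sup>+ v. ennreal (half_cauchy_density \<tau> v) \<partial>lborel) = 1"
  using nn_integral_half_cauchy_rescale[OF assms, of "\<lambda>_. 1"]
    prob_space.emeasure_space_1[OF prob_space_half_cauchy] by simp

lemma integrable_half_cauchy_density: "0 < \<tau> \<Longrightarrow> integrable lborel (half_cauchy_density \<tau>)"
  by (intro integrableI_nn_integral_finite[where x=1])
    (auto simp: nn_integral_half_cauchy_density half_cauchy_density_nonneg)

lemma integral_half_cauchy_density: "0 < \<tau> \<Longrightarrow> (\<integral>v. half_cauchy_density \<tau> v \<partial>lborel) = 1"
  by (subst integral_eq_nn_integral)
    (auto simp: nn_integral_half_cauchy_density half_cauchy_density_nonneg)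

lemma integrable_marginal_ratio:
  assumes "0 < \<tau>"
  shows "integrable lborel (\<lambda>v. half_cauchy_density \<tau> v * scale_ratio x v)"
proof (rule Bochner_Integration.integrable_bound)
  show "integrable lborel (\<lambda>v. half_cauchy_density \<tau> v * exp (x\<^sup>2 / 2))"
    using integrable_half_cauchy_density[OF assms] by simp
  show "AE v in lborel. norm (half_cauchy_density \<tau> v * scale_ratio x v)
      \<le> norm (half_cauchy_density \<tau> v * exp (x\<^sup>2 / 2))"
    using assms scale_ratio_le[of x] scale_ratio_pos[of x]
    by (auto simp: abs_mult half_cauchy_density_nonneg less_imp_le intro!: mult_left_mono)
qed simp

lemma nn_integral_marginal_ratio:
  assumes "0 < \<tau>"
  shows "(\<integral>\<^sup>+ v. ennreal (half_cauchy_density \<tau> v) * ennreal (scale_ratio x v) \<partial>lborel)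
    = ennreal (marginal_ratio \<tau> x)"
  unfolding marginal_ratio_def using assms scale_ratio_pos[of x]
  by (subst nn_integral_eq_integral[OF integrable_marginal_ratio, symmetric])
    (auto simp: half_cauchy_density_nonneg less_imp_le ennreal_mult)

text \<open>Integrating over the parameter before the local scale avoids the singularity of the
  prior density at 0: for a fixed scale, two centred normal densities convolve to a normal
  density.\<close>

lemma marginal_eq_ratio:
  assumes "0 < \<tau>"
  shows "marginal \<tau> x = ennreal (std_normal_density x * marginal_ratio \<tau> x)"
proof -
  interpret C: prob_space half_cauchy by (rule prob_space_half_cauchy)
  interpret pair_sigma_finite half_cauchy lborel ..
  have "marginal \<tau> x = (\<integral>\<^sup>+ \<theta>. \<integral>\<^sup>+ l. ennreal (std_normal_density (x - \<theta>)) * ennreal (normal_density 0 (l * \<tau>) \<theta>)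
      \<partial>half_cauchy \<partial>lborel)"
    unfolding marginal_def horseshoe_density_def by (simp add: nn_integral_cmult)
  also have "\<dots> = (\<integral>\<^sup>+ l. \<integral>\<^sup>+ \<theta>. ennreal (std_normal_density (x - \<theta>)) * ennreal (normal_density 0 (l * \<tau>) \<theta>)
      \<partial>lborel \<partial>half_cauchy)"
    by (rule Fubini') measurable
  also have "\<dots> = (\<integral>\<^sup>+ l. ennreal (std_normal_density x) * ennreal (scale_ratio x (l * \<tau>)) \<partial>half_cauchy)"
  proof (rule nn_integral_cong_AE)
    \<comment> \<open>At l = 0 the kernel is degenerate, so the convolution identity is claimed only
      almost everywhere.\<close>
    have "AE l in half_cauchy. 0 < l"
      unfolding half_cauchy_def by (subst AE_density) (auto simp: indicator_def)
    then show "AE l in half_cauchy.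
        (\<integral>\<^sup>+ \<theta>. ennreal (std_normal_density (x - \<theta>)) * ennreal (normal_density 0 (l * \<tau>) \<theta>) \<partial>lborel)
        = ennreal (std_normal_density x) * ennreal (scale_ratio x (l * \<tau>))"
    proof (rule eventually_mono)
      fix l :: real assume "0 < l"
      then have "0 < l * \<tau>" using assms by simp
      from fun_cong[OF conv_normal_density_zero_mean[OF zero_less_one this], of x]
      show "(\<integral>\<^sup>+ \<theta>. ennreal (std_normal_density (x - \<theta>)) * ennreal (normal_density 0 (l * \<tau>) \<theta>) \<partial>lborel)
        = ennreal (std_normal_density x) * ennreal (scale_ratio x (l * \<tau>))"
        using normal_density_scale_ratio[of "l * \<tau>" x] scale_ratio_pos[of x "l * \<tau>"]
        by (simp add: ennreal_mult less_imp_le)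
    qed
  qed
  also have "\<dots> = ennreal (std_normal_density x) * (\<integral>\<^sup>+ l. ennreal (scale_ratio x (l * \<tau>)) \<partial>half_cauchy)"
    by (rule nn_integral_cmult) simp
  also have "\<dots> = ennreal (std_normal_density x) * ennreal (marginal_ratio \<tau> x)"
    using nn_integral_half_cauchy_rescale[OF assms, of "\<lambda>v. ennreal (scale_ratio x v)"]
    by (simp add: nn_integral_marginal_ratio[OF assms])
  finally show ?thesis
    by (simp add: ennreal_mult')
qed

lemma marginal_ratio_pos:
  assumes "0 < \<tau>"
  shows "0 < marginal_ratio \<tau> x"
proof (rule ccontr)
  assume "\<not> ?thesis"
  then have "std_normal_density x * marginal_ratio \<tau> x \<le> 0"
    by (intro mult_nonneg_nonpos) auto
  then show False
    using marginal_pos_finite(1)[OF assms, of x] by (simp add: marginal_eq_ratio[OF assms] ennreal_neg)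
qed

lemma marginal_ratio_measurable [measurable]: "marginal_ratio \<tau> \<in> borel_measurable borel"
  unfolding marginal_ratio_def by measurable

text \<open>Integrating over the observation first leaves the total mass of the prior. The Bayes
  factor therefore has mean 1 under the null, as the Hellinger bound requires.\<close>

lemma integral_marginal_ratio:
  assumes "0 < \<tau>"
  shows "(\<integral>\<^sup>+ x. ennreal (std_normal_density x * marginal_ratio \<tau> x) \<partial>lborel) = 1"
proof -
  interpret P: prob_space "horseshoe \<tau>" by (rule prob_space_horseshoe[OF assms])
  interpret pair_sigma_finite "horseshoe \<tau>" lborel ..
  have "(\<integral>\<^sup>+ x. ennreal (std_normal_density (x - \<theta>)) \<partial>lborel) = 1" for \<theta>
    using prob_space.emeasure_space_1[OF prob_space_normal_density[of 1 \<theta>]]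
    by (simp add: emeasure_density normal_density_def)
  moreover have "(\<integral>\<^sup>+ x. marginal \<tau> x \<partial>lborel)
      = (\<integral>\<^sup>+ \<theta>. \<integral>\<^sup>+ x. ennreal (std_normal_density (x - \<theta>)) \<partial>lborel \<partial>horseshoe \<tau>)"
    unfolding marginal_eq by (rule Fubini') measurable
  ultimately show ?thesis
    using P.emeasure_space_1 by (simp add: marginal_eq_ratio[OF assms])
qed

section \<open>Bounds on the marginal density\<close>

lemma sqrt_le_self: "1 \<le> x \<Longrightarrow> sqrt x \<le> x" for x :: real
  by (intro real_le_lsqrt) (auto simp: power2_eq_square mult_le_cancel_left1)

text \<open>The scale ratio is at least 1 / (1 + v^2) for every x, and the loss v^2 / (1 + v^2)
  turns the half-Cauchy density of scale \<tau> into at most \<tau> times the one of scale 1, which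
  has mass 1.\<close>

lemma marginal_ratio_ge:
  assumes "0 < \<tau>"
  shows "1 - \<tau> \<le> marginal_ratio \<tau> x"
proof -
  have "(\<integral>v. half_cauchy_density \<tau> v - \<tau> * half_cauchy_density 1 v \<partial>lborel) \<le> marginal_ratio \<tau> x"
    unfolding marginal_ratio_def
  proof (rule integral_mono)
    show "integrable lborel (\<lambda>v. half_cauchy_density \<tau> v - \<tau> * half_cauchy_density 1 v)"
      using assms by (intro Bochner_Integration.integrable_diff integrable_mult_right integrable_half_cauchy_density) auto
    show "integrable lborel (\<lambda>v. half_cauchy_density \<tau> v * scale_ratio x v)"
      by (rule integrable_marginal_ratio[OF assms])
    fix v :: real
    show "half_cauchy_density \<tau> v - \<tau> * half_cauchy_density 1 v \<le> half_cauchy_density \<tau> v * scale_ratio x v"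
    proof (cases "0 < v")
      case True
      define w where "w = 1 + v\<^sup>2"
      have w: "1 \<le> w" "sqrt w \<le> w" "0 < w"
        by (auto simp: w_def add_pos_nonneg intro!: sqrt_le_self)
      have "1 / w \<le> 1 / sqrt w" using w by (intro divide_left_mono) auto
      also have "\<dots> \<le> scale_ratio x v"
        unfolding scale_ratio_def w_def[symmetric] using w by (intro divide_right_mono) auto
      finally have "half_cauchy_density \<tau> v * (1 / w) \<le> half_cauchy_density \<tau> v * scale_ratio x v"
        using assms by (intro mult_left_mono half_cauchy_density_nonneg) auto
      moreover have "half_cauchy_density \<tau> v - \<tau> * half_cauchy_density 1 v \<le> half_cauchy_density \<tau> v * (1 / w)"
      proof -
        define a where "a = \<tau>\<^sup>2 + v\<^sup>2"
        have a: "0 < a" "1 - w + a = \<tau>\<^sup>2" using True assms by (simp_all add: a_def w_def add_pos_pos)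
        have "half_cauchy_density \<tau> v * (1 / w) - (half_cauchy_density \<tau> v - \<tau> * half_cauchy_density 1 v)
          = 2 * \<tau> / pi * (1 / (a * w) - 1 / a + 1 / w)"
          unfolding half_cauchy_density_def using True
          by (simp add: a_def[symmetric] w_def[symmetric] right_diff_distrib distrib_left mult_ac)
        also have "1 / (a * w) - 1 / a + 1 / w = (1 - w + a) / (a * w)"
          using a(1) w by (simp add: field_simps)
        also have "2 * \<tau> / pi * \<dots> \<ge> 0" unfolding a(2) using a(1) w assms by simp
        finally show ?thesis by simp
      qed
      ultimately show ?thesis by linarith
    qed (simp add: half_cauchy_density_def)
  qed
  then show ?thesis
    using assms by (simp add: integral_half_cauchy_density integrable_half_cauchy_density)
qed

text \<open>\<open>half_cauchy_density \<tau> v / \<tau>\<close> decreases in \<tau>, so enlarging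
  the scale gains at most proportionally. This caps what a signal can contribute to a likelihood
  ratio, however large it is.\<close>

lemma marginal_ratio_log_lipschitz:
  assumes "0 < \<tau>" "\<tau> \<le> \<tau>'"
  shows "marginal_ratio \<tau>' x \<le> \<tau>' / \<tau> * marginal_ratio \<tau> x"
proof -
  have "half_cauchy_density \<tau>' v \<le> \<tau>' / \<tau> * half_cauchy_density \<tau> v" for v
  proof (cases "0 < v")
    case True
    then have p: "0 < \<tau>\<^sup>2 + v\<^sup>2" using assms by (simp add: add_pos_pos)
    have "\<tau>\<^sup>2 \<le> \<tau>'\<^sup>2" using assms by (simp add: power_mono)
    moreover have "0 < \<tau>'\<^sup>2 + v\<^sup>2" using True assms by (simp add: add_pos_pos)
    ultimately have "2 * \<tau>' / (pi * (\<tau>'\<^sup>2 + v\<^sup>2)) \<le> 2 * \<tau>' / (pi * (\<tau>\<^sup>2 + v\<^sup>2))"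
      using p assms by (intro divide_left_mono mult_left_mono mult_pos_pos) auto
    then show ?thesis
      using True assms by (simp add: half_cauchy_density_def mult.commute)
  qed (simp add: half_cauchy_density_def)
  then have "marginal_ratio \<tau>' x \<le> (\<integral>v. \<tau>' / \<tau> * half_cauchy_density \<tau> v * scale_ratio x v \<partial>lborel)"
    unfolding marginal_ratio_def using assms integrable_marginal_ratio[of \<tau> x] scale_ratio_pos[of x]
    by (intro integral_mono integrable_marginal_ratio mult_right_mono)
      (auto simp: mult.assoc less_imp_le)
  then show ?thesis
    by (simp add: marginal_ratio_def mult.assoc)
qed

section \<open>Almost-monotonicity in the scale\<close>

lemma half_cauchy_density_geI:
  assumes "0 < \<tau>" "0 < v" "pi * (\<tau>\<^sup>2 + v\<^sup>2) \<le> c"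
  shows "2 * \<tau> / c \<le> half_cauchy_density \<tau> v"
proof -
  have "0 < pi * (\<tau>\<^sup>2 + v\<^sup>2)" using assms by (simp add: add_pos_pos)
  with assms(3) have "2 * \<tau> / c \<le> 2 * \<tau> / (pi * (\<tau>\<^sup>2 + v\<^sup>2))"
    using assms(1) by (intro divide_left_mono mult_pos_pos[of c]) auto
  then show ?thesis using assms(2) by (simp add: half_cauchy_density_def)
qed

lemma scale_ratio_mono:
  assumes "0 \<le> u" "u \<le> v"
  shows "scale_ratio x u * sqrt (1 + u\<^sup>2) \<le> scale_ratio x v * sqrt (1 + v\<^sup>2)"
proof -
  have "u\<^sup>2 \<le> v\<^sup>2" using assms by (simp add: power_mono)
  then have "u\<^sup>2 / (1 + u\<^sup>2) \<le> v\<^sup>2 / (1 + v\<^sup>2)"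
    using one_plus_square_pos[of u] one_plus_square_pos[of v]
    by (simp add: divide_le_eq pos_le_divide_eq algebra_simps)
  from mult_left_mono[OF this, of "x\<^sup>2 / 2"]
  have "x\<^sup>2 * u\<^sup>2 / (2 * (1 + u\<^sup>2)) \<le> x\<^sup>2 * v\<^sup>2 / (2 * (1 + v\<^sup>2))" by simp
  then show ?thesis
    using one_plus_square_pos[of u] one_plus_square_pos[of v] by (simp add: scale_ratio_def)
qed

text \<open>The densities of scales \<open>\<tau> \<le> \<tau>'\<close> cross at \<open>sqrt (\<tau> * \<tau>')\<close>. Subtracting from the ratio its value
  there makes the product nonnegative up to a term of order \<open>\<tau>' - \<tau>\<close>, because the ratio is
  increasing up to the factor \<open>1 / sqrt (1 + v\<^sup>2)\<close>.\<close>

lemma crossing_bound: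
  fixes v :: real
  assumes "0 < \<tau>" "\<tau> \<le> \<tau>'" and v0: "0 \<le> v0" "v0\<^sup>2 = \<tau> * \<tau>'"
  shows "- ((\<tau>' - \<tau>) * scale_ratio x v0 * (half_cauchy_density 1 v + \<tau> * half_cauchy_density \<tau> v))
    \<le> (half_cauchy_density \<tau>' v - half_cauchy_density \<tau> v) * (scale_ratio x v - scale_ratio x v0)"
proof (cases "0 < v")
  case True
  let ?q = "scale_ratio x" and ?k = half_cauchy_density
  define P where "P = (\<tau>'\<^sup>2 + v\<^sup>2) * (\<tau>\<^sup>2 + v\<^sup>2)"
  have pos: "0 < \<tau>\<^sup>2 + v\<^sup>2" "0 < \<tau>'\<^sup>2 + v\<^sup>2" using True assms by (simp_all add: add_pos_pos)
  then have P: "0 < P" by (simp add: P_def)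
  have d: "?k \<tau>' v - ?k \<tau> v = 2 * (\<tau>' - \<tau>) / pi * ((v\<^sup>2 - \<tau> * \<tau>') / P)"
  proof -
    have "?k \<tau>' v - ?k \<tau> v = 2 / pi * (\<tau>' / (\<tau>'\<^sup>2 + v\<^sup>2) - \<tau> / (\<tau>\<^sup>2 + v\<^sup>2))"
      using True by (simp add: half_cauchy_density_def right_diff_distrib)
    also have "\<tau>' / (\<tau>'\<^sup>2 + v\<^sup>2) - \<tau> / (\<tau>\<^sup>2 + v\<^sup>2) = (\<tau>' - \<tau>) * (v\<^sup>2 - \<tau> * \<tau>') / P"
      using pos unfolding P_def by (subst diff_frac_eq) (auto simp: power2_eq_square algebra_simps)
    finally show ?thesis by simp
  qed
  have kn: "0 \<le> ?k 1 v" "0 \<le> ?k \<tau> v" using assms by (simp_all add: half_cauchy_density_nonneg)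
  have q0: "0 < ?q v0" by (rule scale_ratio_pos)
  have w: "0 < 1 + v\<^sup>2" "0 < 1 + v0\<^sup>2" by (rule one_plus_square_pos)+
  show ?thesis
  proof (cases "v0 \<le> v")
    \<comment> \<open>Right of the crossing the ratio may drop below its value at \<open>v0\<close>,
      by a factor of at most 1 + v^2. The factor v^2 in the loss cancels against the density
      difference and 1 / (1 + v^2) remains: this is the term with
      \<open>half_cauchy_density 1 v\<close>.\<close>
    case le: True
    then have "v0\<^sup>2 \<le> v\<^sup>2" using v0(1) by (intro power_mono)
    have sq: "sqrt (1 + v\<^sup>2) \<le> (1 + v\<^sup>2)" by (intro sqrt_le_self) simp
    have "?q v0 * 1 \<le> ?q v0 * sqrt (1 + v0\<^sup>2)" using q0 by (intro mult_left_mono) auto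
    also have "\<dots> \<le> ?q v * sqrt (1 + v\<^sup>2)" by (rule scale_ratio_mono[OF v0(1) le])
    also have "\<dots> \<le> ?q v * (1 + v\<^sup>2)" using scale_ratio_pos[of x v] sq by (intro mult_left_mono) auto
    finally have "?q v0 / (1 + v\<^sup>2) \<le> ?q v" using w by (simp add: divide_le_eq)
    then have A: "- (?q v0 * v\<^sup>2 / (1 + v\<^sup>2)) \<le> ?q v - ?q v0"
      using w by (simp add: field_simps)
    have B: "0 \<le> (v\<^sup>2 - \<tau> * \<tau>') / P" using \<open>v0\<^sup>2 \<le> v\<^sup>2\<close> P v0 by simp
    have "v\<^sup>2 * (v\<^sup>2 - \<tau> * \<tau>') \<le> P"
      unfolding P_def using assms by (simp add: algebra_simps)
    then have C: "(v\<^sup>2 - \<tau> * \<tau>') / P * v\<^sup>2 \<le> 1" using P by (simp add: divide_le_eq mult.commute)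
    have "(?k \<tau>' v - ?k \<tau> v) * (?q v - ?q v0) \<ge> 2 * (\<tau>' - \<tau>) / pi * ((v\<^sup>2 - \<tau> * \<tau>') / P) * (- (?q v0 * v\<^sup>2 / (1 + v\<^sup>2)))"
      unfolding d using A B assms by (intro mult_left_mono mult_nonneg_nonneg) auto
    moreover have "2 * (\<tau>' - \<tau>) / pi * ((v\<^sup>2 - \<tau> * \<tau>') / P) * (- (?q v0 * v\<^sup>2 / (1 + v\<^sup>2)))
      = - (((v\<^sup>2 - \<tau> * \<tau>') / P * v\<^sup>2) * (2 * (\<tau>' - \<tau>) / pi * ?q v0 / (1 + v\<^sup>2)))"
      by (simp add: mult_ac del: right_diff_distrib_numeral)
    moreover have "((v\<^sup>2 - \<tau> * \<tau>') / P * v\<^sup>2) * (2 * (\<tau>' - \<tau>) / pi * ?q v0 / (1 + v\<^sup>2))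
        \<le> 1 * (2 * (\<tau>' - \<tau>) / pi * ?q v0 / (1 + v\<^sup>2))"
      using C q0 w assms by (intro mult_right_mono) auto
    moreover have "1 * (2 * (\<tau>' - \<tau>) / pi * ?q v0 / (1 + v\<^sup>2)) = (\<tau>' - \<tau>) * ?q v0 * ?k 1 v"
      using True by (simp add: half_cauchy_density_def)
    moreover have "0 \<le> (\<tau>' - \<tau>) * ?q v0 * (\<tau> * ?k \<tau> v)"
      using kn q0 assms by simp
    ultimately show ?thesis
      unfolding distrib_left by linarith
  next
    \<comment> \<open>Left of the crossing the ratio may exceed its value at \<open>v0\<close>, by a
      factor of at most 1 + \<tau> * \<tau>'. This excess is the term with
      \<open>\<tau> * half_cauchy_density \<tau> v\<close>.\<close>
    case False
    then have le: "v \<le> v0" by simp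
    then have vv: "v\<^sup>2 \<le> v0\<^sup>2" using True by (intro power_mono) auto
    define r where "r = (1 + v0\<^sup>2) / (1 + v\<^sup>2)"
    have r: "1 \<le> r" using vv w by (simp add: r_def)
    have "?q v * sqrt (1 + v\<^sup>2) \<le> ?q v0 * sqrt (1 + v0\<^sup>2)"
      using scale_ratio_mono[OF less_imp_le[OF True] le] .
    then have "?q v \<le> ?q v0 * sqrt r"
      using w by (simp add: r_def real_sqrt_divide field_simps)
    also have "\<dots> \<le> ?q v0 * r"
      using q0 r by (intro mult_left_mono) (auto intro!: sqrt_le_self)
    also have "r \<le> 1 + \<tau> * \<tau>'"
      unfolding r_def v0(2)[symmetric] using w
      by (simp add: divide_le_eq algebra_simps)
    then have "?q v0 * r \<le> ?q v0 * (1 + \<tau> * \<tau>')" using q0 by simp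
    finally have A: "?q v - ?q v0 \<le> ?q v0 * (\<tau> * \<tau>')" by (simp add: algebra_simps)
    have B: "0 \<le> (\<tau> * \<tau>' - v\<^sup>2) / P" using vv P v0 by simp
    have "(\<tau> * \<tau>' - v\<^sup>2) / P * (\<tau> * \<tau>') \<le> \<tau> * \<tau>' / P * (\<tau> * \<tau>')"
      using P assms by (intro mult_right_mono divide_right_mono) auto
    also have "\<dots> = \<tau>\<^sup>2 / (\<tau>\<^sup>2 + v\<^sup>2) * (\<tau>'\<^sup>2 / (\<tau>'\<^sup>2 + v\<^sup>2))"
      by (simp add: P_def power2_eq_square mult_ac)
    also have "\<dots> \<le> \<tau>\<^sup>2 / (\<tau>\<^sup>2 + v\<^sup>2) * 1"
      using pos by (intro mult_left_mono) auto
    finally have C: "(\<tau> * \<tau>' - v\<^sup>2) / P * (\<tau> * \<tau>') \<le> \<tau>\<^sup>2 / (\<tau>\<^sup>2 + v\<^sup>2)" by simp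
    have "2 * (\<tau>' - \<tau>) / pi * ((\<tau> * \<tau>' - v\<^sup>2) / P) * (?q v - ?q v0)
      \<le> 2 * (\<tau>' - \<tau>) / pi * ((\<tau> * \<tau>' - v\<^sup>2) / P) * (?q v0 * (\<tau> * \<tau>'))"
      using A B assms by (intro mult_left_mono mult_nonneg_nonneg) auto
    moreover have "2 * (\<tau>' - \<tau>) / pi * ((\<tau> * \<tau>' - v\<^sup>2) / P) * (?q v0 * (\<tau> * \<tau>'))
      = ((\<tau> * \<tau>' - v\<^sup>2) / P * (\<tau> * \<tau>')) * (2 * (\<tau>' - \<tau>) / pi * ?q v0)"
      by (simp add: mult_ac del: right_diff_distrib_numeral)
    moreover have "((\<tau> * \<tau>' - v\<^sup>2) / P * (\<tau> * \<tau>')) * (2 * (\<tau>' - \<tau>) / pi * ?q v0)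
      \<le> \<tau>\<^sup>2 / (\<tau>\<^sup>2 + v\<^sup>2) * (2 * (\<tau>' - \<tau>) / pi * ?q v0)"
      using C q0 assms by (intro mult_right_mono) auto
    moreover have "\<tau>\<^sup>2 / (\<tau>\<^sup>2 + v\<^sup>2) * (2 * (\<tau>' - \<tau>) / pi * ?q v0) = (\<tau>' - \<tau>) * ?q v0 * (\<tau> * ?k \<tau> v)"
      using True by (simp add: half_cauchy_density_def power2_eq_square mult_ac del: right_diff_distrib_numeral)
    moreover have "0 \<le> (\<tau>' - \<tau>) * ?q v0 * ?k 1 v"
      using kn q0 assms by simp
    moreover have "(?k \<tau>' v - ?k \<tau> v) * (?q v - ?q v0)
      = - (2 * (\<tau>' - \<tau>) / pi * ((\<tau> * \<tau>' - v\<^sup>2) / P) * (?q v - ?q v0))"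
      unfolding d using P by (simp add: field_simps)
    ultimately show ?thesis
      unfolding distrib_left by linarith
  qed
qed (simp add: half_cauchy_density_def)

text \<open>Both half-Cauchy densities have mass 1, so subtracting the constant
  \<open>scale_ratio x v0\<close> does not change the integral of their difference; the error terms
  integrate to 1 + \<tau>.\<close>

lemma marginal_ratio_crossing:
  assumes "0 < \<tau>" "\<tau> \<le> \<tau>'" and v0: "0 \<le> v0" "v0\<^sup>2 = \<tau> * \<tau>'"
  shows "marginal_ratio \<tau> x \<le> marginal_ratio \<tau>' x + (\<tau>' - \<tau>) * (1 + \<tau>) * scale_ratio x v0"
proof -
  let ?q = "scale_ratio x" and ?k = half_cauchy_density
  have t': "0 < \<tau>'" using assms by simp
  note int = integrable_half_cauchy_density integrable_marginal_ratio
  have "(\<integral>v. - ((\<tau>' - \<tau>) * ?q v0 * (?k 1 v + \<tau> * ?k \<tau> v)) \<partial>lborel)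
      \<le> (\<integral>v. (?k \<tau>' v * ?q v - ?k \<tau> v * ?q v) - (?k \<tau>' v - ?k \<tau> v) * ?q v0 \<partial>lborel)"
  proof (rule integral_mono)
    fix v
    have "(?k \<tau>' v - ?k \<tau> v) * (?q v - ?q v0)
      = (?k \<tau>' v * ?q v - ?k \<tau> v * ?q v) - (?k \<tau>' v - ?k \<tau> v) * ?q v0"
      by (simp add: algebra_simps)
    then show "- ((\<tau>' - \<tau>) * ?q v0 * (?k 1 v + \<tau> * ?k \<tau> v))
        \<le> (?k \<tau>' v * ?q v - ?k \<tau> v * ?q v) - (?k \<tau>' v - ?k \<tau> v) * ?q v0"
      using crossing_bound[OF assms, of x v] by simp
  qed (use assms t' in \<open>auto intro!: int Bochner_Integration.integrable_diff integrable_mult_left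
      integrable_mult_right integrable_minus Bochner_Integration.integrable_add\<close>)
  also have "\<dots> = marginal_ratio \<tau>' x - marginal_ratio \<tau> x"
    using assms t' by (simp add: int integral_half_cauchy_density marginal_ratio_def)
  also have "(\<integral>v. - ((\<tau>' - \<tau>) * ?q v0 * (?k 1 v + \<tau> * ?k \<tau> v)) \<partial>lborel) = - ((\<tau>' - \<tau>) * ?q v0 * (1 + \<tau>))"
    using assms by (simp add: int integral_half_cauchy_density)
  finally show ?thesis by (simp add: mult_ac)
qed

lemma integral_indicator_Icc:
  fixes a b c :: real
  assumes "a \<le> b"
  shows "integrable lborel (\<lambda>v. indicator {a..b} v * c)" "(\<integral>v. indicator {a..b} v * c \<partial>lborel) = (b - a) * c"
  using assms by auto

text \<open>The mixing density is at least 1 / (10 * \<tau>) on the interval from \<tau> to 2 *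
  \<tau>, and there the ratio is at least a fifth of its value at u, since sqrt (1 + v^2) \<le> 5
  for v \<le> 4. Hence 50 = 10 * 5.\<close>

lemma scale_ratio_le_marginal_ratio:
  assumes "0 < \<tau>" "\<tau> \<le> 2" "0 \<le> u" "u \<le> \<tau>"
  shows "scale_ratio x u \<le> 50 * marginal_ratio \<tau> x"
proof -
  let ?q = "scale_ratio x"
  have q: "0 < ?q u" by (rule scale_ratio_pos)
  have "(\<integral>v. indicator {\<tau>..2 * \<tau>} v * (1 / (50 * \<tau>) * ?q u) \<partial>lborel) \<le> marginal_ratio \<tau> x"
    unfolding marginal_ratio_def
  proof (rule integral_mono)
    fix v :: real
    show "indicator {\<tau>..2 * \<tau>} v * (1 / (50 * \<tau>) * ?q u) \<le> half_cauchy_density \<tau> v * ?q v"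
    proof (cases "v \<in> {\<tau>..2 * \<tau>}")
      case True
      then have v: "0 < v" "u \<le> v" "v \<le> 2 * \<tau>" "v \<le> 4" using assms by auto
      have "v\<^sup>2 \<le> (2 * \<tau>)\<^sup>2" using v by (intro power_mono) auto
      then have "pi * (\<tau>\<^sup>2 + v\<^sup>2) \<le> 4 * (5 * \<tau>\<^sup>2)"
        using pi_less_4 by (intro mult_mono) auto
      then have "2 * \<tau> / (4 * (5 * \<tau>\<^sup>2)) \<le> half_cauchy_density \<tau> v"
        using v assms by (intro half_cauchy_density_geI) auto
      then have 1: "1 / (10 * \<tau>) \<le> half_cauchy_density \<tau> v"
        using assms by (simp add: power2_eq_square)
      have "v\<^sup>2 \<le> 4\<^sup>2" using v by (intro power_mono) auto
      then have s: "sqrt (1 + v\<^sup>2) \<le> 5" by (intro real_le_lsqrt) auto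
      have "?q u * 1 \<le> ?q u * sqrt (1 + u\<^sup>2)" using q by (intro mult_left_mono) auto
      also have "\<dots> \<le> ?q v * sqrt (1 + v\<^sup>2)" by (rule scale_ratio_mono[OF assms(3) v(2)])
      also have "\<dots> \<le> ?q v * 5" using s scale_ratio_pos[of x v] by (intro mult_left_mono) auto
      finally have "?q u / 5 \<le> ?q v" by simp
      with 1 have "1 / (10 * \<tau>) * (?q u / 5) \<le> half_cauchy_density \<tau> v * ?q v"
        using q assms half_cauchy_density_nonneg[of \<tau> v] by (intro mult_mono) auto
      then show ?thesis using True by simp
    next
      case False
      then show ?thesis
        using assms half_cauchy_density_nonneg[of \<tau> v] scale_ratio_pos[of x v] by simp
    qed
  qed (use assms integral_indicator_Icc(1)[of \<tau> "2 * \<tau>"] in \<open>auto intro: integrable_marginal_ratio\<close>)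
  then show ?thesis
    using assms by (simp add: integral_indicator_Icc(2))
qed

text \<open>At x = 0 the ratio decreases with the scale, so some correction is unavoidable. The
  crossing point lies below \<tau>', which makes the error a multiple of the ratio at \<tau>'
  itself; 150 = 3 * 50, with 3 from 1 + \<tau> \<le> 3.\<close>

lemma marginal_ratio_almost_mono:
  assumes "0 < \<tau>" "\<tau> \<le> \<tau>'" "\<tau>' \<le> 2"
  shows "marginal_ratio \<tau> x \<le> exp (150 * (\<tau>' - \<tau>)) * marginal_ratio \<tau>' x"
proof -
  define v0 where "v0 = sqrt (\<tau> * \<tau>')"
  have v0: "0 \<le> v0" "v0\<^sup>2 = \<tau> * \<tau>'" using assms by (auto simp: v0_def)
  have "v0 \<le> \<tau>'" unfolding v0_def using assms by (intro real_le_lsqrt) (auto simp: power2_eq_square)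
  then have q: "scale_ratio x v0 \<le> 50 * marginal_ratio \<tau>' x"
    using assms v0 by (intro scale_ratio_le_marginal_ratio) auto
  have "marginal_ratio \<tau> x \<le> marginal_ratio \<tau>' x + (\<tau>' - \<tau>) * (1 + \<tau>) * scale_ratio x v0"
    by (rule marginal_ratio_crossing[OF assms(1,2) v0])
  also have "\<dots> \<le> marginal_ratio \<tau>' x + (\<tau>' - \<tau>) * 3 * (50 * marginal_ratio \<tau>' x)"
    using assms q scale_ratio_pos[of x v0] by (intro add_left_mono mult_mono) auto
  also have "\<dots> = (1 + 150 * (\<tau>' - \<tau>)) * marginal_ratio \<tau>' x" by (simp add: algebra_simps)
  also have "\<dots> \<le> exp (150 * (\<tau>' - \<tau>)) * marginal_ratio \<tau>' x"
    using assms marginal_ratio_pos[of \<tau>' x] exp_ge_add_one_self by (intro mult_right_mono) auto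
  finally show ?thesis .
qed

section \<open>Size of the marginal density at large observations\<close>

lemma std_normal_scale_ratio:
  "std_normal_density x * scale_ratio x v = exp (- (x\<^sup>2 / (2 * (1 + v\<^sup>2)))) / (sqrt (2 * pi) * sqrt (1 + v\<^sup>2))"
  unfolding normal_density_scale_ratio[symmetric] using one_plus_square_pos[of v]
  by (simp add: normal_density_def real_sqrt_mult)

text \<open>Only the scales between |x| and 2 * |x| are kept. There the mixing density is at least
  \<tau> / (16 * x^2), the normal density with variance 1 + v^2 at x is at least 1 / (14 * |x|), and
  the interval has length |x|; 224 = 16 * 14.\<close>

lemma marginal_lower:
  assumes "0 < \<tau>" "\<tau> \<le> 2" "1 \<le> \<bar>x\<bar>"
  shows "\<tau> / (224 * x\<^sup>2) \<le> std_normal_density x * marginal_ratio \<tau> x"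
proof -
  define y where "y = \<bar>x\<bar>"
  have y: "1 \<le> y" "x\<^sup>2 = y\<^sup>2" using assms by (auto simp: y_def)
  have y1: "1 \<le> y\<^sup>2" using y by simp
  have "(\<integral>v. indicator {y..2 * y} v * (\<tau> / (224 * y ^ 3)) \<partial>lborel)
      \<le> (\<integral>v. std_normal_density x * (half_cauchy_density \<tau> v * scale_ratio x v) \<partial>lborel)"
  proof (rule integral_mono)
    fix v :: real
    show "indicator {y..2 * y} v * (\<tau> / (224 * y ^ 3))
      \<le> std_normal_density x * (half_cauchy_density \<tau> v * scale_ratio x v)"
    proof (cases "v \<in> {y..2 * y}")
      case True
      then have v: "0 < v" "y \<le> v" "v \<le> 2 * y" using y by auto
      have vv: "y\<^sup>2 \<le> v\<^sup>2" "v\<^sup>2 \<le> 4 * y\<^sup>2"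
        using power_mono[OF v(2), of 2] power_mono[OF v(3), of 2] v y by (auto simp: power_mult_distrib)
      have "\<tau>\<^sup>2 \<le> 2\<^sup>2" using assms by (intro power_mono) auto
      then have "pi * (\<tau>\<^sup>2 + v\<^sup>2) \<le> 4 * (8 * y\<^sup>2)"
        using pi_less_4 vv y1 by (intro mult_mono) auto
      then have "2 * \<tau> / (4 * (8 * y\<^sup>2)) \<le> half_cauchy_density \<tau> v"
        using v y assms by (intro half_cauchy_density_geI) auto
      then have 1: "\<tau> / (16 * y\<^sup>2) \<le> half_cauchy_density \<tau> v" by simp
      have "x\<^sup>2 / (2 * (1 + v\<^sup>2)) \<le> 1 / 2"
        using vv y y1 by (simp add: divide_le_eq)
      then have "exp (- (1 / 2)) \<le> exp (- (x\<^sup>2 / (2 * (1 + v\<^sup>2))))" by simp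
      moreover have "1 / 2 \<le> exp (- (1 / 2) :: real)"
        using exp_ge_add_one_self[of "- (1 / 2) :: real"] by simp
      ultimately have e: "1 / 2 \<le> exp (- (x\<^sup>2 / (2 * (1 + v\<^sup>2))))" by linarith
      have "sqrt (2 * pi) * sqrt (1 + v\<^sup>2) = sqrt (2 * pi * (1 + v\<^sup>2))" by (simp add: real_sqrt_mult)
      also have "\<dots> \<le> 7 * y"
      proof (rule real_le_lsqrt)
        have "2 * pi * (1 + v\<^sup>2) \<le> 8 * (5 * y\<^sup>2)"
          using pi_less_4 vv y1 by (intro mult_mono) auto
        then show "2 * pi * (1 + v\<^sup>2) \<le> (7 * y)\<^sup>2" using y1 by (simp add: power_mult_distrib)
      qed (use y in auto)
      finally have "1 / 2 / (7 * y) \<le> std_normal_density x * scale_ratio x v"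
        unfolding std_normal_scale_ratio using e y one_plus_square_pos[of v] by (intro frac_le) auto
      with 1 have "\<tau> / (16 * y\<^sup>2) * (1 / 2 / (7 * y)) \<le> half_cauchy_density \<tau> v * (std_normal_density x * scale_ratio x v)"
        using assms y half_cauchy_density_nonneg[of \<tau> v] by (intro mult_mono) auto
      then show ?thesis using True by (simp add: power2_eq_square power3_eq_cube mult_ac)
    next
      case False
      then show ?thesis
        using assms half_cauchy_density_nonneg[of \<tau> v] scale_ratio_pos[of x v] by simp
    qed
  qed (use assms y integral_indicator_Icc(1)[of y "2 * y"] in \<open>auto intro!: integrable_marginal_ratio\<close>)
  then show ?thesis
    using assms y by (simp add: integral_indicator_Icc(2) marginal_ratio_def power2_eq_square power3_eq_cube)
qed

text \<open>Away from \<open>0\<close> the scale mixture is dominated by a half-Cauchy density whose scale is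
  \<open>sqrt (2 + x\<^sup>2)\<close>, which is what produces the tail \<open>\<tau> / x\<^sup>2\<close>.\<close>

lemma scale_mixture_tail:
  assumes "0 < \<tau>" "0 < \<epsilon>" "\<epsilon> \<le> 1" "\<epsilon> / (1 + \<bar>x\<bar>) < v"
  shows "half_cauchy_density \<tau> v * (std_normal_density x * scale_ratio x v)
    \<le> 1728 * \<tau> / (\<epsilon>\<^sup>2 * (2 + x\<^sup>2)) * half_cauchy_density (sqrt (2 + x\<^sup>2)) v"
proof -
  have v: "0 < v" using assms by (smt (verit) divide_nonneg_nonneg)
  define w where "w = sqrt (1 + v\<^sup>2)"
  \<comment> \<open>\<open>y\<close> is the exponent of the normal density with variance w^2.
    Trading x^2 for 2 * w^2 * y turns each comparison below into a power of 1 + y, which exp (- y)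
    absorbs.\<close>
  define y where "y = x\<^sup>2 / (2 * w\<^sup>2)"
  define r where "r = sqrt (2 + x\<^sup>2)"
  have w: "1 \<le> w" "0 < w" "w\<^sup>2 = 1 + v\<^sup>2" using one_plus_square_pos[of v] by (auto simp: w_def)
  have y: "0 \<le> y" "x\<^sup>2 = 2 * w\<^sup>2 * y" using w(1,2) by (simp_all add: y_def)
  have r: "0 < r" "r\<^sup>2 = 2 + x\<^sup>2" by (auto simp: r_def add_pos_nonneg)
  \<comment> \<open>The cutoff on v enters only here: for v < 1 the variance is bounded, and
    \<epsilon> is at most (1 + |x|) * v.\<close>
  have v2: "w\<^sup>2 * \<epsilon>\<^sup>2 \<le> 16 * (1 + y) * v\<^sup>2"
  proof (cases "1 \<le> v")
    case True
    then have "w\<^sup>2 \<le> 2 * v\<^sup>2" using w by simp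
    moreover have "\<epsilon>\<^sup>2 \<le> 1" using assms by (simp add: power_le_one)
    ultimately have "w\<^sup>2 * \<epsilon>\<^sup>2 \<le> 2 * v\<^sup>2 * 1" by (intro mult_mono) auto
    also have "\<dots> \<le> 16 * (1 + y) * v\<^sup>2" using y by (simp add: algebra_simps)
    finally show ?thesis .
  next
    case False
    then have "v\<^sup>2 \<le> 1" using v by (simp add: power_le_one)
    then have w2: "w\<^sup>2 \<le> 2" using w by simp
    have "\<epsilon> \<le> (1 + \<bar>x\<bar>) * v" using assms(4) by (simp add: divide_less_eq mult.commute add_pos_nonneg)
    then have "\<epsilon>\<^sup>2 \<le> ((1 + \<bar>x\<bar>) * v)\<^sup>2" using assms by (intro power_mono) auto
    also have "\<dots> = (1 + \<bar>x\<bar>)\<^sup>2 * v\<^sup>2" by (simp add: power_mult_distrib)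
    also have "(1 + \<bar>x\<bar>)\<^sup>2 \<le> 2 * (1 + x\<^sup>2)"
      using zero_le_power2[of "1 - \<bar>x\<bar>"] by (simp add: power2_eq_square algebra_simps)
    also have "x\<^sup>2 \<le> 2 * 2 * y" unfolding y(2) using w2 y by (intro mult_right_mono) auto
    finally have "\<epsilon>\<^sup>2 \<le> 2 * (1 + 2 * 2 * y) * v\<^sup>2" by (simp add: mult_right_mono)
    also have "\<dots> \<le> 8 * (1 + y) * v\<^sup>2" using y by (intro mult_right_mono) auto
    finally have "w\<^sup>2 * \<epsilon>\<^sup>2 \<le> 2 * (8 * (1 + y) * v\<^sup>2)" using w2 by (intro mult_mono) auto
    also have "\<dots> = 16 * (1 + y) * v\<^sup>2" by (simp add: algebra_simps)
    finally show ?thesis .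
  qed
  have r2: "r\<^sup>2 + v\<^sup>2 \<le> 2 * w\<^sup>2 * (1 + y)"
    using w(1,3) unfolding r y(2) by (simp add: algebra_simps)
  have r1: "r \<le> 2 * w * (1 + y)"
  proof (rule power2_le_imp_le)
    have "r\<^sup>2 \<le> 2 * w\<^sup>2 * (1 + y)" using r2 zero_le_power2[of v] by linarith
    also have "\<dots> \<le> 4 * w\<^sup>2 * ((1 + y) * (1 + y))" using y w by (intro mult_mono) (auto simp: algebra_simps)
    finally show "r\<^sup>2 \<le> (2 * w * (1 + y))\<^sup>2" by (simp add: power2_eq_square algebra_simps)
  qed (use w y in auto)
  \<comment> \<open>\<open>v2\<close>, \<open>r2\<close> and \<open>r1\<close> each cost one factor
    1 + y, hence the cube; 1728 = 64 * 27.\<close>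
  have e: "(1 + y) ^ 3 \<le> 27 * exp y"
  proof -
    have "(1 + y) ^ 3 \<le> (3 * (1 + y / 3)) ^ 3" using y by (intro power_mono) auto
    also have "\<dots> \<le> (3 * exp (y / 3)) ^ 3" using y by (intro power_mono mult_left_mono exp_ge_add_one_self) auto
    also have "\<dots> = 27 * exp y" by (simp add: power_mult_distrib flip: exp_of_nat_mult)
    finally show ?thesis .
  qed
  have "r * (r\<^sup>2 + v\<^sup>2) * \<epsilon>\<^sup>2 \<le> (2 * w * (1 + y)) * (2 * w\<^sup>2 * (1 + y)) * \<epsilon>\<^sup>2"
    using r1 r2 r w y by (intro mult_right_mono mult_mono) auto
  also have "\<dots> = 4 * w * (1 + y)\<^sup>2 * (w\<^sup>2 * \<epsilon>\<^sup>2)" by (simp add: power2_eq_square)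
  also have "\<dots> \<le> 4 * w * (1 + y)\<^sup>2 * (16 * (1 + y) * v\<^sup>2)" using v2 w y by (intro mult_left_mono) auto
  also have "\<dots> = 64 * w * v\<^sup>2 * (1 + y) ^ 3" by (simp add: power2_eq_square power3_eq_cube)
  also have "\<dots> \<le> 64 * w * v\<^sup>2 * (27 * exp y)" using e w by (intro mult_left_mono) auto
  finally have main: "r * (r\<^sup>2 + v\<^sup>2) * \<epsilon>\<^sup>2 \<le> 1728 * w * v\<^sup>2 * exp y" by simp
  have pv: "0 < r\<^sup>2 + v\<^sup>2" using r(1) v by (intro add_pos_pos) auto
  have "exp (- y) / (v\<^sup>2 * w) \<le> 1728 / (\<epsilon>\<^sup>2 * r * (r\<^sup>2 + v\<^sup>2))"
  proof -
    define A B where "A = exp y * (v\<^sup>2 * w)" and "B = \<epsilon>\<^sup>2 * r * (r\<^sup>2 + v\<^sup>2)"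
    have "0 < A" "0 < B" "B \<le> 1728 * A"
      using main v w(2) r(1) assms pv by (simp_all add: A_def B_def mult_ac)
    then have "1 / A \<le> 1728 / B" by (simp add: field_simps)
    then show ?thesis by (simp add: A_def B_def exp_minus divide_inverse)
  qed
  moreover have "std_normal_density x * scale_ratio x v \<le> exp (- y) / w"
  proof -
    have "1 \<le> sqrt (2 * pi)" using pi_gt3 by simp
    then have "exp (- y) / (sqrt (2 * pi) * w) \<le> exp (- y) / (1 * w)"
      using w by (intro divide_left_mono mult_right_mono) auto
    then show ?thesis using w(2) unfolding std_normal_scale_ratio w_def[symmetric] w(3)[symmetric] y_def by simp
  qed
  moreover have "half_cauchy_density \<tau> v \<le> 2 * \<tau> / (pi * v\<^sup>2)"
    using v assms unfolding half_cauchy_density_def by (auto intro!: divide_left_mono mult_pos_pos add_pos_pos)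
  ultimately have "half_cauchy_density \<tau> v * (std_normal_density x * scale_ratio x v)
     \<le> 2 * \<tau> / (pi * v\<^sup>2) * (exp (- y) / w)"
    using v assms w half_cauchy_density_nonneg[of \<tau> v] scale_ratio_pos[of x v] by (intro mult_mono) auto
  also have "\<dots> = 2 * \<tau> / pi * (exp (- y) / (v\<^sup>2 * w))" by simp
  also have "\<dots> \<le> 2 * \<tau> / pi * (1728 / (\<epsilon>\<^sup>2 * r * (r\<^sup>2 + v\<^sup>2)))"
    using \<open>exp (- y) / (v\<^sup>2 * w) \<le> _\<close> assms by (intro mult_left_mono) auto
  also have "\<dots> = 1728 * \<tau> / (\<epsilon>\<^sup>2 * r\<^sup>2) * half_cauchy_density r v"
    using v r(1) by (simp add: half_cauchy_density_def power2_eq_square)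
  finally show ?thesis unfolding r(2) unfolding r_def .
qed

text \<open>Scales below \<epsilon> / (1 + |x|) change the null density by at most the factor exp
  (\<epsilon>^2 / 2), and larger ones fall under \<open>scale_mixture_tail\<close>. The parameter
  \<epsilon> stays free because levels t close to 1 require a first term close to the null density,
  whereas \<epsilon> = 1 suffices for locating the scale.\<close>

lemma marginal_upper:
  assumes "0 < \<tau>" "0 < \<epsilon>" "\<epsilon> \<le> 1"
  shows "std_normal_density x * marginal_ratio \<tau> x
    \<le> exp (\<epsilon>\<^sup>2 / 2) * std_normal_density x + 1728 * \<tau> / (\<epsilon>\<^sup>2 * (2 + x\<^sup>2))"
proof -
  define r where "r = sqrt (2 + x\<^sup>2)"
  have r: "0 < r" by (auto simp: r_def add_pos_nonneg)
  let ?\<phi> = "std_normal_density x"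
  have "(\<integral>v. ?\<phi> * (half_cauchy_density \<tau> v * scale_ratio x v) \<partial>lborel)
    \<le> (\<integral>v. ?\<phi> * exp (\<epsilon>\<^sup>2 / 2) * half_cauchy_density \<tau> v
      + 1728 * \<tau> / (\<epsilon>\<^sup>2 * (2 + x\<^sup>2)) * half_cauchy_density r v \<partial>lborel)"
  proof (rule integral_mono)
    fix v :: real
    have n: "0 \<le> half_cauchy_density \<tau> v" "0 \<le> half_cauchy_density r v"
      using assms r by (auto simp: half_cauchy_density_nonneg)
    show "?\<phi> * (half_cauchy_density \<tau> v * scale_ratio x v) \<le> ?\<phi> * exp (\<epsilon>\<^sup>2 / 2) * half_cauchy_density \<tau> v
      + 1728 * \<tau> / (\<epsilon>\<^sup>2 * (2 + x\<^sup>2)) * half_cauchy_density r v"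
    proof (cases "\<epsilon> / (1 + \<bar>x\<bar>) < v")
      case True
      then have "?\<phi> * (half_cauchy_density \<tau> v * scale_ratio x v)
        \<le> 1728 * \<tau> / (\<epsilon>\<^sup>2 * (2 + x\<^sup>2)) * half_cauchy_density r v"
        using scale_mixture_tail[OF assms, of x v] by (simp add: r_def mult_ac)
      then show ?thesis using n by (simp add: add_increasing)
    next
      case False
      show ?thesis
      proof (cases "0 < v")
        case True
        have "v * \<bar>x\<bar> \<le> v * (1 + \<bar>x\<bar>)" using True by simp
        also have "\<dots> \<le> \<epsilon>" using False by (simp add: not_less le_divide_eq add_pos_nonneg)
        finally have "(v * \<bar>x\<bar>)\<^sup>2 \<le> \<epsilon>\<^sup>2" using True by (intro power_mono) auto
        moreover have "x\<^sup>2 * v\<^sup>2 / (2 * (1 + v\<^sup>2)) \<le> x\<^sup>2 * v\<^sup>2 / (2 * 1)"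
          using one_plus_square_pos[of v] by (intro divide_left_mono mult_pos_pos) auto
        ultimately have "x\<^sup>2 * v\<^sup>2 / (2 * (1 + v\<^sup>2)) \<le> \<epsilon>\<^sup>2 / 2" by (simp add: power_mult_distrib mult.commute)
        then have "scale_ratio x v \<le> exp (\<epsilon>\<^sup>2 / 2) / 1"
          unfolding scale_ratio_def by (intro frac_le) auto
        then have "?\<phi> * (half_cauchy_density \<tau> v * scale_ratio x v) \<le> ?\<phi> * (half_cauchy_density \<tau> v * exp (\<epsilon>\<^sup>2 / 2))"
          using n by (intro mult_left_mono) auto
        also have "\<dots> \<le> ?\<phi> * exp (\<epsilon>\<^sup>2 / 2) * half_cauchy_density \<tau> v
           + 1728 * \<tau> / (\<epsilon>\<^sup>2 * (2 + x\<^sup>2)) * half_cauchy_density r v"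
          using n assms by simp
        finally show ?thesis .
      qed (simp add: half_cauchy_density_def)
    qed
  qed (use assms r in \<open>auto intro!: integrable_marginal_ratio integrable_half_cauchy_density
      Bochner_Integration.integrable_add integrable_mult_right simp del: times_divide_eq_left\<close>)
  then show ?thesis
    using assms r by (simp add: integrable_half_cauchy_density integral_half_cauchy_density marginal_ratio_def mult.commute)
qed

section \<open>Posterior half-lines and Hellinger affinity\<close>

lemma horseshoe_density_minus: "horseshoe_density \<tau> (- \<theta>) = horseshoe_density \<tau> \<theta>"
  by (simp add: horseshoe_density_def normal_density_def)

lemma nn_integral_horseshoe_minus:
  assumes [measurable]: "f \<in> borel_measurable borel"
  shows "(\<integral>\<^sup>+ \<theta>. f (- \<theta>) \<partial>horseshoe \<tau>) = (\<integral>\<^sup>+ \<theta>. f \<theta> \<partial>horseshoe \<tau>)"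
  using nn_integral_real_affine[of "\<lambda>\<theta>. horseshoe_density \<tau> \<theta> * f \<theta>" "-1" 0]
  by (simp add: horseshoe_eq_density nn_integral_density horseshoe_density_minus)

lemma emeasure_horseshoe_minus:
  assumes [measurable]: "A \<in> sets borel"
  shows "emeasure (horseshoe \<tau>) {\<theta>. - \<theta> \<in> A} = emeasure (horseshoe \<tau>) A"
proof -
  have [measurable]: "{\<theta>. - \<theta> \<in> A} \<in> sets borel" by measurable
  have "emeasure (horseshoe \<tau>) {\<theta>. - \<theta> \<in> A} = (\<integral>\<^sup>+ \<theta>. indicator A (- \<theta>) \<partial>horseshoe \<tau>)"
  proof -
    have "indicator A (- \<theta>) = (indicator {\<theta>. - \<theta> \<in> A} \<theta> :: ennreal)" for \<theta>
      by (simp add: indicator_def)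
    then show ?thesis by (simp del: indicator_simps)
  qed
  also have "\<dots> = emeasure (horseshoe \<tau>) A"
    by (subst nn_integral_horseshoe_minus) auto
  finally show ?thesis .
qed

lemma measure_horseshoe_half:
  assumes "0 < \<tau>"
  shows "measure (horseshoe \<tau>) {..<0} = 1 / 2" "measure (horseshoe \<tau>) {0<..} = 1 / 2"
proof -
  interpret prob_space "horseshoe \<tau>" by (rule prob_space_horseshoe[OF assms])
  have "emeasure (horseshoe \<tau>) {0} = 0"
    by (simp add: horseshoe_eq_density emeasure_density nn_integral_null_set null_sets_def)
  then have "measure (horseshoe \<tau>) {0} = 0" by (simp add: measure_def)
  moreover have "measure (horseshoe \<tau>) ({..<0} \<union> {0<..} \<union> {0}) = measure (horseshoe \<tau>) {..<0}
      + measure (horseshoe \<tau>) {0<..} + measure (horseshoe \<tau>) {0}"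
    by (subst measure_Union) (auto intro!: finite_measure_Union)
  moreover have "{..<0} \<union> {0<..} \<union> {0 :: real} = space (horseshoe \<tau>)" by auto
  moreover have "measure (horseshoe \<tau>) {..<0} = measure (horseshoe \<tau>) {0<..}"
    using emeasure_horseshoe_minus[of "{0<..}" \<tau>] by (simp add: measure_def lessThan_def)
  ultimately show "measure (horseshoe \<tau>) {..<0} = 1 / 2" "measure (horseshoe \<tau>) {0<..} = 1 / 2"
    using prob_space by auto
qed

text \<open>Markov's inequality for \<open>1 - exp (- \<theta>\<^sup>2 / 2)\<close>, whose mean is read off the marginal density at \<open>0\<close>.\<close>

lemma horseshoe_tail:
  assumes "0 < \<tau>" "0 < a" "a \<le> 1"
  shows "measure (horseshoe \<tau>) {\<theta>. a \<le> \<bar>\<theta>\<bar>} \<le> 4 * \<tau> / a\<^sup>2"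
proof -
  interpret prob_space "horseshoe \<tau>" by (rule prob_space_horseshoe[OF assms(1)])
  have int: "integrable (horseshoe \<tau>) (\<lambda>\<theta>. exp (- (\<theta>\<^sup>2 / 2)))"
    by (intro integrable_const_bound[of _ 1]) auto
  have phi: "std_normal_density (0 - \<theta>) = std_normal_density 0 * exp (- (\<theta>\<^sup>2 / 2))" for \<theta>
    by (simp add: std_normal_density_def)
  have "ennreal (std_normal_density 0 * marginal_ratio \<tau> 0)
      = ennreal (std_normal_density 0) * (\<integral>\<^sup>+ \<theta>. ennreal (exp (- (\<theta>\<^sup>2 / 2))) \<partial>horseshoe \<tau>)"
    unfolding marginal_eq_ratio[OF assms(1), symmetric] marginal_eq phi
    by (simp add: ennreal_mult nn_integral_cmult)
  also have "\<dots> = ennreal (std_normal_density 0 * (\<integral>\<theta>. exp (- (\<theta>\<^sup>2 / 2)) \<partial>horseshoe \<tau>))"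
    by (subst nn_integral_eq_integral[OF int]) (auto simp: ennreal_mult)
  finally have "(\<integral>\<theta>. exp (- (\<theta>\<^sup>2 / 2)) \<partial>horseshoe \<tau>) = marginal_ratio \<tau> 0"
    using marginal_ratio_pos[OF assms(1), of 0] normal_density_pos[of 1 0 0]
    by (simp add: ennreal_inj)
  then have "1 - \<tau> \<le> (\<integral>\<theta>. exp (- (\<theta>\<^sup>2 / 2)) \<partial>horseshoe \<tau>)"
    using marginal_ratio_ge[OF assms(1), of 0] by simp
  then have "(\<integral>\<theta>. 1 - exp (- (\<theta>\<^sup>2 / 2)) \<partial>horseshoe \<tau>) \<le> \<tau>"
    using int prob_space by simp
  moreover have "(\<integral>\<theta>. a\<^sup>2 / 4 * indicator {\<theta>. a \<le> \<bar>\<theta>\<bar>} \<theta> \<partial>horseshoe \<tau>)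
      \<le> (\<integral>\<theta>. 1 - exp (- (\<theta>\<^sup>2 / 2)) \<partial>horseshoe \<tau>)"
  proof (rule integral_mono)
    fix \<theta> :: real
    show "a\<^sup>2 / 4 * indicator {\<theta>. a \<le> \<bar>\<theta>\<bar>} \<theta> \<le> 1 - exp (- (\<theta>\<^sup>2 / 2))"
    proof (cases "a \<le> \<bar>\<theta>\<bar>")
      case True
      define y where "y = a\<^sup>2 / 2"
      have y: "0 \<le> y" "y \<le> 1" using assms power_le_one[of a 2] by (auto simp: y_def)
      have "a\<^sup>2 \<le> \<theta>\<^sup>2" using power_mono[OF True, of 2] assms by simp
      then have "exp (- (\<theta>\<^sup>2 / 2)) \<le> exp (- y)" by (simp add: y_def)
      also have "exp (- y) \<le> 1 / (1 + y)"
        using y exp_ge_add_one_self[of y] by (simp add: exp_minus divide_inverse le_imp_inverse_le)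
      also have "\<dots> \<le> 1 - y / 2"
      proof -
          have "(1 + y) * (1 - y / 2) = 1 + y * (1 - y) / 2" by (simp add: field_simps)
          also have "\<dots> \<ge> 1" using y by simp
          finally show ?thesis using y by (simp add: divide_le_eq mult.commute)
        qed
      finally show ?thesis using True by (simp add: y_def)
    qed simp
  next
    have [measurable]: "{\<theta>::real. a \<le> \<bar>\<theta>\<bar>} \<in> sets borel" by measurable
    show "integrable (horseshoe \<tau>) (\<lambda>\<theta>. a\<^sup>2 / 4 * indicator {\<theta>. a \<le> \<bar>\<theta>\<bar>} \<theta>)"
      by (intro integrable_mult_right integrable_real_indicator) (auto simp: less_top[symmetric])
  qed (use int in auto)
  moreover have "(\<integral>\<theta>. a\<^sup>2 / 4 * indicator {\<theta>. a \<le> \<bar>\<theta>\<bar>} \<theta> \<partial>horseshoe \<tau>)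
      = a\<^sup>2 / 4 * measure (horseshoe \<tau>) {\<theta>. a \<le> \<bar>\<theta>\<bar>}" by simp
  ultimately show ?thesis using assms by (simp add: field_simps)
qed

section \<open>Two-sided bounds on the s-value\<close>

lemma std_normal_density_le: "std_normal_density x \<le> exp (- x\<^sup>2 / 2)"
proof -
  have "1 \<le> sqrt (2 * pi)" using pi_gt3 by simp
  then show ?thesis by (simp add: std_normal_density_def divide_le_eq)
qed

lemma std_normal_density_le_1: "std_normal_density x \<le> 1"
  by (rule order_trans[OF std_normal_density_le]) simp

lemma integrable_horseshoe_indicator:
  assumes "0 < \<tau>" "A \<in> sets borel"
  shows "integrable (horseshoe \<tau>) (\<lambda>\<theta>. indicator A \<theta> * c :: real)"
proof -
  interpret prob_space "horseshoe \<tau>" by (rule prob_space_horseshoe[OF assms(1)])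
  show ?thesis using assms(2)
    by (intro integrable_mult_left integrable_real_indicator) (auto simp: less_top[symmetric])
qed

lemma integrable_horseshoe_normal:
  assumes "0 < \<tau>" and [measurable]: "A \<in> sets borel"
  shows "integrable (horseshoe \<tau>) (\<lambda>\<theta>. std_normal_density (x - \<theta>) * indicator A \<theta>)"
proof -
  interpret prob_space "horseshoe \<tau>" by (rule prob_space_horseshoe[OF assms(1)])
  show ?thesis
    by (intro integrable_const_bound[of _ 1]) (auto simp: indicator_def std_normal_density_le_1)
qed

lemma measure_posterior:
  assumes "0 < \<tau>" and [measurable]: "A \<in> sets borel"
  shows "measure (posterior \<tau> x) A * (std_normal_density x * marginal_ratio \<tau> x)
    = (\<integral>\<theta>. std_normal_density (x - \<theta>) * indicator A \<theta> \<partial>horseshoe \<tau>)"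
proof -
  interpret prob_space "horseshoe \<tau>" by (rule prob_space_horseshoe[OF assms(1)])
  let ?m = "std_normal_density x * marginal_ratio \<tau> x"
  have m: "0 < ?m"
    using marginal_ratio_pos[OF assms(1), of x] normal_density_pos[of 1 0 x] by simp
  have int: "integrable (horseshoe \<tau>) (\<lambda>\<theta>. std_normal_density (x - \<theta>) * indicator A \<theta>)"
    by (rule integrable_horseshoe_normal) fact+
  have "emeasure (posterior \<tau> x) A
      = (\<integral>\<^sup>+ \<theta>. ennreal (std_normal_density (x - \<theta>) * indicator A \<theta> / ?m) \<partial>horseshoe \<tau>)"
    unfolding posterior_def marginal_eq_ratio[OF assms(1)]
    using m by (subst emeasure_density)
      (auto intro!: nn_integral_cong simp: divide_ennreal indicator_def)
  also have "\<dots> = ennreal ((\<integral>\<theta>. std_normal_density (x - \<theta>) * indicator A \<theta> \<partial>horseshoe \<tau>) / ?m)"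
    using int m by (subst nn_integral_eq_integral) auto
  finally have "measure (posterior \<tau> x) A
      = (\<integral>\<theta>. std_normal_density (x - \<theta>) * indicator A \<theta> \<partial>horseshoe \<tau>) / ?m"
    using m by (simp add: measure_def)
  then show ?thesis using m by (metis nonzero_eq_divide_eq less_irrefl)
qed

lemma std_normal_density_diff:
  "std_normal_density (x - \<theta>) = std_normal_density x * exp (x * \<theta> - \<theta>\<^sup>2 / 2)"
  by (simp add: std_normal_density_def power2_diff diff_divide_distrib add_divide_distrib algebra_simps flip: exp_add)

text \<open>On a half-line pointing away from x the exponent x * \<theta> - \<theta>^2 / 2 is
  nonpositive, so the likelihood is at most its value at \<theta> = 0, and the prior mass of the
  half-line is 1 / 2.\<close>

lemma posterior_half_upper:
  assumes "0 < \<tau>" and [measurable]: "A \<in> sets borel" and A: "measure (horseshoe \<tau>) A = 1 / 2"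
    and "\<And>\<theta>. \<theta> \<in> A \<Longrightarrow> x * \<theta> \<le> 0"
  shows "2 * measure (posterior \<tau> x) A * marginal_ratio \<tau> x \<le> 1"
proof -
  have p: "0 < std_normal_density x" by (rule normal_density_pos) simp
  have "(\<integral>\<theta>. std_normal_density (x - \<theta>) * indicator A \<theta> \<partial>horseshoe \<tau>)
      \<le> (\<integral>\<theta>. indicator A \<theta> * std_normal_density x \<partial>horseshoe \<tau>)"
  proof (rule integral_mono)
    fix \<theta> :: real
    have "x * \<theta> - \<theta>\<^sup>2 / 2 \<le> 0" if "\<theta> \<in> A"
      using assms(4)[OF that] zero_le_power2[of \<theta>] by linarith
    then show "std_normal_density (x - \<theta>) * indicator A \<theta> \<le> indicator A \<theta> * std_normal_density x"
      unfolding std_normal_density_diff[of x] using p by (auto simp: indicator_def)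
  qed (rule integrable_horseshoe_normal integrable_horseshoe_indicator, fact assms(1), measurable)+
  also have "\<dots> = std_normal_density x * (1 / 2)" using A by (simp add: mult.commute del: integral_mult_left)
  finally have "measure (posterior \<tau> x) A * (std_normal_density x * marginal_ratio \<tau> x) \<le> std_normal_density x * (1 / 2)"
    unfolding measure_posterior[OF assms(1,2)] .
  then have "std_normal_density x * (measure (posterior \<tau> x) A * marginal_ratio \<tau> x) \<le> std_normal_density x * (1 / 2)"
    by (simp add: mult_ac)
  then show ?thesis using p by simp
qed

lemma s_value_upper:
  assumes "0 < \<tau>"
  shows "s_value x \<tau> * marginal_ratio \<tau> x \<le> 1"
proof -
  have g: "0 < marginal_ratio \<tau> x" by (rule marginal_ratio_pos[OF assms])
  show ?thesis
  proof (cases "0 \<le> x")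
    case True
    have "s_value x \<tau> \<le> 2 * measure (posterior \<tau> x) {..<0}" by (simp add: s_value_def)
    with g have "s_value x \<tau> * marginal_ratio \<tau> x \<le> 2 * measure (posterior \<tau> x) {..<0} * marginal_ratio \<tau> x"
      by simp
    also have "\<dots> \<le> 1"
      using True assms by (intro posterior_half_upper measure_horseshoe_half) (auto intro: mult_nonneg_nonpos)
    finally show ?thesis .
  next
    case False
    have "s_value x \<tau> \<le> 2 * measure (posterior \<tau> x) {0<..}" by (simp add: s_value_def)
    with g have "s_value x \<tau> * marginal_ratio \<tau> x \<le> 2 * measure (posterior \<tau> x) {0<..} * marginal_ratio \<tau> x"
      by simp
    also have "\<dots> \<le> 1"
      using False assms by (intro posterior_half_upper measure_horseshoe_half) (auto intro: mult_nonpos_nonneg)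
    finally show ?thesis .
  qed
qed

text \<open>Cutting A down to |\<theta>| < \<delta> / (1 + |x|) keeps the likelihood exponent above
  - \<delta> - \<delta>^2 / 2, and \<open>horseshoe_tail\<close> bounds the prior mass cut off. The
  sign of x plays no part, so both half-lines, and hence their minimum in the s-value, are
  covered.\<close>

lemma posterior_half_lower:
  assumes "0 < \<tau>" and [measurable]: "A \<in> sets borel" and A: "measure (horseshoe \<tau>) A = 1 / 2"
    and d: "0 < \<delta>" "\<delta> \<le> 1"
  shows "exp (- \<delta> - \<delta>\<^sup>2 / 2) * (1 - 8 * \<tau> * (1 + \<bar>x\<bar>)\<^sup>2 / \<delta>\<^sup>2)
    \<le> 2 * measure (posterior \<tau> x) A * marginal_ratio \<tau> x"
proof -
  interpret prob_space "horseshoe \<tau>" by (rule prob_space_horseshoe[OF assms(1)])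
  have p: "0 < std_normal_density x" by (rule normal_density_pos) simp
  define a where "a = \<delta> / (1 + \<bar>x\<bar>)"
  have a: "0 < a" "a \<le> \<delta>" "\<bar>x\<bar> * a \<le> \<delta>"
    using d by (auto simp: a_def field_simps add_pos_nonneg)
  define B where "B = A - {\<theta>. a \<le> \<bar>\<theta>\<bar>}"
  have [measurable]: "{\<theta>::real. a \<le> \<bar>\<theta>\<bar>} \<in> sets borel" by measurable
  then have [measurable]: "B \<in> sets borel" by (simp add: B_def)
  have "measure (horseshoe \<tau>) A \<le> measure (horseshoe \<tau>) (B \<union> {\<theta>. a \<le> \<bar>\<theta>\<bar>})"
    by (intro finite_measure_mono) (auto simp: B_def)
  also have "\<dots> \<le> measure (horseshoe \<tau>) B + measure (horseshoe \<tau>) {\<theta>. a \<le> \<bar>\<theta>\<bar>}"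
    by (intro measure_Un_le) auto
  also have "measure (horseshoe \<tau>) {\<theta>. a \<le> \<bar>\<theta>\<bar>} \<le> 4 * \<tau> / a\<^sup>2"
    using a d assms by (intro horseshoe_tail) auto
  also have "4 * \<tau> / a\<^sup>2 = 4 * \<tau> * (1 + \<bar>x\<bar>)\<^sup>2 / \<delta>\<^sup>2"
    by (simp add: a_def power_divide)
  finally have B: "1 / 2 - 4 * \<tau> * (1 + \<bar>x\<bar>)\<^sup>2 / \<delta>\<^sup>2 \<le> measure (horseshoe \<tau>) B"
    using A by simp
  let ?e = "exp (- \<delta> - \<delta>\<^sup>2 / 2)"
  have "std_normal_density x * (?e * measure (horseshoe \<tau>) B)
      = (\<integral>\<theta>. indicator B \<theta> * (std_normal_density x * ?e) \<partial>horseshoe \<tau>)" by simp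
  also have "\<dots> \<le> (\<integral>\<theta>. std_normal_density (x - \<theta>) * indicator A \<theta> \<partial>horseshoe \<tau>)"
  proof (rule integral_mono)
    fix \<theta> :: real
    have "- \<delta> - \<delta>\<^sup>2 / 2 \<le> x * \<theta> - \<theta>\<^sup>2 / 2" if "\<theta> \<in> B"
    proof -
      have t: "\<bar>\<theta>\<bar> \<le> a" using that by (auto simp: B_def)
      have "\<bar>x * \<theta>\<bar> \<le> \<bar>x\<bar> * a" unfolding abs_mult using t by (intro mult_left_mono) auto
      then have "- \<delta> \<le> x * \<theta>" using a by linarith
      moreover have "\<theta>\<^sup>2 \<le> \<delta>\<^sup>2" using t a d by (intro power2_le_iff_abs_le[THEN iffD2]) auto
      ultimately show ?thesis by linarith
    qed
    then show "indicator B \<theta> * (std_normal_density x * ?e) \<le> std_normal_density (x - \<theta>) * indicator A \<theta>"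
      unfolding std_normal_density_diff[of x] using p by (auto simp: indicator_def B_def)
  qed (rule integrable_horseshoe_normal integrable_horseshoe_indicator, fact assms(1), measurable)+
  also have "\<dots> = std_normal_density x * (measure (posterior \<tau> x) A * marginal_ratio \<tau> x)"
    unfolding measure_posterior[OF assms(1,2), symmetric] by (simp add: mult_ac)
  finally have "?e * measure (horseshoe \<tau>) B \<le> measure (posterior \<tau> x) A * marginal_ratio \<tau> x"
    using p by simp
  moreover have "?e * (1 / 2 - 4 * \<tau> * (1 + \<bar>x\<bar>)\<^sup>2 / \<delta>\<^sup>2) \<le> ?e * measure (horseshoe \<tau>) B"
    using B by (intro mult_left_mono) auto
  moreover have "?e * (1 - 8 * \<tau> * (1 + \<bar>x\<bar>)\<^sup>2 / \<delta>\<^sup>2) = 2 * (?e * (1 / 2 - 4 * \<tau> * (1 + \<bar>x\<bar>)\<^sup>2 / \<delta>\<^sup>2))"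
    by (simp add: algebra_simps)
  ultimately show ?thesis by linarith
qed

lemma s_value_lower:
  assumes "0 < \<tau>" "0 < \<delta>" "\<delta> \<le> 1"
  shows "exp (- \<delta> - \<delta>\<^sup>2 / 2) * (1 - 8 * \<tau> * (1 + \<bar>x\<bar>)\<^sup>2 / \<delta>\<^sup>2) \<le> s_value x \<tau> * marginal_ratio \<tau> x"
proof -
  have "s_value x \<tau> * marginal_ratio \<tau> x
    = min (2 * measure (posterior \<tau> x) {..<0} * marginal_ratio \<tau> x)
        (2 * measure (posterior \<tau> x) {0<..} * marginal_ratio \<tau> x)"
    using marginal_ratio_pos[OF assms(1), of x] by (auto simp: s_value_def min_def)
  then show ?thesis
    using posterior_half_lower[OF assms(1) _ measure_horseshoe_half(1) assms(2,3), of x]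
      posterior_half_lower[OF assms(1) _ measure_horseshoe_half(2) assms(2,3), of x] assms(1) by simp
qed

text \<open>The s-value is at most 1 / g, so rejection follows once the lower bound on g exceeds 1 /
  t.\<close>

lemma s_value_less:
  assumes "0 < \<tau>" "\<tau> \<le> 2" "1 \<le> \<bar>x\<bar>" "224 * x\<^sup>2 * std_normal_density x < t * \<tau>"
  shows "s_value x \<tau> < t"
proof -
  let ?g = "marginal_ratio \<tau> x"
  have g: "0 < ?g" by (rule marginal_ratio_pos[OF assms(1)])
  have x: "0 < x\<^sup>2" using assms(3) by auto
  have "\<tau> / (224 * x\<^sup>2) \<le> std_normal_density x * ?g" using assms by (intro marginal_lower)
  then have "\<tau> \<le> 224 * x\<^sup>2 * std_normal_density x * ?g" using x by (simp add: field_simps)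
  also have "\<dots> < t * \<tau> * ?g" using assms(4) g by (intro mult_strict_right_mono)
  finally have "1 < t * ?g" using assms(1) by simp
  with s_value_upper[OF assms(1), of x] have "s_value x \<tau> * ?g < t * ?g" by linarith
  then show ?thesis using g by simp
qed

text \<open>As \<delta> tends to 0, the lower bound on s-value times g and the upper bound on g both
  tend to 1, so for some \<delta> their quotient exceeds t. The first smallness condition keeps the
  prior concentrated near 0, the second keeps g near 1.\<close>

lemma s_value_ge:
  assumes "t < 1"
  shows "\<exists>c>0. \<forall>\<tau> x. 0 < \<tau> \<longrightarrow> \<tau> * (1 + \<bar>x\<bar>)\<^sup>2 \<le> c \<longrightarrow> \<tau> \<le> c * (2 + x\<^sup>2) * std_normal_density x \<longrightarrow> t \<le> s_value x \<tau>"
proof -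
  have "((\<lambda>\<delta>::real. exp (- \<delta> - \<delta>\<^sup>2 / 2) * (1 - \<delta>) / (exp (\<delta>\<^sup>2 / 2) + \<delta>)) \<longlongrightarrow> 1) (at_right 0)"
    by real_asymp
  then have "eventually (\<lambda>\<delta>::real. t < exp (- \<delta> - \<delta>\<^sup>2 / 2) * (1 - \<delta>) / (exp (\<delta>\<^sup>2 / 2) + \<delta>)) (at_right 0)"
    using assms by (rule order_tendstoD)
  moreover have "eventually (\<lambda>\<delta>::real. \<delta> \<in> {0<..<1}) (at_right 0)"
    by (rule eventually_at_right_real) simp
  ultimately have "eventually (\<lambda>\<delta>::real. t < exp (- \<delta> - \<delta>\<^sup>2 / 2) * (1 - \<delta>) / (exp (\<delta>\<^sup>2 / 2) + \<delta>) \<and> \<delta> \<in> {0<..<1}) (at_right 0)"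
    by (rule eventually_conj)
  then obtain \<delta> :: real where d: "0 < \<delta>" "\<delta> < 1"
    "t < exp (- \<delta> - \<delta>\<^sup>2 / 2) * (1 - \<delta>) / (exp (\<delta>\<^sup>2 / 2) + \<delta>)"
    using eventually_happens[of _ "at_right (0::real)"] by force
  \<comment> \<open>Chosen so that 1728 * c = \<delta> * \<delta>^2: the tail term of
    \<open>marginal_upper\<close> with \<epsilon> = \<delta> is then at most \<delta> times the null
    density.\<close>
  define c where "c = \<delta> ^ 3 / 1728"
  have "t \<le> s_value x \<tau>" if H: "0 < \<tau>" "\<tau> * (1 + \<bar>x\<bar>)\<^sup>2 \<le> c" "\<tau> \<le> c * (2 + x\<^sup>2) * std_normal_density x" for \<tau> x
  proof -
    let ?g = "marginal_ratio \<tau> x" and ?\<phi> = "std_normal_density x"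
    have g: "0 < ?g" by (rule marginal_ratio_pos[OF H(1)])
    have p: "0 < ?\<phi>" by (rule normal_density_pos) simp
    have x: "0 < 2 + x\<^sup>2" by (simp add: add_pos_nonneg)
    have "8 * \<tau> * (1 + \<bar>x\<bar>)\<^sup>2 \<le> \<delta> * \<delta>\<^sup>2"
    proof -
      have "\<delta> * \<delta>\<^sup>2 = 1728 * c" by (simp add: c_def power2_eq_square power3_eq_cube)
      moreover have "0 \<le> \<tau> * (1 + \<bar>x\<bar>)\<^sup>2" using H(1) by simp
      ultimately show ?thesis using H(2) by linarith
    qed
    then have "8 * \<tau> * (1 + \<bar>x\<bar>)\<^sup>2 / \<delta>\<^sup>2 \<le> \<delta>" using d by (simp add: divide_le_eq)
    then have "exp (- \<delta> - \<delta>\<^sup>2 / 2) * (1 - \<delta>) \<le> exp (- \<delta> - \<delta>\<^sup>2 / 2) * (1 - 8 * \<tau> * (1 + \<bar>x\<bar>)\<^sup>2 / \<delta>\<^sup>2)"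
      by (intro mult_left_mono) auto
    also have "\<dots> \<le> s_value x \<tau> * ?g" using H d by (intro s_value_lower) auto
    finally have 1: "exp (- \<delta> - \<delta>\<^sup>2 / 2) * (1 - \<delta>) \<le> s_value x \<tau> * ?g" .
    have "1728 * \<tau> \<le> \<delta> * ?\<phi> * (\<delta>\<^sup>2 * (2 + x\<^sup>2))"
      using H(3) by (simp add: c_def power2_eq_square power3_eq_cube mult_ac)
    then have "1728 * \<tau> / (\<delta>\<^sup>2 * (2 + x\<^sup>2)) \<le> \<delta> * ?\<phi>" using d x by (simp add: divide_le_eq)
    moreover have "?\<phi> * ?g \<le> exp (\<delta>\<^sup>2 / 2) * ?\<phi> + 1728 * \<tau> / (\<delta>\<^sup>2 * (2 + x\<^sup>2))"
      using H d by (intro marginal_upper) auto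
    ultimately have "?\<phi> * ?g \<le> ?\<phi> * (exp (\<delta>\<^sup>2 / 2) + \<delta>)" by (simp add: algebra_simps)
    then have 2: "?g \<le> exp (\<delta>\<^sup>2 / 2) + \<delta>" using p by simp
    have s0: "0 \<le> s_value x \<tau>" by (simp add: s_value_def)
    have "exp (- \<delta> - \<delta>\<^sup>2 / 2) * (1 - \<delta>) \<le> s_value x \<tau> * (exp (\<delta>\<^sup>2 / 2) + \<delta>)"
      using 1 mult_left_mono[OF 2 s0] by linarith
    then have "exp (- \<delta> - \<delta>\<^sup>2 / 2) * (1 - \<delta>) / (exp (\<delta>\<^sup>2 / 2) + \<delta>) \<le> s_value x \<tau>"
      using d by (simp add: divide_le_eq add_pos_pos)
    then show ?thesis using d by linarith
  qed
  moreover have "0 < c" using d by (simp add: c_def)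
  ultimately show ?thesis by blast
qed

section \<open>Hellinger affinity between the marginal and the null density\<close>

lemma integrable_marginal:
  assumes "0 < \<tau>"
  shows "integrable lborel (\<lambda>x. std_normal_density x * marginal_ratio \<tau> x)"
    "(\<integral>x. std_normal_density x * marginal_ratio \<tau> x \<partial>lborel) = 1"
proof -
  have n: "0 \<le> std_normal_density x * marginal_ratio \<tau> x" for x
    using marginal_ratio_pos[OF assms, of x] by (simp add: less_imp_le)
  then show "integrable lborel (\<lambda>x. std_normal_density x * marginal_ratio \<tau> x)"
    by (intro integrableI_nn_integral_finite[where x = 1])
      (simp_all add: integral_marginal_ratio[OF assms])
  show "(\<integral>x. std_normal_density x * marginal_ratio \<tau> x \<partial>lborel) = 1"
    using n by (subst integral_eq_nn_integral) (simp_all add: integral_marginal_ratio[OF assms])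
qed

text \<open>\<open>1 - E (sqrt g) = E (1 - sqrt g)\<^sup>2 / 2\<close> when \<open>g\<close> has mean \<open>1\<close>; the right-hand side is bounded below
  by the mass that the marginal puts on an interval where \<open>4 \<le> g\<close>.\<close>

lemma hellinger_affinity:
  assumes "0 < \<tau>" "\<tau> \<le> 2" "1 \<le> Z" and big: "\<And>x. Z \<le> x \<Longrightarrow> x \<le> 2 * Z \<Longrightarrow> 4 \<le> marginal_ratio \<tau> x"
  shows "(\<integral>\<^sup>+ x. ennreal (sqrt (marginal_ratio \<tau> x)) \<partial>normal_law 0 1) \<le> ennreal (exp (- (\<tau> / (7168 * Z))))"
proof -
  let ?\<phi> = std_normal_density and ?g = "marginal_ratio \<tau>"
  have g: "0 \<le> ?g x" for x using marginal_ratio_pos[OF assms(1), of x] by simp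
  note int = integrable_marginal[OF assms(1)]
  have intn: "integrable lborel ?\<phi>" "(\<integral>x. ?\<phi> x \<partial>lborel) = 1"
    using integrable_normal_density[of 1 0] integral_normal_density[of 1 0] by simp_all
  have am: "sqrt y \<le> (1 + y) / 2" if "0 \<le> y" for y :: real
    using arith_geo_mean_sqrt[of 1 y] that by simp
  have si: "integrable lborel (\<lambda>x. ?\<phi> x * sqrt (?g x))"
  proof (rule Bochner_Integration.integrable_bound)
    show "integrable lborel (\<lambda>x. ?\<phi> x + ?\<phi> x * ?g x)" using int intn by simp
    show "AE x in lborel. norm (?\<phi> x * sqrt (?g x)) \<le> norm (?\<phi> x + ?\<phi> x * ?g x)"
    proof (rule AE_I2)
      fix x
      have "sqrt (?g x) \<le> (1 + ?g x) / 2" by (rule am[OF g])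
      also have "\<dots> \<le> 1 + ?g x" using g[of x] by simp
      finally have "sqrt (?g x) \<le> 1 + ?g x" .
      then have "?\<phi> x * sqrt (?g x) \<le> ?\<phi> x * (1 + ?g x)" by (intro mult_left_mono) auto
      then show "norm (?\<phi> x * sqrt (?g x)) \<le> norm (?\<phi> x + ?\<phi> x * ?g x)"
        using g by (simp add: algebra_simps)
    qed
  qed simp
  \<comment> \<open>The lower bound of \<open>marginal_lower\<close> at the right endpoint 2 * Z,
    times the 1 / 8 gained below; over length Z this gives 7168 = 224 * 4 * 8.\<close>
  define c where "c = \<tau> / (224 * (2 * Z)\<^sup>2 * 8)"
  have "(\<integral>x. ?\<phi> x * sqrt (?g x) \<partial>lborel)
    \<le> (\<integral>x. (?\<phi> x + ?\<phi> x * ?g x) / 2 - indicator {Z..2 * Z} x * c \<partial>lborel)"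
  proof (rule integral_mono[OF si])
    show "integrable lborel (\<lambda>x. (?\<phi> x + ?\<phi> x * ?g x) / 2 - indicator {Z..2 * Z} x * c)"
      using int intn assms by (intro Bochner_Integration.integrable_diff integral_indicator_Icc) auto
    fix x :: real
    show "?\<phi> x * sqrt (?g x) \<le> (?\<phi> x + ?\<phi> x * ?g x) / 2 - indicator {Z..2 * Z} x * c"
    proof (cases "x \<in> {Z..2 * Z}")
      case True
      then have x: "Z \<le> x" "x \<le> 2 * Z" "1 \<le> \<bar>x\<bar>" using assms by auto
      define u where "u = sqrt (?g x)"
      have u: "2 \<le> u" "?g x = u\<^sup>2"
        using g[of x] big[OF x(1,2)] by (auto simp: u_def intro!: real_le_rsqrt)
      \<comment> \<open>With g = u^2 this is the inequality between geometric and arithmetic mean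
        sharpened by g / 8, valid for u \<ge> 2.\<close>
      have "0 \<le> (3 * u - 2) * (u - 2)" using u by (intro mult_nonneg_nonneg) auto
      then have "u \<le> (1 + ?g x) / 2 - ?g x / 8" unfolding u(2) by (simp add: power2_eq_square algebra_simps)
      then have "?\<phi> x * u \<le> ?\<phi> x * ((1 + ?g x) / 2 - ?g x / 8)" by (intro mult_left_mono) auto
      moreover have "c \<le> ?\<phi> x * ?g x / 8"
      proof -
        have "x\<^sup>2 \<le> (2 * Z)\<^sup>2" using x assms by (intro power_mono) auto
        moreover have "0 < x\<^sup>2" using x by auto
        ultimately have "\<tau> / (224 * (2 * Z)\<^sup>2) \<le> \<tau> / (224 * x\<^sup>2)"
          using assms by (intro divide_left_mono) auto
        also have "\<dots> \<le> ?\<phi> x * ?g x" using assms x by (intro marginal_lower)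
        finally show ?thesis by (simp add: c_def)
      qed
      ultimately show ?thesis using True by (simp add: u_def[symmetric] algebra_simps)
    next
      case False
      have "?\<phi> x * sqrt (?g x) \<le> ?\<phi> x * ((1 + ?g x) / 2)" using am[OF g] by (intro mult_left_mono) auto
      then show ?thesis using False by (simp add: algebra_simps)
    qed
  qed
  also have "\<dots> = 1 - Z * c"
    using int intn assms integral_indicator_Icc[of Z "2 * Z"]
    by (subst Bochner_Integration.integral_diff) auto
  also have "Z * c = \<tau> / (7168 * Z)" using assms by (simp add: c_def power2_eq_square)
  also have "1 - \<tau> / (7168 * Z) \<le> exp (- (\<tau> / (7168 * Z)))"
    using exp_ge_add_one_self[of "- (\<tau> / (7168 * Z))"] by simp
  finally have "(\<integral>x. ?\<phi> x * sqrt (?g x) \<partial>lborel) \<le> exp (- (\<tau> / (7168 * Z)))" .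
  moreover have "(\<integral>\<^sup>+ x. ennreal (sqrt (?g x)) \<partial>normal_law 0 1) = ennreal (\<integral>x. ?\<phi> x * sqrt (?g x) \<partial>lborel)"
    unfolding normal_law_def using si g
    by (subst nn_integral_density) (auto simp: nn_integral_eq_integral simp flip: ennreal_mult)
  ultimately show ?thesis by (simp add: ennreal_leI)
qed

text \<open>Beyond Z = 3 * sqrt L the null density is at most exp (- 9 * L / 2), far below \<tau> /
  x^2 even at the smallest scale exp (- L), so g \<ge> 4 there. The marginal puts mass of order
  \<tau> / Z on that range, which is where the division by sqrt L comes from; 21504 = 3 *
  7168.\<close>

lemma hellinger_affinity_eventually:
  "\<forall>\<^sub>F L in at_top. \<forall>\<tau>. exp (- L) \<le> \<tau> \<and> \<tau> \<le> 2 \<longrightarrow>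
    (\<integral>\<^sup>+ x. ennreal (sqrt (marginal_ratio \<tau> x)) \<partial>normal_law 0 1) \<le> ennreal (exp (- (\<tau> / (21504 * sqrt L))))"
proof -
  have "\<forall>\<^sub>F L::real in at_top. 4 * (224 * 36 * L) \<le> exp (7 / 2 * L)" by real_asymp
  moreover have "\<forall>\<^sub>F L::real in at_top. 1 \<le> L" by (rule eventually_ge_at_top)
  ultimately show ?thesis
  proof eventually_elim
    case (elim L)
    define Z where "Z = 3 * sqrt L"
    have Z: "1 \<le> Z" "Z\<^sup>2 = 9 * L" using real_sqrt_ge_one[of L] elim(2) unfolding Z_def by (linarith, simp add: power_mult_distrib)
    show ?case
    proof (intro allI impI)
      fix \<tau> assume t: "exp (- L) \<le> \<tau> \<and> \<tau> \<le> 2"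
      then have t0: "0 < \<tau>" using exp_gt_zero[of "- L"] by linarith
      have "4 \<le> marginal_ratio \<tau> x" if x: "Z \<le> x" "x \<le> 2 * Z" for x
      proof -
        have x2: "9 * L \<le> x\<^sup>2" "x\<^sup>2 \<le> 36 * L"
          using power_mono[OF x(1), of 2] power_mono[OF x(2), of 2] x Z by (auto simp: power_mult_distrib)
        have xp: "0 < x\<^sup>2" using x2 elim by linarith
        have "std_normal_density x \<le> exp (- x\<^sup>2 / 2)" by (rule std_normal_density_le)
        also have "\<dots> \<le> exp (- (9 / 2) * L)" using x2 by simp
        finally have p: "std_normal_density x \<le> exp (- (9 / 2) * L)" .
        have "4 * (224 * x\<^sup>2) * exp (- (9 / 2) * L) \<le> 4 * (224 * (36 * L)) * exp (- (9 / 2) * L)"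
          using x2 by (intro mult_right_mono) auto
        also have "\<dots> \<le> exp (7 / 2 * L) * exp (- (9 / 2) * L)"
          using elim by (intro mult_right_mono) auto
        also have "\<dots> = exp (- L)" by (simp flip: exp_add)
        also have "\<dots> \<le> \<tau>" using t by simp
        also have "\<tau> \<le> 224 * x\<^sup>2 * (std_normal_density x * marginal_ratio \<tau> x)"
          using marginal_lower[of \<tau> x] t0 t x Z xp by (simp add: divide_le_eq mult_ac)
        also have "\<dots> \<le> 224 * x\<^sup>2 * (exp (- (9 / 2) * L) * marginal_ratio \<tau> x)"
          using p marginal_ratio_pos[OF t0, of x] by (intro mult_left_mono mult_right_mono) auto
        finally have "(224 * x\<^sup>2 * exp (- (9 / 2) * L)) * 4 \<le> (224 * x\<^sup>2 * exp (- (9 / 2) * L)) * marginal_ratio \<tau> x"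
          by (simp add: mult_ac)
        then show ?thesis using xp by simp
      qed
      from hellinger_affinity[OF t0 _ Z(1) this] t
      show "(\<integral>\<^sup>+ x. ennreal (sqrt (marginal_ratio \<tau> x)) \<partial>normal_law 0 1) \<le> ennreal (exp (- (\<tau> / (21504 * sqrt L))))"
        by (simp add: Z_def)
    qed
  qed
qed

section \<open>Gaussian tails and Chernoff bounds\<close>

lemma prob_space_normal_law: "0 < \<sigma> \<Longrightarrow> prob_space (normal_law m \<sigma>)"
  unfolding normal_law_def by (rule prob_space_normal_density)

lemma emeasure_normal_law_shift:
  assumes [measurable]: "A \<in> sets borel"
  shows "emeasure (normal_law m 1) A = emeasure (normal_law 0 1) {e. m + e \<in> A}"
proof -
  have [measurable]: "{e. m + e \<in> A} \<in> sets borel" by measurable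
  have "emeasure (normal_law m 1) A = (\<integral>\<^sup>+ x. ennreal (normal_density m 1 x) * indicator A x \<partial>lborel)"
    by (simp add: normal_law_def emeasure_density)
  also have "\<dots> = (\<integral>\<^sup>+ e. ennreal (normal_density m 1 (m + 1 * e)) * indicator A (m + 1 * e) \<partial>lborel)"
    by (subst nn_integral_real_affine[where t = m and c = 1]) auto
  also have "\<dots> = (\<integral>\<^sup>+ e. ennreal (std_normal_density e) * indicator {e. m + e \<in> A} e \<partial>lborel)"
    by (intro nn_integral_cong) (simp add: normal_density_def indicator_def)
  also have "\<dots> = emeasure (normal_law 0 1) {e. m + e \<in> A}"
    by (simp add: normal_law_def emeasure_density)
  finally show ?thesis .
qed

lemma measure_normal_law_shift:
  "A \<in> sets borel \<Longrightarrow> measure (normal_law m 1) A = measure (normal_law 0 1) {e. m + e \<in> A}"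
  unfolding measure_def by (rule arg_cong[OF emeasure_normal_law_shift])

lemma measure_std_normal_lessThan: "measure (normal_law 0 1) {..<- u} = Phi_bar u"
proof -
  have "emeasure (normal_law 0 1) {..<- u}
      = (\<integral>\<^sup>+ x. ennreal (std_normal_density x) * indicator {..<- u} x \<partial>lborel)"
    by (simp add: normal_law_def emeasure_density)
  also have "\<dots> = (\<integral>\<^sup>+ e. ennreal (std_normal_density (0 + (-1) * e)) * indicator {..<- u} (0 + (-1) * e) \<partial>lborel)"
    by (subst nn_integral_real_affine[where t = 0 and c = "-1"]) auto
  also have "\<dots> = (\<integral>\<^sup>+ e. ennreal (std_normal_density e) * indicator {u<..} e \<partial>lborel)"
    by (intro nn_integral_cong) (simp add: normal_density_def indicator_def)
  also have "\<dots> = emeasure (normal_law 0 1) {u<..}"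
    by (simp add: normal_law_def emeasure_density)
  finally show ?thesis by (simp add: measure_def Phi_bar_def)
qed

lemma Phi_bar_nonneg: "0 \<le> Phi_bar u"
  by (simp add: Phi_bar_def)

lemma Phi_bar_antimono:
  assumes "u \<le> v"
  shows "Phi_bar v \<le> Phi_bar u"
proof -
  interpret prob_space "normal_law 0 1" by (rule prob_space_normal_law) simp
  show ?thesis unfolding Phi_bar_def using assms by (intro finite_measure_mono) auto
qed

lemma Phi_bar_lipschitz:
  assumes "u \<le> v"
  shows "Phi_bar u \<le> Phi_bar v + (v - u)"
proof -
  interpret prob_space "normal_law 0 1" by (rule prob_space_normal_law) simp
  have "emeasure (normal_law 0 1) {u..v}
      = (\<integral>\<^sup>+ x. ennreal (std_normal_density x) * indicator {u..v} x \<partial>lborel)"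
    by (simp add: normal_law_def emeasure_density)
  also have "\<dots> \<le> (\<integral>\<^sup>+ x. indicator {u..v} x \<partial>lborel)"
    using std_normal_density_le_1 by (intro nn_integral_mono) (auto simp: indicator_def)
  also have "\<dots> = ennreal (v - u)" using assms by simp
  finally have "measure (normal_law 0 1) {u..v} \<le> v - u"
    using assms by (simp add: emeasure_eq_measure)
  moreover have "Phi_bar u \<le> measure (normal_law 0 1) ({v<..} \<union> {u..v})"
    unfolding Phi_bar_def by (intro finite_measure_mono) auto
  moreover have "\<dots> \<le> measure (normal_law 0 1) {v<..} + measure (normal_law 0 1) {u..v}"
    by (intro measure_Un_le) auto
  ultimately show ?thesis by (simp add: Phi_bar_def)
qed

text \<open>Makes the detected fraction of signals positive even for very negative b.\<close>

lemma Phi_bar_less_1: "Phi_bar u < 1"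
proof (rule ccontr)
  assume "\<not> ?thesis"
  interpret prob_space "normal_law 0 1" by (rule prob_space_normal_law) simp
  have "measure (normal_law 0 1) {..u} = 1 - Phi_bar u"
    using prob_compl[of "{u<..}"] by (simp add: Phi_bar_def Compl_eq_Diff_UNIV[symmetric])
  with \<open>\<not> ?thesis\<close> have "measure (normal_law 0 1) {..u} = 0"
    using measure_nonneg[of "normal_law 0 1" "{..u}"] by linarith
  then have "{..u} \<in> null_sets (normal_law 0 1)"
    by (simp add: null_sets_def emeasure_eq_measure)
  then have "AE x in lborel. x \<in> {..u} \<longrightarrow> ennreal (std_normal_density x) = 0"
    unfolding normal_law_def by (subst (asm) null_sets_density_iff) auto
  then have "AE x in lborel. x \<notin> {u - 1..u}"
  proof (rule eventually_mono)
    fix x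
    assume H: "x \<in> {..u} \<longrightarrow> ennreal (std_normal_density x) = 0"
    have "0 < std_normal_density x" by (rule normal_density_pos) simp
    with H show "x \<notin> {u - 1..u}" by (auto simp: ennreal_eq_0_iff)
  qed
  moreover have "{x \<in> space lborel. \<not> x \<notin> {u - 1..u}} = {u - 1..u}" by auto
  ultimately have "emeasure lborel {u - 1..u} = 0"
    by (subst (asm) AE_iff_measurable[of "{u - 1..u}"]) auto
  then show False by simp
qed

text \<open>Shifted by u, the normal density is dominated by a multiple of the exponential density
  of rate u. The factor 1 / u is essential: n times the null density at T is only of order s, and
  dividing by T makes it negligible against s.\<close>

lemma Phi_bar_mills:
  assumes "0 < u"
  shows "Phi_bar u \<le> std_normal_density u / u"
proof -
  interpret prob_space "normal_law 0 1" by (rule prob_space_normal_law) simp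
  have "emeasure (normal_law 0 1) {u<..}
      = (\<integral>\<^sup>+ x. ennreal (std_normal_density x) * indicator {u<..} x \<partial>lborel)"
    by (simp add: normal_law_def emeasure_density)
  also have "\<dots> = (\<integral>\<^sup>+ y. ennreal (std_normal_density (u + 1 * y)) * indicator {u<..} (u + 1 * y) \<partial>lborel)"
    by (subst nn_integral_real_affine[where t = u and c = 1]) auto
  also have "\<dots> \<le> (\<integral>\<^sup>+ y. ennreal (std_normal_density u / u) * ennreal (exponential_density u y) \<partial>lborel)"
  proof (rule nn_integral_mono)
    fix y :: real
    show "ennreal (std_normal_density (u + 1 * y)) * indicator {u<..} (u + 1 * y)
        \<le> ennreal (std_normal_density u / u) * ennreal (exponential_density u y)"
    proof (cases "0 < y")
      case True
      have "std_normal_density (u + y) = std_normal_density u * exp (- y * u - y\<^sup>2 / 2)"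
        using std_normal_density_diff[of u "- y"] by (simp add: mult_ac)
      also have "\<dots> \<le> std_normal_density u * exp (- y * u)"
        by (intro mult_left_mono) auto
      also have "\<dots> = std_normal_density u / u * exponential_density u y"
        using True assms by (simp add: exponential_density_def)
      finally have "ennreal (std_normal_density (u + y)) \<le> ennreal (std_normal_density u / u * exponential_density u y)"
        by (rule ennreal_leI)
      with True assms show ?thesis
        by (subst ennreal_mult[symmetric]) (auto simp: exponential_density_nonneg)
    qed simp
  qed
  also have "\<dots> = ennreal (std_normal_density u / u) * (\<integral>\<^sup>+ y. ennreal (exponential_density u y) \<partial>lborel)"
    by (rule nn_integral_cmult) simp
  also have "(\<integral>\<^sup>+ y. ennreal (exponential_density u y) \<partial>lborel) = 1"
    using prob_space.emeasure_space_1[OF prob_space_exponential_density[OF assms]]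
    by (simp add: emeasure_density)
  finally show ?thesis
    using assms by (simp add: Phi_bar_def emeasure_eq_measure)
qed

lemma measure_normal_law_small:
  "measure (normal_law m 1) {x. \<bar>x\<bar> < a} \<le> Phi_bar (\<bar>m\<bar> - a)"
proof -
  interpret prob_space "normal_law 0 1" by (rule prob_space_normal_law) simp
  have [measurable]: "{x::real. \<bar>x\<bar> < a} \<in> sets borel" by measurable
  have *: "measure (normal_law m 1) {x. \<bar>x\<bar> < a} = measure (normal_law 0 1) {e. \<bar>m + e\<bar> < a}"
    by (subst measure_normal_law_shift) auto
  show ?thesis
  proof (cases "0 \<le> m")
    case True
    then have "measure (normal_law 0 1) {e. \<bar>m + e\<bar> < a} \<le> measure (normal_law 0 1) {..<- (\<bar>m\<bar> - a)}"
      by (intro finite_measure_mono) auto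
    then show ?thesis unfolding * measure_std_normal_lessThan .
  next
    case False
    then have "measure (normal_law 0 1) {e. \<bar>m + e\<bar> < a} \<le> measure (normal_law 0 1) {\<bar>m\<bar> - a<..}"
      by (intro finite_measure_mono) auto
    then show ?thesis unfolding * Phi_bar_def .
  qed
qed

lemma measure_std_normal_large: "measure (normal_law 0 1) {x. u < \<bar>x\<bar>} \<le> 2 * Phi_bar u"
proof -
  interpret prob_space "normal_law 0 1" by (rule prob_space_normal_law) simp
  have "measure (normal_law 0 1) {x. u < \<bar>x\<bar>} \<le> measure (normal_law 0 1) ({..<- u} \<union> {u<..})"
    by (intro finite_measure_mono) auto
  also have "\<dots> \<le> measure (normal_law 0 1) {..<- u} + measure (normal_law 0 1) {u<..}"
    by (intro measure_Un_le) auto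
  also have "\<dots> = 2 * Phi_bar u" unfolding measure_std_normal_lessThan by (simp add: Phi_bar_def)
  finally show ?thesis .
qed

text \<open>Noise below - b either brings the observation into the acceptance interval or overshoots
  it on the negative side; the overshoot has probability Phi_bar (2 * u + b).\<close>

lemma measure_normal_law_boundary:
  "Phi_bar b - Phi_bar (2 * u + b) \<le> measure (normal_law (u + b) 1) {x. \<bar>x\<bar> \<le> u}"
proof -
  interpret prob_space "normal_law 0 1" by (rule prob_space_normal_law) simp
  have [measurable]: "{e::real. \<bar>u + b + e\<bar> \<le> u} \<in> sets borel" "{x::real. \<bar>x\<bar> \<le> u} \<in> sets borel" by measurable
  have "measure (normal_law 0 1) {..<- b}
      \<le> measure (normal_law 0 1) ({e. \<bar>u + b + e\<bar> \<le> u} \<union> {..<- (2 * u + b)})"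
    by (intro finite_measure_mono) auto
  also have "\<dots> \<le> measure (normal_law 0 1) {e. \<bar>u + b + e\<bar> \<le> u} + measure (normal_law 0 1) {..<- (2 * u + b)}"
    by (intro measure_Un_le) auto
  finally show ?thesis
    unfolding measure_std_normal_lessThan by (subst measure_normal_law_shift) auto
qed

section \<open>Independence and exponential inequalities\<close>

lemma seq_law_eq_PiM: "seq_law n \<theta> = (\<Pi>\<^sub>M i\<in>{..<n}. normal_law (\<theta> i) 1)"
proof -
  interpret N: product_prob_space "\<lambda>i. normal_law (\<theta> i) 1" "{..<n}"
    by (intro product_prob_spaceI prob_space_normal_law) simp
  interpret E: product_prob_space "\<lambda>i. normal_law 0 1" "{..<n}"
    by (intro product_prob_spaceI prob_space_normal_law) simp
  have [measurable]: "(\<lambda>\<epsilon>. \<lambda>i\<in>{..<n}. \<theta> i + \<epsilon> i) \<in> (\<Pi>\<^sub>M i\<in>{..<n}. normal_law 0 1) \<rightarrow>\<^sub>M (\<Pi>\<^sub>M i\<in>{..<n}. borel)"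
    by measurable
  show ?thesis
  proof (rule N.PiM_eqI)
    show "sets (seq_law n \<theta>) = sets (\<Pi>\<^sub>M i\<in>{..<n}. normal_law (\<theta> i) 1)"
      unfolding seq_law_def by (auto intro!: sets_PiM_cong)
    fix A assume A: "\<And>i. i \<in> {..<n} \<Longrightarrow> A i \<in> sets (normal_law (\<theta> i) 1)"
    have pre: "{e. \<theta> i + e \<in> A i} \<in> sets borel" if "i \<in> {..<n}" for i
    proof -
      have [measurable]: "A i \<in> sets borel" using A[OF that] by simp
      show ?thesis by measurable
    qed
    have "emeasure (seq_law n \<theta>) (Pi\<^sub>E {..<n} A)
        = emeasure (\<Pi>\<^sub>M i\<in>{..<n}. normal_law 0 1) ((\<lambda>\<epsilon>. \<lambda>i\<in>{..<n}. \<theta> i + \<epsilon> i) -` (Pi\<^sub>E {..<n} A)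
          \<inter> space (\<Pi>\<^sub>M i\<in>{..<n}. normal_law 0 1))"
      unfolding seq_law_def using A by (intro emeasure_distr sets_PiM_I_finite) auto
    also have "(\<lambda>\<epsilon>. \<lambda>i\<in>{..<n}. \<theta> i + \<epsilon> i) -` (Pi\<^sub>E {..<n} A) \<inter> space (\<Pi>\<^sub>M i\<in>{..<n}. normal_law 0 1)
        = Pi\<^sub>E {..<n} (\<lambda>i. {e. \<theta> i + e \<in> A i})"
      unfolding space_PiM space_normal_law by (intro set_eqI) (simp add: PiE_iff)
    also have "emeasure (\<Pi>\<^sub>M i\<in>{..<n}. normal_law 0 1) \<dots> = (\<Prod>i\<in>{..<n}. emeasure (normal_law 0 1) {e. \<theta> i + e \<in> A i})"
      using pre by (intro E.emeasure_PiM) auto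
    also have "\<dots> = (\<Prod>i\<in>{..<n}. emeasure (normal_law (\<theta> i) 1) (A i))"
      using A by (intro prod.cong refl emeasure_normal_law_shift[symmetric]) simp
    finally show "emeasure (seq_law n \<theta>) (Pi\<^sub>E {..<n} A) = (\<Prod>i\<in>{..<n}. emeasure (normal_law (\<theta> i) 1) (A i))" .
  qed simp
qed

lemma prob_space_seq_law: "prob_space (seq_law n \<theta>)"
  unfolding seq_law_eq_PiM by (intro prob_space_PiM prob_space_normal_law) simp

lemma sets_seq_law [measurable_cong, simp]: "sets (seq_law n \<theta>) = sets (\<Pi>\<^sub>M i\<in>{..<n}. borel)"
  and space_seq_law [simp]: "space (seq_law n \<theta>) = {..<n} \<rightarrow>\<^sub>E UNIV"
  by (simp_all add: seq_law_def space_PiM)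

lemma measurable_seq_law_coord:
  assumes "i < n" "h \<in> borel \<rightarrow>\<^sub>M N"
  shows "(\<lambda>X. h (X i)) \<in> seq_law n \<theta> \<rightarrow>\<^sub>M N"
proof -
  have "(\<lambda>X. X i) \<in> seq_law n \<theta> \<rightarrow>\<^sub>M borel"
    using measurable_component_singleton[of i "{..<n}" "\<lambda>_. borel"] assms(1)
    by (simp cong: measurable_cong_sets)
  then show ?thesis using assms(2) by (rule measurable_compose)
qed

lemma nn_integral_seq_law_prod:
  assumes "I \<subseteq> {..<n}" and [measurable]: "\<And>i. i \<in> I \<Longrightarrow> f i \<in> borel_measurable borel"
  shows "(\<integral>\<^sup>+ X. (\<Prod>i\<in>I. f i (X i)) \<partial>seq_law n \<theta>) = (\<Prod>i\<in>I. \<integral>\<^sup>+ x. f i x \<partial>normal_law (\<theta> i) 1)"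
proof -
  interpret N: product_prob_space "\<lambda>i. normal_law (\<theta> i) 1" "{..<n}"
    by (intro product_prob_spaceI prob_space_normal_law) simp
  define h where "h i = (if i \<in> I then f i else (\<lambda>_. 1))" for i
  have [measurable]: "h i \<in> borel_measurable borel" for i
    using assms by (auto simp: h_def)
  have "(\<integral>\<^sup>+ X. (\<Prod>i\<in>I. f i (X i)) \<partial>seq_law n \<theta>) = (\<integral>\<^sup>+ X. (\<Prod>i\<in>{..<n}. h i (X i)) \<partial>seq_law n \<theta>)"
    using assms(1) by (intro nn_integral_cong prod.mono_neutral_cong_left) (auto simp: h_def)
  also have "\<dots> = (\<Prod>i\<in>{..<n}. \<integral>\<^sup>+ x. h i x \<partial>normal_law (\<theta> i) 1)"
    unfolding seq_law_eq_PiM by (intro N.product_nn_integral_prod) auto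
  also have "\<dots> = (\<Prod>i\<in>I. \<integral>\<^sup>+ x. f i x \<partial>normal_law (\<theta> i) 1)"
    using assms(1) prob_space.emeasure_space_1[OF prob_space_normal_law[of 1]]
    by (intro prod.mono_neutral_cong_right) (auto simp: h_def)
  finally show ?thesis .
qed

lemma measure_seq_law_coord:
  assumes "i < n" and [measurable]: "A \<in> sets borel"
  shows "measure (seq_law n \<theta>) {X \<in> space (seq_law n \<theta>). X i \<in> A} = measure (normal_law (\<theta> i) 1) A"
proof -
  have "{X \<in> space (seq_law n \<theta>). X i \<in> A} = (\<lambda>X. X i) -` A \<inter> space (seq_law n \<theta>)" by auto
  then have "{X \<in> space (seq_law n \<theta>). X i \<in> A} \<in> sets (seq_law n \<theta>)"
    using measurable_sets[OF measurable_seq_law_coord[OF assms(1) measurable_ident_sets[OF refl]] assms(2)]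
    by (simp del: sets_seq_law space_seq_law)
  then have "emeasure (seq_law n \<theta>) {X \<in> space (seq_law n \<theta>). X i \<in> A}
      = (\<integral>\<^sup>+ X. indicator {X \<in> space (seq_law n \<theta>). X i \<in> A} X \<partial>seq_law n \<theta>)" by simp
  also have "\<dots> = (\<integral>\<^sup>+ X. (\<Prod>i\<in>{i}. indicator A (X i)) \<partial>seq_law n \<theta>)"
    by (intro nn_integral_cong) (auto simp: indicator_def)
  also have "\<dots> = emeasure (normal_law (\<theta> i) 1) A"
    using assms(1) by (subst nn_integral_seq_law_prod) auto
  finally show ?thesis by (simp add: measure_def)
qed

lemma (in prob_space) markov_inequality_nn:
  fixes f :: "'a \<Rightarrow> real"
  assumes [measurable]: "f \<in> borel_measurable M" and "\<And>x. x \<in> space M \<Longrightarrow> 0 \<le> f x"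
    and "(\<integral>\<^sup>+ x. ennreal (f x) \<partial>M) \<le> ennreal B" "0 < a" "0 \<le> B"
  shows "prob {x \<in> space M. a \<le> f x} \<le> B / a"
proof -
  have "ennreal a * emeasure M {x \<in> space M. a \<le> f x} = (\<integral>\<^sup>+ x. ennreal a * indicator {x \<in> space M. a \<le> f x} x \<partial>M)"
    by (subst nn_integral_cmult_indicator) auto
  also have "\<dots> \<le> (\<integral>\<^sup>+ x. ennreal (f x) \<partial>M)"
    using assms by (intro nn_integral_mono) (auto simp: indicator_def intro: ennreal_leI)
  also have "\<dots> \<le> ennreal B" by fact
  finally have "ennreal (a * prob {x \<in> space M. a \<le> f x}) \<le> ennreal B"
    using assms by (simp add: emeasure_eq_measure ennreal_mult)
  then show ?thesis using assms by (simp add: field_simps)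
qed

lemma prod_mono_ennreal:
  fixes f g :: "'a \<Rightarrow> ennreal"
  assumes "\<And>i. i \<in> I \<Longrightarrow> f i \<le> g i"
  shows "prod f I \<le> prod g I"
  using assms by (induction I rule: infinite_finite_induct) (auto intro: mult_mono)

text \<open>Markov's inequality for exp (- count): since exp (- 1) \<le> 1 / 2, each factor has mean
  at most 1 - p / 2 \<le> exp (- p / 2). A threshold at p / 4 of the coordinates gives up half of
  the total exponent.\<close>

lemma count_chernoff:
  assumes S: "S \<subseteq> {..<n}" and [measurable]: "A \<in> sets borel"
    and p: "\<And>i. i \<in> S \<Longrightarrow> p \<le> measure (normal_law (\<theta> i) 1) A"
  shows "measure (seq_law n \<theta>) {X \<in> space (seq_law n \<theta>). real (card {i \<in> S. X i \<in> A}) \<le> p * real (card S) / 4}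
    \<le> exp (- (p * real (card S) / 4))"
proof -
  interpret P: prob_space "seq_law n \<theta>" by (rule prob_space_seq_law)
  have fin: "finite S" using S finite_subset by blast
  have ind: "(\<Prod>i\<in>S. exp (- indicator A (X i))) = exp (- real (card {i \<in> S. X i \<in> A}))" for X :: "nat \<Rightarrow> real"
  proof -
    have "(\<Sum>i\<in>S. indicator A (X i)) = real (card {i \<in> S. X i \<in> A})"
      using fin by (simp add: indicator_def of_bool_def sum.inter_filter[symmetric])
    then show ?thesis using fin by (simp add: exp_sum[symmetric] sum_negf)
  qed
  have S': "i \<in> S \<Longrightarrow> i < n" for i using S by auto
  have m: "(\<lambda>X. \<Prod>i\<in>S. exp (- indicator A (X i)) :: real) \<in> borel_measurable (seq_law n \<theta>)"
  proof (rule borel_measurable_prod)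
    fix i assume "i \<in> S"
    show "(\<lambda>X. exp (- indicator A (X i)) :: real) \<in> borel_measurable (seq_law n \<theta>)"
      by (rule measurable_seq_law_coord[OF S'[OF \<open>i \<in> S\<close>]]) measurable
  qed
  have "(\<integral>\<^sup>+ X. ennreal (\<Prod>i\<in>S. exp (- indicator A (X i))) \<partial>seq_law n \<theta>)
      = (\<Prod>i\<in>S. \<integral>\<^sup>+ x. ennreal (exp (- indicator A x)) \<partial>normal_law (\<theta> i) 1)"
    using S by (subst nn_integral_seq_law_prod[symmetric]) (auto simp: prod_ennreal)
  also have "\<dots> \<le> (\<Prod>i\<in>S. ennreal (exp (- (p / 2))))"
  proof (rule prod_mono_ennreal)
    fix i assume "i \<in> S"
    interpret N: prob_space "normal_law (\<theta> i) 1" by (rule prob_space_normal_law) simp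
    have e: "exp (- 1) \<le> (1 / 2 :: real)"
      using exp_ge_add_one_self[of 1] by (simp add: exp_minus field_simps)
    have "(\<integral>\<^sup>+ x. ennreal (exp (- indicator A x)) \<partial>normal_law (\<theta> i) 1)
        \<le> (\<integral>\<^sup>+ x. ennreal (1 - indicator A x * (1 / 2)) \<partial>normal_law (\<theta> i) 1)"
      using e by (intro nn_integral_mono ennreal_leI) (auto simp: indicator_def)
    also have "\<dots> = ennreal (\<integral>x. 1 - indicator A x * (1 / 2) \<partial>normal_law (\<theta> i) 1)"
      by (intro nn_integral_eq_integral N.integrable_const_bound[of _ 1]) (auto simp: indicator_def)
    also have "(\<integral>x. 1 - indicator A x * (1 / 2) \<partial>normal_law (\<theta> i) 1) = 1 - measure (normal_law (\<theta> i) 1) A / 2"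
    proof -
      have "integrable (normal_law (\<theta> i) 1) (\<lambda>x. indicator A x * (1 / 2) :: real)"
        by (intro N.integrable_const_bound[of _ 1]) (auto simp: indicator_def)
      then show ?thesis using N.prob_space by simp
    qed
    also have "1 - measure (normal_law (\<theta> i) 1) A / 2 \<le> exp (- (p / 2))"
      using p[OF \<open>i \<in> S\<close>] exp_ge_add_one_self[of "- (p / 2)"] by simp
    finally show "(\<integral>\<^sup>+ x. ennreal (exp (- indicator A x)) \<partial>normal_law (\<theta> i) 1) \<le> ennreal (exp (- (p / 2)))"
      by (simp add: ennreal_leI)
  qed
  also have "\<dots> = ennreal (exp (- (p * real (card S) / 2)))"
    by (simp add: ennreal_power mult.commute flip: exp_of_nat_mult)
  finally have I: "(\<integral>\<^sup>+ X. ennreal (\<Prod>i\<in>S. exp (- indicator A (X i))) \<partial>seq_law n \<theta>)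
    \<le> ennreal (exp (- (p * real (card S) / 2)))" .
  have "P.prob {X \<in> space (seq_law n \<theta>). exp (- (p * real (card S) / 4)) \<le> (\<Prod>i\<in>S. exp (- indicator A (X i)))}
      \<le> exp (- (p * real (card S) / 2)) / exp (- (p * real (card S) / 4))"
    by (rule P.markov_inequality_nn[OF m _ I]) (simp_all add: prod_nonneg)
  also have "\<dots> = exp (- (p * real (card S) / 4))"
    by (simp flip: exp_diff)
  finally show ?thesis unfolding ind by simp
qed

text \<open>Markov's inequality for the square root of the likelihood ratio, whose mean factorises
  into affinities. The ratio itself has mean 1 and would give no decay.\<close>

lemma likelihood_chernoff:
  assumes N: "N \<subseteq> {..<n}" "\<And>i. i \<in> N \<Longrightarrow> \<theta> i = 0" and "0 < \<tau>"
    and h: "(\<integral>\<^sup>+ x. ennreal (sqrt (marginal_ratio \<tau> x)) \<partial>normal_law 0 1) \<le> ennreal (exp (- h))"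
  shows "measure (seq_law n \<theta>) {X \<in> space (seq_law n \<theta>). exp (- a) \<le> (\<Prod>i\<in>N. marginal_ratio \<tau> (X i))}
    \<le> exp (a / 2 - h * real (card N))"
proof -
  interpret P: prob_space "seq_law n \<theta>" by (rule prob_space_seq_law)
  have N': "i \<in> N \<Longrightarrow> i < n" for i using N by auto
  have g: "0 \<le> marginal_ratio \<tau> x" for x using marginal_ratio_pos[OF assms(3), of x] by simp
  have m: "(\<lambda>X. \<Prod>i\<in>N. sqrt (marginal_ratio \<tau> (X i))) \<in> borel_measurable (seq_law n \<theta>)"
  proof (rule borel_measurable_prod)
    fix i assume "i \<in> N"
    show "(\<lambda>X. sqrt (marginal_ratio \<tau> (X i))) \<in> borel_measurable (seq_law n \<theta>)"
      by (rule measurable_seq_law_coord[OF N'[OF \<open>i \<in> N\<close>]]) measurable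
  qed
  have "(\<integral>\<^sup>+ X. ennreal (\<Prod>i\<in>N. sqrt (marginal_ratio \<tau> (X i))) \<partial>seq_law n \<theta>)
      = (\<Prod>i\<in>N. \<integral>\<^sup>+ x. ennreal (sqrt (marginal_ratio \<tau> x)) \<partial>normal_law (\<theta> i) 1)"
    using N g by (subst nn_integral_seq_law_prod[symmetric]) (auto simp: prod_ennreal)
  also have "\<dots> \<le> (\<Prod>i\<in>N. ennreal (exp (- h)))"
    using h N by (intro prod_mono_ennreal) auto
  also have "\<dots> = ennreal (exp (- (h * real (card N))))"
    by (simp add: ennreal_power mult.commute flip: exp_of_nat_mult)
  finally have I: "(\<integral>\<^sup>+ X. ennreal (\<Prod>i\<in>N. sqrt (marginal_ratio \<tau> (X i))) \<partial>seq_law n \<theta>)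
    \<le> ennreal (exp (- (h * real (card N))))" .
  have "P.prob {X \<in> space (seq_law n \<theta>). exp (- (a / 2)) \<le> (\<Prod>i\<in>N. sqrt (marginal_ratio \<tau> (X i)))}
      \<le> exp (- (h * real (card N))) / exp (- (a / 2))"
    by (rule P.markov_inequality_nn[OF m _ I]) (simp_all add: prod_nonneg g)
  also have "\<dots> = exp (a / 2 - h * real (card N))"
    by (simp flip: exp_diff)
  also have "{X \<in> space (seq_law n \<theta>). exp (- (a / 2)) \<le> (\<Prod>i\<in>N. sqrt (marginal_ratio \<tau> (X i)))}
    = {X \<in> space (seq_law n \<theta>). exp (- a) \<le> (\<Prod>i\<in>N. marginal_ratio \<tau> (X i))}"
  proof -
    have "exp (- (a / 2)) = sqrt (exp (- a))"
      by (rule real_sqrt_unique[symmetric]) (auto simp: power2_eq_square simp flip: exp_add)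
    moreover have "(\<Prod>i\<in>N. sqrt (marginal_ratio \<tau> (X i))) = sqrt (\<Prod>i\<in>N. marginal_ratio \<tau> (X i))" for X
      by (induction N rule: infinite_finite_induct) (auto simp: real_sqrt_mult)
    ultimately show ?thesis by simp
  qed
  finally show ?thesis .
qed

section \<open>Location of the maximum likelihood scale\<close>

lemma horseshoe_density_measurable2 [measurable]:
  "(\<lambda>(\<tau>, \<theta>). horseshoe_density \<tau> \<theta>) \<in> borel_measurable (borel \<Otimes>\<^sub>M borel)"
proof -
  interpret prob_space half_cauchy by (rule prob_space_half_cauchy)
  show ?thesis unfolding horseshoe_density_def case_prod_beta normal_density_def by measurable
qed

lemma marginal_measurable2 [measurable]:
  "(\<lambda>(\<tau>, x). marginal \<tau> x) \<in> borel_measurable (borel \<Otimes>\<^sub>M borel)"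
  unfolding marginal_def by measurable

lemma s_value_measurable [measurable]:
  "(\<lambda>(x, \<tau>). s_value x \<tau>) \<in> borel_measurable (borel \<Otimes>\<^sub>M borel)"
proof -
  have "emeasure (posterior \<tau> x) A = (\<integral>\<^sup>+ \<theta>. horseshoe_density \<tau> \<theta>
      * (ennreal (std_normal_density (x - \<theta>)) / marginal \<tau> x) * indicator A \<theta> \<partial>lborel)"
    if [measurable]: "A \<in> sets borel" for \<tau> x A
    unfolding posterior_def horseshoe_eq_density by (simp add: density_density_eq emeasure_density)
  then show ?thesis unfolding s_value_def measure_def by simp
qed

lemma s_procedure_sets [measurable]:
  assumes "is_mmle n \<tau>h" "i < n"
  shows "{X \<in> space (seq_law n \<theta>). s_procedure \<tau>h t X i} \<in> sets (seq_law n \<theta>)"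
proof -
  have [measurable]: "\<tau>h \<in> borel_measurable (seq_law n \<theta>)"
    using assms(1) by (simp add: is_mmle_def cong: measurable_cong_sets)
  have [measurable]: "(\<lambda>X. X i) \<in> borel_measurable (seq_law n \<theta>)"
    by (rule measurable_seq_law_coord[OF assms(2)]) simp
  show ?thesis unfolding s_procedure_def by measurable
qed

lemma mmle_range:
  assumes "is_mmle n \<tau>h" "X \<in> {..<n} \<rightarrow>\<^sub>E UNIV"
  shows "1 / real n \<le> \<tau>h X" "\<tau>h X \<le> 1"
  using assms by (auto simp: is_mmle_def is_arg_max_def)

lemma prod_marginal:
  assumes "0 < \<tau>"
  shows "(\<Prod>i<n. marginal \<tau> (X i))
    = ennreal ((\<Prod>i<n. std_normal_density (X i)) * (\<Prod>i<n. marginal_ratio \<tau> (X i)))"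
  using marginal_ratio_pos[OF assms]
  by (simp add: marginal_eq_ratio[OF assms] prod_ennreal less_imp_le flip: prod.distrib)

text \<open>The null likelihood is a common factor of all scales, so the estimator also maximises
  the product of Bayes factors.\<close>

lemma mmle_maximal:
  assumes "is_mmle n \<tau>h" "X \<in> {..<n} \<rightarrow>\<^sub>E UNIV" "1 \<le> n" "1 / real n \<le> \<tau>" "\<tau> \<le> 1"
  shows "(\<Prod>i<n. marginal_ratio \<tau> (X i)) \<le> (\<Prod>i<n. marginal_ratio (\<tau>h X) (X i))"
proof -
  have n: "0 < 1 / real n" using assms(3) by simp
  then have pos: "0 < \<tau>" "0 < \<tau>h X" using assms(4) mmle_range[OF assms(1,2)] by linarith+
  have "\<not> (\<Prod>i<n. marginal (\<tau>h X) (X i)) < (\<Prod>i<n. marginal \<tau> (X i))"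
    using assms by (auto simp: is_mmle_def is_arg_max_def)
  then have "ennreal ((\<Prod>i<n. std_normal_density (X i)) * (\<Prod>i<n. marginal_ratio \<tau> (X i)))
    \<le> ennreal ((\<Prod>i<n. std_normal_density (X i)) * (\<Prod>i<n. marginal_ratio (\<tau>h X) (X i)))"
    by (simp add: not_less prod_marginal pos)
  moreover have "0 < (\<Prod>i<n. std_normal_density (X i))"
    by (intro prod_pos ballI normal_density_pos) simp
  moreover have "0 \<le> (\<Prod>i<n. marginal_ratio (\<tau>h X) (X i))"
    using marginal_ratio_pos[OF pos(2)] by (intro prod_nonneg) (auto simp: less_imp_le)
  ultimately show ?thesis by (simp add: ennreal_le_iff)
qed

text \<open>Almost-monotonicity in the scale costs at most \<open>exp (150 * n * \<tau>1)\<close> in total, while every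
  coordinate in \<open>G\<close> gains a factor \<open>exp 1\<close> when passing from a much smaller scale to \<open>\<tau>1\<close>.
  The constants are \<open>2688 = 12 * 224\<close> and \<open>2322432 = 6 * 224 * 1728\<close>, where \<open>224\<close> and \<open>1728\<close> come from
  \<open>marginal_lower\<close> and \<open>marginal_upper\<close>.\<close>

lemma mmle_lower_bound:
  assumes "is_mmle n \<tau>h" "X \<in> {..<n} \<rightarrow>\<^sub>E UNIV" "1 \<le> n" "1 / real n \<le> \<tau>1" "\<tau>1 \<le> 1" "G \<subseteq> {..<n}"
    and G: "\<And>i. i \<in> G \<Longrightarrow> 1 \<le> \<bar>X i\<bar>" "\<And>i. i \<in> G \<Longrightarrow> 2688 * (X i)\<^sup>2 * std_normal_density (X i) \<le> \<tau>1"
    and card: "150 * real n * \<tau>1 < real (card G)"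
  shows "\<tau>1 < 2322432 * \<tau>h X"
proof (rule ccontr)
  assume "\<not> ?thesis"
  then have small: "2322432 * \<tau>h X \<le> \<tau>1" by simp
  define \<tau> where "\<tau> = \<tau>h X"
  have n: "0 < 1 / real n" using assms(3) by simp
  then have pos: "0 < \<tau>1" "0 < \<tau>" using assms(4) mmle_range(1)[OF assms(1,2)] unfolding \<tau>_def by linarith+
  have le: "\<tau> \<le> \<tau>1" using small pos by (simp add: \<tau>_def)
  note g = marginal_ratio_pos[OF pos(1)] marginal_ratio_pos[OF pos(2)]
  have all: "marginal_ratio \<tau> x \<le> exp (150 * \<tau>1) * marginal_ratio \<tau>1 x" for x
  proof -
    have "marginal_ratio \<tau> x \<le> exp (150 * (\<tau>1 - \<tau>)) * marginal_ratio \<tau>1 x"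
      using pos le assms by (intro marginal_ratio_almost_mono) auto
    also have "\<dots> \<le> exp (150 * \<tau>1) * marginal_ratio \<tau>1 x"
      using pos g(1)[of x] by (intro mult_right_mono) auto
    finally show ?thesis .
  qed
  have good: "marginal_ratio \<tau> (X i) \<le> exp (150 * \<tau>1 - 1) * marginal_ratio \<tau>1 (X i)" if "i \<in> G" for i
  proof -
    define x where "x = X i"
    let ?\<phi> = "std_normal_density x"
    have x: "1 \<le> \<bar>x\<bar>" "2688 * x\<^sup>2 * ?\<phi> \<le> \<tau>1" using G that by (auto simp: x_def)
    have x2: "0 < x\<^sup>2" using x by auto
    have p: "0 < ?\<phi>" by (rule normal_density_pos) simp
    have "exp (1\<^sup>2 / 2) \<le> (2::real)"
    proof (rule power2_le_imp_le)
      show "(exp (1\<^sup>2 / 2))\<^sup>2 \<le> (2::real)\<^sup>2" using exp_le by (simp add: power2_eq_square flip: exp_add)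
    qed simp
    then have "exp (1\<^sup>2 / 2) * ?\<phi> \<le> 2 * ?\<phi>" by (intro mult_right_mono) auto
    moreover have "1728 * \<tau> / (1\<^sup>2 * (2 + x\<^sup>2)) \<le> 1728 * \<tau> / x\<^sup>2"
      using x2 pos by (intro divide_left_mono mult_pos_pos add_pos_pos) auto
    moreover have "?\<phi> * marginal_ratio \<tau> x \<le> exp (1\<^sup>2 / 2) * ?\<phi> + 1728 * \<tau> / (1\<^sup>2 * (2 + x\<^sup>2))"
      using pos by (intro marginal_upper) auto
    ultimately have "?\<phi> * marginal_ratio \<tau> x \<le> 2 * ?\<phi> + 1728 * \<tau> / x\<^sup>2" by linarith
    also have "\<dots> = (2 * x\<^sup>2 * ?\<phi> + 1728 * \<tau>) / x\<^sup>2" using x2 by (simp add: field_simps)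
    \<comment> \<open>Each summand is at most \<tau>1 / 1344, where 1344 = 2688 / 2 = 2322432 /
      1728. The sum is a third of \<open>marginal_lower\<close> at \<tau>1, as 672 = 3 * 224, and 1
      / 3 \<le> exp (- 1).\<close>
    also have "\<dots> \<le> (\<tau>1 / 672) / x\<^sup>2"
      using x(2) small x2 by (intro divide_right_mono) (auto simp: \<tau>_def)
    also have "\<dots> = 1 / 3 * (\<tau>1 / (224 * x\<^sup>2))" by simp
    also have "\<dots> \<le> 1 / 3 * (?\<phi> * marginal_ratio \<tau>1 x)"
      using marginal_lower[of \<tau>1 x] pos x assms by (intro mult_left_mono) auto
    finally have "?\<phi> * marginal_ratio \<tau> x \<le> ?\<phi> * (1 / 3 * marginal_ratio \<tau>1 x)" by simp
    then have "marginal_ratio \<tau> x \<le> 1 / 3 * marginal_ratio \<tau>1 x" using p by simp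
    also have "\<dots> \<le> exp (150 * \<tau>1 - 1) * marginal_ratio \<tau>1 x"
    proof (intro mult_right_mono)
      have "1 / 3 \<le> exp (- 1 :: real)" using exp_le by (simp add: exp_minus field_simps)
      also have "\<dots> \<le> exp (150 * \<tau>1 - 1)" using pos by simp
      finally show "1 / 3 \<le> exp (150 * \<tau>1 - 1)" .
    qed (use g in \<open>auto simp: less_imp_le\<close>)
    finally show ?thesis by (simp add: x_def)
  qed
  have "(\<Prod>i<n. marginal_ratio \<tau> (X i))
      \<le> (\<Prod>i<n. exp (150 * \<tau>1 - (if i \<in> G then 1 else 0)) * marginal_ratio \<tau>1 (X i))"
    using all good g by (intro prod_mono) (auto simp: less_imp_le)
  also have "\<dots> = exp (\<Sum>i<n. 150 * \<tau>1 - (if i \<in> G then 1 else 0)) * (\<Prod>i<n. marginal_ratio \<tau>1 (X i))"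
    by (simp add: prod.distrib exp_sum)
  also have "(\<Sum>i<n. 150 * \<tau>1 - (if i \<in> G then 1 else 0)) = 150 * real n * \<tau>1 - real (card G)"
    using assms(6) by (simp add: sum_subtractf sum.If_cases inf.absorb2)
  also have "exp (150 * real n * \<tau>1 - real (card G)) * (\<Prod>i<n. marginal_ratio \<tau>1 (X i))
      < 1 * (\<Prod>i<n. marginal_ratio \<tau>1 (X i))"
    using card g by (intro mult_strict_right_mono prod_pos) auto
  also have "\<dots> \<le> (\<Prod>i<n. marginal_ratio \<tau> (X i))"
    using mmle_maximal[OF assms(1,2,3,4,5)] by (simp add: \<tau>_def)
  finally show False by simp
qed

text \<open>Comparison of \<open>\<tau>h X\<close> with \<open>s / n\<close>: signals contribute at most \<open>j ^ s\<close> to the likelihood ratio,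
  and rounding the scale up to the grid costs only \<open>exp (150 * s)\<close>.\<close>

lemma mmle_upper_bound:
  assumes "is_mmle n \<tau>h" "X \<in> {..<n} \<rightarrow>\<^sub>E UNIV" "1 \<le> s" "2 * s \<le> n" "S \<subseteq> {..<n}" "card S = s"
    and j: "j = nat \<lceil>\<tau>h X * real n / real s\<rceil>" "2 \<le> j"
  shows "exp (- (real s * (152 + ln (real j)))) \<le> (\<Prod>i\<in>{..<n} - S. marginal_ratio (real (j * s) / real n) (X i))"
proof -
  define \<tau> \<tau>0 \<tau>j where "\<tau> = \<tau>h X" and "\<tau>0 = real s / real n" and "\<tau>j = real (j * s) / real n"
  let ?N = "{..<n} - S"
  have sn: "0 < real s" "0 < real n" "1 \<le> n" using assms by auto
  have t0: "0 < \<tau>0" "\<tau>0 \<le> 1 / 2" "1 / real n \<le> \<tau>0"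
    using assms by (auto simp: \<tau>0_def field_simps)
  have tau: "\<tau> \<le> 1" using mmle_range[OF assms(1,2)] by (simp add: \<tau>_def)
  have r: "\<tau> * real n / real s = \<tau> / \<tau>0" by (simp add: \<tau>0_def)
  have jr: "\<tau> / \<tau>0 \<le> real j" "real j < \<tau> / \<tau>0 + 1"
  proof -
    have jc: "j = nat \<lceil>\<tau> / \<tau>0\<rceil>" using j(1) unfolding \<tau>_def[symmetric] r .
    \<comment> \<open>From 2 \<le> j: otherwise \<open>nat\<close> would have truncated the ceiling
      to 0.\<close>
    have "0 \<le> \<lceil>\<tau> / \<tau>0\<rceil>" using j(2) unfolding jc by linarith
    then have "real j = of_int \<lceil>\<tau> / \<tau>0\<rceil>" unfolding jc by (rule of_nat_nat)
    then show "\<tau> / \<tau>0 \<le> real j" "real j < \<tau> / \<tau>0 + 1" by linarith+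
  qed
  have tj: "\<tau>j = real j * \<tau>0" by (simp add: \<tau>j_def \<tau>0_def)
  have le: "\<tau> \<le> \<tau>j" "\<tau>j \<le> \<tau> + \<tau>0" "\<tau>0 \<le> \<tau>"
  proof -
    show "\<tau> \<le> \<tau>j" "\<tau>j \<le> \<tau> + \<tau>0" using jr t0 by (simp_all add: tj field_simps)
    have "1 \<le> \<tau> / \<tau>0" using jr j by linarith
    then show "\<tau>0 \<le> \<tau>" using t0 by (simp add: field_simps)
  qed
  have pos: "0 < \<tau>" "0 < \<tau>j" using le t0 by linarith+
  note g = marginal_ratio_pos[OF t0(1)] marginal_ratio_pos[OF pos(1)] marginal_ratio_pos[OF pos(2)]
  have fin: "finite S" "finite ?N" using assms(5) finite_subset by auto
  have split: "(\<Prod>i<n. f i) = (\<Prod>i\<in>S. f i) * (\<Prod>i\<in>?N. f i)" for f :: "nat \<Rightarrow> real"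
    using prod.subset_diff[OF assms(5), of f] by (simp add: mult.commute)
  have cN: "real (card ?N) \<le> real n" using card_mono[of "{..<n}" ?N] by simp
  have c0: "real n * \<tau>0 = real s" using sn by (simp add: \<tau>0_def)
  have jp: "0 < real j" using j(2) by simp
  have S: "(\<Prod>i\<in>S. marginal_ratio \<tau> (X i)) \<le> real j ^ s * (\<Prod>i\<in>S. marginal_ratio \<tau>0 (X i))"
  proof -
    have "(\<Prod>i\<in>S. marginal_ratio \<tau> (X i)) \<le> (\<Prod>i\<in>S. real j * marginal_ratio \<tau>0 (X i))"
    proof (intro prod_mono conjI)
      fix i
      have "marginal_ratio \<tau> (X i) \<le> \<tau> / \<tau>0 * marginal_ratio \<tau>0 (X i)"
        using t0 le by (intro marginal_ratio_log_lipschitz)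
      also have "\<dots> \<le> real j * marginal_ratio \<tau>0 (X i)"
        using jr g(1)[of "X i"] by (intro mult_right_mono) auto
      finally show "marginal_ratio \<tau> (X i) \<le> real j * marginal_ratio \<tau>0 (X i)" .
    qed (use g in \<open>auto simp: less_imp_le\<close>)
    then show ?thesis using assms(6) by (simp add: prod.distrib)
  qed
  have N: "(\<Prod>i\<in>?N. marginal_ratio \<tau> (X i)) \<le> exp (150 * real s) * (\<Prod>i\<in>?N. marginal_ratio \<tau>j (X i))"
  proof -
    have "(\<Prod>i\<in>?N. marginal_ratio \<tau> (X i)) \<le> (\<Prod>i\<in>?N. exp (150 * \<tau>0) * marginal_ratio \<tau>j (X i))"
    proof (intro prod_mono conjI)
      fix i
      \<comment> \<open>Rounding up can push the scale above 1, but not above 3 / 2; this is why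
        almost-monotonicity is available up to 2.\<close>
      have "marginal_ratio \<tau> (X i) \<le> exp (150 * (\<tau>j - \<tau>)) * marginal_ratio \<tau>j (X i)"
        using pos le tau t0 by (intro marginal_ratio_almost_mono) auto
      also have "\<dots> \<le> exp (150 * \<tau>0) * marginal_ratio \<tau>j (X i)"
        using le g(3)[of "X i"] by (intro mult_right_mono) auto
      finally show "marginal_ratio \<tau> (X i) \<le> exp (150 * \<tau>0) * marginal_ratio \<tau>j (X i)" .
    qed (use g in \<open>auto simp: less_imp_le\<close>)
    also have "\<dots> = exp (real (card ?N) * (150 * \<tau>0)) * (\<Prod>i\<in>?N. marginal_ratio \<tau>j (X i))"
      by (simp add: prod.distrib exp_of_nat_mult)
    also have "\<dots> \<le> exp (150 * real s) * (\<Prod>i\<in>?N. marginal_ratio \<tau>j (X i))"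
    proof (intro mult_right_mono)
      have "real (card ?N) * (150 * \<tau>0) \<le> real n * (150 * \<tau>0)"
        using cN t0 by (intro mult_right_mono) auto
      then show "exp (real (card ?N) * (150 * \<tau>0)) \<le> exp (150 * real s)" using c0 by simp
    qed (use g in \<open>auto intro!: prod_nonneg simp: less_imp_le\<close>)
    finally show ?thesis .
  qed
  \<comment> \<open>The nulls lose at most a factor exp (- 2 * \<tau>0) each at the reference scale,
    because \<tau>0 \<le> 1 / 2. This explains 152 = 150 + 2.\<close>
  have N0: "exp (- (2 * real s)) \<le> (\<Prod>i\<in>?N. marginal_ratio \<tau>0 (X i))"
  proof -
    have "exp (- (2 * \<tau>0)) \<le> 1 - \<tau>0"
    proof -
      have "0 \<le> \<tau>0 * (1 - 2 * \<tau>0)" using t0 by (intro mult_nonneg_nonneg) auto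
      then have "1 \<le> (1 - \<tau>0) * (1 + 2 * \<tau>0)" by (simp add: algebra_simps)
      also have "\<dots> \<le> (1 - \<tau>0) * exp (2 * \<tau>0)" using t0 by (intro mult_left_mono exp_ge_add_one_self) auto
      finally show ?thesis by (simp add: exp_minus field_simps)
    qed
    then have "exp (- (2 * \<tau>0)) \<le> marginal_ratio \<tau>0 x" for x
      using marginal_ratio_ge[OF t0(1), of x] by linarith
    then have "(\<Prod>i\<in>?N. exp (- (2 * \<tau>0))) \<le> (\<Prod>i\<in>?N. marginal_ratio \<tau>0 (X i))"
      by (intro prod_mono) auto
    moreover have "(\<Prod>i\<in>?N. exp (- (2 * \<tau>0))) = exp (- (real (card ?N) * (2 * \<tau>0)))"
      by (simp flip: exp_of_nat_mult)
    moreover have "real (card ?N) * (2 * \<tau>0) \<le> real n * (2 * \<tau>0)"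
      using cN t0 by (intro mult_right_mono) auto
    then have "exp (- (2 * real s)) \<le> exp (- (real (card ?N) * (2 * \<tau>0)))" using c0 by simp
    ultimately show ?thesis by linarith
  qed
  define A where "A = (\<Prod>i\<in>S. marginal_ratio \<tau>0 (X i))"
  have A: "0 < A" unfolding A_def using g by (intro prod_pos) auto
  define B where "B = (\<Prod>i\<in>?N. marginal_ratio \<tau>j (X i))"
  have "A * exp (- (2 * real s)) \<le> A * (\<Prod>i\<in>?N. marginal_ratio \<tau>0 (X i))"
    using N0 A by simp
  also have "\<dots> = (\<Prod>i<n. marginal_ratio \<tau>0 (X i))" unfolding split by (simp add: A_def)
  also have "\<dots> \<le> (\<Prod>i<n. marginal_ratio \<tau> (X i))"
    unfolding \<tau>_def using t0 sn by (intro mmle_maximal assms(1,2)) auto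
  also have "\<dots> \<le> (real j ^ s * A) * (exp (150 * real s) * B)"
    unfolding split A_def B_def using S N g by (intro mult_mono) (auto intro!: prod_nonneg mult_nonneg_nonneg simp: less_imp_le)
  finally have "A * exp (- (2 * real s)) \<le> A * (real j ^ s * exp (150 * real s) * B)" by (simp add: mult_ac)
  then have "exp (- (2 * real s)) \<le> real j ^ s * exp (150 * real s) * B" using A by simp
  moreover have "real j ^ s = exp (real s * ln (real j))"
    using jp by (simp add: exp_of_nat_mult)
  moreover define u where "u = real s * ln (real j) + 150 * real s"
  ultimately have "exp (- (2 * real s)) \<le> exp u * B"
    by (simp add: exp_add)
  then have "exp (- u) * exp (- (2 * real s)) \<le> exp (- u) * (exp u * B)"
    by (intro mult_left_mono) auto
  also have "\<dots> = B" by (simp add: exp_minus)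
  finally have "exp (- u) * exp (- (2 * real s)) \<le> B" .
  then show ?thesis unfolding B_def \<tau>j_def u_def by (simp add: algebra_simps flip: exp_add)
qed

section \<open>Union bound over the grid of scales\<close>

lemma sum_inverse_squares_le:
  assumes "1 \<le> R"
  shows "(\<Sum>j\<in>{R<..m}. 1 / (real j)\<^sup>2) \<le> 1 / real R"
proof -
  have "(\<Sum>j\<in>{R<..m}. 1 / (real j)\<^sup>2) \<le> 1 / real R - 1 / real m" if "R \<le> m"
    using that
  proof (induction m rule: dec_induct)
    case (step m)
    have m: "0 < real m" using step assms by simp
    have "1 / (real (Suc m))\<^sup>2 \<le> 1 / (real m * real (Suc m))"
      unfolding power2_eq_square using m by (intro divide_left_mono mult_right_mono mult_pos_pos) auto
    also have "\<dots> = 1 / real m - 1 / real (Suc m)" using m by (simp add: field_simps)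
    finally have "1 / (real (Suc m))\<^sup>2 \<le> 1 / real m - 1 / real (Suc m)" .
    moreover have "{R<..Suc m} = insert (Suc m) {R<..m}" using step by auto
    ultimately show ?case using step by simp
  qed simp
  moreover have "{R<..m} = {}" if "\<not> R \<le> m" using that by auto
  ultimately show ?thesis
  proof (cases "R \<le> m")
    case True
    then have "(\<Sum>j\<in>{R<..m}. 1 / (real j)\<^sup>2) \<le> 1 / real R - 1 / real m"
      using \<open>R \<le> m \<Longrightarrow> _\<close> by simp
    also have "\<dots> \<le> 1 / real R" by simp
    finally show ?thesis .
  qed simp
qed

text \<open>The necessary condition supplied by \<open>mmle_upper_bound\<close> when the estimate
  rounds up to j * s / n. Only null coordinates occur, so its probability can be bounded regardless
  of the signals.\<close>

definition overfit :: "nat \<Rightarrow> nat \<Rightarrow> nat \<Rightarrow> (nat \<Rightarrow> real) \<Rightarrow> nat \<Rightarrow> (nat \<Rightarrow> real) set" where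
  "overfit n s R \<theta> j = {X \<in> space (seq_law n \<theta>).
     exp (- (real s * (152 + ln (real j)))) \<le> (\<Prod>i\<in>{..<n} - supp n \<theta>. marginal_ratio (real (j * s) / real n) (X i))}"

text \<open>The grid stops at scale 2: rounding up a scale of at most 1 adds less than s /
  n.\<close>

definition overfit_event :: "nat \<Rightarrow> nat \<Rightarrow> nat \<Rightarrow> (nat \<Rightarrow> real) \<Rightarrow> (nat \<Rightarrow> real) set" where
  "overfit_event n s R \<theta> = (\<Union>j\<in>{j. R < j \<and> j * s \<le> 2 * n}. overfit n s R \<theta> j)"

lemma finite_grid:
  fixes n s R :: nat
  assumes "1 \<le> s"
  shows "{j. R < j \<and> j * s \<le> 2 * n} \<subseteq> {R<..2 * n}"
proof
  fix j assume j: "j \<in> {j. R < j \<and> j * s \<le> 2 * n}"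
  have "j * 1 \<le> j * s" using assms by (intro mult_le_mono2)
  also have "\<dots> \<le> 2 * n" using j by simp
  finally show "j \<in> {R<..2 * n}" using j by simp
qed

lemma overfit_sets: "overfit n s R \<theta> j \<in> sets (seq_law n \<theta>)"
proof -
  have [measurable]: "(\<lambda>X. \<Prod>i\<in>{..<n} - supp n \<theta>. marginal_ratio (real (j * s) / real n) (X i)) \<in> borel_measurable (seq_law n \<theta>)"
  proof (rule borel_measurable_prod)
    fix i assume "i \<in> {..<n} - supp n \<theta>"
    then have "i < n" by simp
    then show "(\<lambda>X. marginal_ratio (real (j * s) / real n) (X i)) \<in> borel_measurable (seq_law n \<theta>)"
      by (rule measurable_seq_law_coord) measurable
  qed
  show ?thesis unfolding overfit_def by measurable
qed

lemma overfit_event_sets: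
  assumes "1 \<le> s"
  shows "overfit_event n s R \<theta> \<in> sets (seq_law n \<theta>)"
  unfolding overfit_event_def
  by (intro sets.finite_UN overfit_sets finite_subset[OF finite_grid[OF assms]]) simp

lemma mmle_le_if_not_overfit:
  assumes "is_mmle n \<tau>h" "X \<in> {..<n} \<rightarrow>\<^sub>E UNIV" "1 \<le> s" "2 * s \<le> n" "card (supp n \<theta>) = s" "1 \<le> R"
    and "X \<notin> overfit_event n s R \<theta>"
  shows "\<tau>h X \<le> real R * real s / real n"
proof (rule ccontr)
  assume "\<not> ?thesis"
  then have big: "real R * real s / real n < \<tau>h X" by simp
  have sn: "0 < real s" "0 < real n" using assms by auto
  define j where "j = nat \<lceil>\<tau>h X * real n / real s\<rceil>"
  have r: "real R < \<tau>h X * real n / real s" using big sn by (simp add: field_simps)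
  then have jR: "R < j" unfolding j_def by linarith
  have "real j < \<tau>h X * real n / real s + 1" using r unfolding j_def by linarith
  also have "\<dots> \<le> 1 * real n / real s + 1"
    using mmle_range[OF assms(1,2)] sn by (intro add_right_mono divide_right_mono mult_right_mono) auto
  finally have "real j * real s \<le> real n + real s" using sn by (simp add: field_simps)
  then have "real (j * s) \<le> real (2 * n)" using assms(4) by simp
  then have js: "j * s \<le> 2 * n" by (simp only: of_nat_le_iff)
  have "supp n \<theta> \<subseteq> {..<n}" by (auto simp: supp_def)
  from mmle_upper_bound[OF assms(1-4) this assms(5) j_def] jR assms(6)
  have "X \<in> overfit n s R \<theta> j" using assms(2) by (simp add: overfit_def)
  with jR js assms(7) show False by (auto simp: overfit_event_def)
qed

text \<open>In \<open>growth\<close>, 76 + ln j / 2 is half of 152 + ln j, as left by the square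
  root, and the remaining 2 * ln j makes the j-th probability at most 1 / j^2, which is summable. At
  least n / 2 coordinates are null, hence 43008 = 2 * 21504.\<close>

lemma prob_overfit:
  assumes s: "1 \<le> s" "2 * s \<le> n" and card: "card (supp n \<theta>) = s" and R: "1 \<le> R"
    and L: "L = ln (real n / real s)"
    and affinity: "\<And>\<tau>. exp (- L) \<le> \<tau> \<Longrightarrow> \<tau> \<le> 2 \<Longrightarrow>
      (\<integral>\<^sup>+ x. ennreal (sqrt (marginal_ratio \<tau> x)) \<partial>normal_law 0 1) \<le> ennreal (exp (- (\<tau> / (21504 * sqrt L))))"
    and growth: "\<And>j. R < j \<Longrightarrow> 76 + 5 / 2 * ln (real j) \<le> real j / (43008 * sqrt L)"
  shows "measure (seq_law n \<theta>) (overfit_event n s R \<theta>) \<le> 1 / real R"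
proof -
  interpret P: prob_space "seq_law n \<theta>" by (rule prob_space_seq_law)
  let ?N = "{..<n} - supp n \<theta>"
  have sn: "0 < real s" "0 < real n" using s by auto
  have sub: "supp n \<theta> \<subseteq> {..<n}" by (auto simp: supp_def)
  have "card ?N = n - s" using card_Diff_subset[OF _ sub] sub card finite_subset[OF sub] by simp
  then have cN: "real n / 2 \<le> real (card ?N)" using s by (simp add: of_nat_diff)
  have eL: "exp (- L) = real s / real n" using sn by (simp add: L exp_minus)
  have L0: "0 < L" unfolding L using sn s by simp
  let ?B = "{j. R < j \<and> j * s \<le> 2 * n}"
  have fin: "finite ?B" by (rule finite_subset[OF finite_grid[OF s(1)]]) simp
  have each: "P.prob (overfit n s R \<theta> j) \<le> 1 / (real j)\<^sup>2" if "j \<in> ?B" for j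
  proof -
    define \<tau> where "\<tau> = real (j * s) / real n"
    have j: "R < j" "j * s \<le> 2 * n" "0 < real j" "1 \<le> real j" using that R by auto
    have "real (j * s) \<le> real (2 * n)" using j(2) by (simp only: of_nat_le_iff)
    then have t2: "\<tau> \<le> 2" using sn by (simp add: \<tau>_def divide_le_eq)
    have t1: "exp (- L) \<le> \<tau>" using j(4) sn unfolding eL \<tau>_def by (intro divide_right_mono) auto
    have t0: "0 < \<tau>" using t1 exp_gt_zero[of "- L"] by linarith
    define h where "h = \<tau> / (21504 * sqrt L)"
    have hN: "real s * (real j / (43008 * sqrt L)) \<le> h * real (card ?N)"
    proof -
      have "real s * (real j / (43008 * sqrt L)) = h * (real n / 2)"
        using sn by (simp add: h_def \<tau>_def)
      also have "\<dots> \<le> h * real (card ?N)"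
        using cN t0 L0 by (intro mult_left_mono) (auto simp: h_def)
      finally show ?thesis .
    qed
    have "P.prob (overfit n s R \<theta> j) \<le> exp (real s * (152 + ln (real j)) / 2 - h * real (card ?N))"
      unfolding overfit_def \<tau>_def[symmetric]
    proof (rule likelihood_chernoff)
      show "(\<integral>\<^sup>+ x. ennreal (sqrt (marginal_ratio \<tau> x)) \<partial>normal_law 0 1) \<le> ennreal (exp (- h))"
        unfolding h_def by (rule affinity[OF t1 t2])
    qed (use t0 in \<open>auto simp: supp_def\<close>)
    also have "\<dots> \<le> exp (- (2 * ln (real j)))"
    proof -
      have "real s * (152 + ln (real j)) / 2 - h * real (card ?N)
          \<le> real s * (76 + 1 / 2 * ln (real j) - real j / (43008 * sqrt L))"
        using hN by (simp add: algebra_simps add_divide_distrib)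
      also have "\<dots> \<le> real s * (- (2 * ln (real j)))"
        using growth[OF j(1)] by (intro mult_left_mono) auto
      also have "\<dots> \<le> 1 * (- (2 * ln (real j)))"
        using s j by (intro mult_right_mono_neg) auto
      finally show ?thesis by simp
    qed
    also have "\<dots> = 1 / (real j)\<^sup>2"
      unfolding exp_minus exp_double using j(3) by (simp add: inverse_eq_divide)
    finally show ?thesis .
  qed
  have "P.prob (overfit_event n s R \<theta>) \<le> (\<Sum>j\<in>?B. P.prob (overfit n s R \<theta> j))"
    unfolding overfit_event_def using fin overfit_sets by (intro P.finite_measure_subadditive_finite) auto
  also have "\<dots> \<le> (\<Sum>j\<in>?B. 1 / (real j)\<^sup>2)" by (intro sum_mono each)
  also have "\<dots> \<le> (\<Sum>j\<in>{R<..2 * n}. 1 / (real j)\<^sup>2)"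
    using finite_grid[OF s(1)] by (intro sum_mono2) auto
  also have "\<dots> \<le> 1 / real R" by (rule sum_inverse_squares_le[OF R])
  finally show ?thesis .
qed

section \<open>Risk bounds for fixed sample size\<close>

text \<open>y * exp (- y) decreases for y \<ge> 1; this follows from 1 + u \<le> exp u.\<close>

lemma square_gauss_le:
  assumes "0 \<le> a" "2 \<le> a\<^sup>2" "a \<le> \<bar>x\<bar>"
  shows "x\<^sup>2 * std_normal_density x \<le> a\<^sup>2 * exp (- a\<^sup>2 / 2)"
proof -
  define A y where "A = a\<^sup>2 / 2" and "y = x\<^sup>2 / 2"
  have "a\<^sup>2 \<le> x\<^sup>2" using power_mono[OF assms(3,1), of 2] by simp
  then have A: "1 \<le> A" "A \<le> y" using assms by (simp_all add: A_def y_def)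
  have "0 \<le> (A - 1) * (y - A)" using A by (intro mult_nonneg_nonneg) auto
  then have "y \<le> A * (1 + (y - A))" by (simp add: algebra_simps)
  also have "\<dots> \<le> A * exp (y - A)" using A by (intro mult_left_mono exp_ge_add_one_self) auto
  finally have "y * exp (- y) \<le> A * exp (y - A) * exp (- y)" by (intro mult_right_mono) auto
  also have "\<dots> = A * exp (- A)" by (simp add: mult.assoc flip: exp_add)
  finally have "x\<^sup>2 * exp (- x\<^sup>2 / 2) \<le> a\<^sup>2 * exp (- a\<^sup>2 / 2)" by (simp add: A_def y_def)
  moreover have "x\<^sup>2 * std_normal_density x \<le> x\<^sup>2 * exp (- x\<^sup>2 / 2)"
    by (intro mult_left_mono std_normal_density_le) auto
  ultimately show ?thesis by linarith
qed

text \<open>(1 + y) * exp (- y) decreases on all of y \<ge> 0, so the worst x is the endpoint; the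
  constant 3 bounds sqrt (2 * pi).\<close>

lemma two_plus_square_gauss_ge:
  assumes "\<bar>x\<bar> \<le> a"
  shows "(2 + a\<^sup>2) * exp (- a\<^sup>2 / 2) / 3 \<le> (2 + x\<^sup>2) * std_normal_density x"
proof -
  define A y where "A = a\<^sup>2 / 2" and "y = x\<^sup>2 / 2"
  have "x\<^sup>2 \<le> a\<^sup>2" using power_mono[OF assms, of 2] by simp
  then have A: "0 \<le> y" "y \<le> A" by (simp_all add: A_def y_def)
  have "0 \<le> y * (A - y)" using A by (intro mult_nonneg_nonneg) auto
  then have "1 + A \<le> (1 + y) * (1 + (A - y))" by (simp add: algebra_simps)
  also have "\<dots> \<le> (1 + y) * exp (A - y)" using A by (intro mult_left_mono exp_ge_add_one_self) auto
  finally have "(1 + A) * exp (- A) \<le> (1 + y) * exp (A - y) * exp (- A)" by (intro mult_right_mono) auto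
  also have "\<dots> = (1 + y) * exp (- y)" by (simp add: mult.assoc flip: exp_add)
  finally have 1: "(2 + a\<^sup>2) * exp (- a\<^sup>2 / 2) \<le> (2 + x\<^sup>2) * exp (- x\<^sup>2 / 2)" by (simp add: A_def y_def field_simps)
  have "sqrt (2 * pi) \<le> 3" using pi_less_4 by (intro real_le_lsqrt) auto
  then have "exp (- x\<^sup>2 / 2) / 3 \<le> exp (- x\<^sup>2 / 2) / sqrt (2 * pi)"
    by (intro divide_left_mono) auto
  then have "exp (- x\<^sup>2 / 2) / 3 \<le> std_normal_density x"
    by (simp add: std_normal_density_def)
  then have "(2 + x\<^sup>2) * (exp (- x\<^sup>2 / 2) / 3) \<le> (2 + x\<^sup>2) * std_normal_density x"
    by (intro mult_left_mono) auto
  with 1 show ?thesis by simp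
qed

lemma integral_coord_indicator:
  assumes "i < n" and [measurable]: "A \<in> sets borel"
  shows "integrable (seq_law n \<theta>) (\<lambda>X. indicator A (X i) :: real)"
    "(\<integral>X. indicator A (X i) \<partial>seq_law n \<theta>) = measure (normal_law (\<theta> i) 1) A"
proof -
  interpret P: prob_space "seq_law n \<theta>" by (rule prob_space_seq_law)
  have m: "(\<lambda>X. indicator A (X i) :: real) \<in> borel_measurable (seq_law n \<theta>)"
    by (rule measurable_seq_law_coord[OF assms(1)]) measurable
  then show "integrable (seq_law n \<theta>) (\<lambda>X. indicator A (X i) :: real)"
    by (intro P.integrable_const_bound[of _ 1]) (auto simp: indicator_def)
  have eq: "{X \<in> space (seq_law n \<theta>). X i \<in> A} = (\<lambda>X. X i) -` A \<inter> space (seq_law n \<theta>)" by auto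
  have s: "{X \<in> space (seq_law n \<theta>). X i \<in> A} \<in> sets (seq_law n \<theta>)"
    unfolding eq by (rule measurable_sets[OF measurable_seq_law_coord[OF assms(1), of "\<lambda>x. x" borel]]) auto
  have "(\<integral>X. indicator A (X i) \<partial>seq_law n \<theta>)
      = (\<integral>X. indicator {X \<in> space (seq_law n \<theta>). X i \<in> A} X \<partial>seq_law n \<theta>)"
    by (intro Bochner_Integration.integral_cong) (auto simp: indicator_def)
  also have "\<dots> = measure (seq_law n \<theta>) {X \<in> space (seq_law n \<theta>). X i \<in> A}"
    using s by (simp del: space_seq_law)
  also have "\<dots> = measure (normal_law (\<theta> i) 1) A" by (rule measure_seq_law_coord) fact+
  finally show "(\<integral>X. indicator A (X i) \<partial>seq_law n \<theta>) = measure (normal_law (\<theta> i) 1) A" .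
qed

lemma card_filter_eq_sum: "finite S \<Longrightarrow> real (card {i \<in> S. f i \<in> A}) = (\<Sum>i\<in>S. indicator A (f i))"
  by (simp add: indicator_def of_bool_def sum.inter_filter[symmetric])

text \<open>Everything required of a single large n, so that the risk bounds are non-asymptotic. The
  lower comparison scale is (s / n) / \<kappa>: \<open>\<kappa> \<le> real s\<close> keeps it at
  least 1 / n, and 600 = 4 * 150 lets a fraction p / 4 of the signals outweigh the
  almost-monotonicity cost. \<open>weak\<close> makes each observation beyond T + 1 count for that
  comparison; \<open>strong\<close> puts the rejection threshold below T + \<delta> at the resulting
  lower bound on the scale. \<open>null1\<close> and \<open>null2\<close> keep the threshold above T
  for scales up to R * s / n.\<close>

locale sparse_regime =
  fixes n s R :: nat and b t T \<delta> p c \<kappa> L :: real and \<tau>h :: "(nat \<Rightarrow> real) \<Rightarrow> real"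
  assumes mmle: "is_mmle n \<tau>h"
    and s: "1 \<le> s" "2 * s \<le> n"
    and L: "L = ln (real n / real s)" and T: "T = sqrt (2 * L)" "2 \<le> T"
    and t: "0 < t" and \<delta>: "0 < \<delta>" "\<delta> \<le> 1"
    and p: "p = 1 - Phi_bar (b - 1)" and R: "1 \<le> R"
    and affinity: "\<And>\<tau>. exp (- L) \<le> \<tau> \<Longrightarrow> \<tau> \<le> 2 \<Longrightarrow>
      (\<integral>\<^sup>+ x. ennreal (sqrt (marginal_ratio \<tau> x)) \<partial>normal_law 0 1) \<le> ennreal (exp (- (\<tau> / (21504 * sqrt L))))"
    and growth: "\<And>j. R < j \<Longrightarrow> 76 + 5 / 2 * ln (real j) \<le> real j / (43008 * sqrt L)"
    and c: "0 < c" "\<And>\<tau> x. 0 < \<tau> \<Longrightarrow> \<tau> * (1 + \<bar>x\<bar>)\<^sup>2 \<le> c \<Longrightarrow> \<tau> \<le> c * (2 + x\<^sup>2) * std_normal_density x \<Longrightarrow> t \<le> s_value x \<tau>"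
    and \<kappa>: "600 < \<kappa> * p" "\<kappa> \<le> real s"
    and weak: "2688 * (T + 1)\<^sup>2 * exp (- T) \<le> 1 / \<kappa>"
    and strong: "224 * (T + 1)\<^sup>2 * exp (- (\<delta> * T)) * (2322432 * \<kappa>) < t"
    and null1: "real R * exp (- L) * (1 + T)\<^sup>2 \<le> c"
    and null2: "3 * real R \<le> c * (2 + 2 * L)"
begin

section \<open>Rejection thresholds and the two exceptional events\<close>

lemma p_bounds: "0 < p" "p \<le> 1"
  using Phi_bar_less_1[of "b - 1"] Phi_bar_nonneg[of "b - 1"] by (simp_all add: p)

lemma \<kappa>_ge_1: "1 \<le> \<kappa>"
proof -
  have "0 < \<kappa> * p" using \<kappa>(1) by simp
  then have "0 < \<kappa>" using p_bounds(1) by (rule zero_less_mult_pos2)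
  then have "\<kappa> * p \<le> \<kappa> * 1" using p_bounds by (intro mult_left_mono) auto
  with \<kappa>(1) show ?thesis by simp
qed

lemma sn: "0 < real s" "0 < real n" "real s / real n = exp (- L)" "1 \<le> n"
  using s by (simp_all add: L exp_minus)

lemma T_sq: "T\<^sup>2 = 2 * L" "0 < L"
proof -
  show L: "0 < L" using s sn by (simp add: L)
  then show "T\<^sup>2 = 2 * L" by (simp add: T)
qed

text \<open>(T + e)^2 / 2 is at least L + e * T, so a fixed excess e gains a factor exp (- e * T),
  which beats any power of T.\<close>

lemma gauss_beyond_T:
  assumes "0 < e" "e \<le> 1" "T + e \<le> \<bar>x\<bar>"
  shows "x\<^sup>2 * std_normal_density x \<le> (T + 1)\<^sup>2 * exp (- (e * T)) * exp (- L)"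
proof -
  have "2\<^sup>2 \<le> (T + e)\<^sup>2" using T assms by (intro power_mono) auto
  then have "x\<^sup>2 * std_normal_density x \<le> (T + e)\<^sup>2 * exp (- (T + e)\<^sup>2 / 2)"
    using T assms by (intro square_gauss_le) auto
  also have "\<dots> \<le> (T + 1)\<^sup>2 * exp (- (e * T) - L)"
  proof (intro mult_mono)
    show "(T + e)\<^sup>2 \<le> (T + 1)\<^sup>2" using T assms by (intro power_mono) auto
    have "(T + e)\<^sup>2 = 2 * L + 2 * (e * T) + e\<^sup>2" unfolding T_sq(1)[symmetric] by (simp add: power2_sum)
    moreover have "0 \<le> e\<^sup>2" by simp
    ultimately have "- (T + e)\<^sup>2 / 2 \<le> - (e * T) - L" by linarith
    then show "exp (- (T + e)\<^sup>2 / 2) \<le> exp (- (e * T) - L)" by simp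
  qed auto
  finally show ?thesis by (simp add: exp_diff exp_minus divide_inverse mult.assoc)
qed

text \<open>By \<open>strong\<close>, the gain exp (- \<delta> * T) outweighs both the factor T^2
  and the constants lost in the lower bound on the scale.\<close>

lemma detected:
  assumes "T + \<delta> \<le> \<bar>x\<bar>" "exp (- L) / \<kappa> < 2322432 * \<tau>" "\<tau> \<le> 1"
  shows "s_value x \<tau> < t"
proof (rule s_value_less)
  have k: "0 < \<kappa>" using \<kappa>_ge_1 by simp
  have "0 < exp (- L) / \<kappa>" using k by simp
  then show pos: "0 < \<tau>" using assms(2) by linarith
  show "1 \<le> \<bar>x\<bar>" using assms(1) T \<delta> by linarith
  have "224 * x\<^sup>2 * std_normal_density x = 224 * (x\<^sup>2 * std_normal_density x)" by simp
  also have "\<dots> \<le> 224 * ((T + 1)\<^sup>2 * exp (- (\<delta> * T)) * exp (- L))"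
    using assms(1) \<delta> by (intro mult_left_mono gauss_beyond_T) auto
  also have "\<dots> = (224 * (T + 1)\<^sup>2 * exp (- (\<delta> * T)) * (2322432 * \<kappa>)) * (exp (- L) / \<kappa> / 2322432)"
    using k by simp
  also have "\<dots> \<le> t * (exp (- L) / \<kappa> / 2322432)"
    using strong k by (intro mult_right_mono) auto
  also have "\<dots> < t * \<tau>" using assms(2) t by (intro mult_strict_left_mono) auto
  finally show "224 * x\<^sup>2 * std_normal_density x < t * \<tau>" .
qed (use assms in simp)

text \<open>The critical point is |x| = T, where 2 + x^2 equals 2 + 2 * L. This factor is what
  leaves room for a scale R times larger than s / n.\<close>

lemma undetected:
  assumes "\<bar>x\<bar> \<le> T" "0 < \<tau>" "\<tau> \<le> real R * exp (- L)"
  shows "t \<le> s_value x \<tau>"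
proof (rule c(2))
  have "\<tau> * (1 + \<bar>x\<bar>)\<^sup>2 \<le> real R * exp (- L) * (1 + T)\<^sup>2"
    using assms by (intro mult_mono power_mono) auto
  with null1 show "\<tau> * (1 + \<bar>x\<bar>)\<^sup>2 \<le> c" by linarith
  have "real R * exp (- L) = 3 * real R * (exp (- L) / 3)" by simp
  also have "\<dots> \<le> c * (2 + 2 * L) * (exp (- L) / 3)"
    using null2 by (intro mult_right_mono) auto
  also have "\<dots> = c * ((2 + T\<^sup>2) * exp (- T\<^sup>2 / 2) / 3)" by (simp add: T_sq)
  also have "\<dots> \<le> c * ((2 + x\<^sup>2) * std_normal_density x)"
    using c(1) assms by (intro mult_left_mono two_plus_square_gauss_ge) auto
  finally show "\<tau> \<le> c * (2 + x\<^sup>2) * std_normal_density x" using assms by simp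
qed fact

text \<open>The margin is 1 rather than \<delta>, so that p depends on b alone: the weakest signal,
  of size T + b, passes T + 1 with probability at least p.\<close>

definition few_detections :: "(nat \<Rightarrow> real) \<Rightarrow> (nat \<Rightarrow> real) set" where
  "few_detections \<theta> = {X \<in> space (seq_law n \<theta>). real (card {i \<in> supp n \<theta>. X i \<in> {x. T + 1 \<le> \<bar>x\<bar>}}) \<le> p * real s / 4}"

context
  fixes \<theta> assumes \<theta>: "\<theta> \<in> L0 n s b"
begin

lemma supp: "supp n \<theta> \<subseteq> {..<n}" "card (supp n \<theta>) = s" "finite (supp n \<theta>)"
  "\<And>i. i \<in> supp n \<theta> \<Longrightarrow> T + b \<le> \<bar>\<theta> i\<bar>"
  using \<theta> by (auto simp: supp_def L0_def T L)

lemma prob_overfit_event: "measure (seq_law n \<theta>) (overfit_event n s R \<theta>) \<le> 1 / real R"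
  by (rule prob_overfit[OF s supp(2) R L affinity growth])

lemma few_detections_sets: "few_detections \<theta> \<in> sets (seq_law n \<theta>)"
proof -
  have [measurable]: "(\<lambda>X. \<Sum>i\<in>supp n \<theta>. indicator {x. T + 1 \<le> \<bar>x\<bar>} (X i) :: real) \<in> borel_measurable (seq_law n \<theta>)"
  proof (rule borel_measurable_sum)
    fix i assume "i \<in> supp n \<theta>"
    then have "i < n" using supp by auto
    then show "(\<lambda>X. indicator {x. T + 1 \<le> \<bar>x\<bar>} (X i) :: real) \<in> borel_measurable (seq_law n \<theta>)"
      by (rule measurable_seq_law_coord) measurable
  qed
  show ?thesis unfolding few_detections_def card_filter_eq_sum[OF supp(3)] by measurable
qed

lemma prob_few_detections: "measure (seq_law n \<theta>) (few_detections \<theta>) \<le> exp (- (p * real s / 4))"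
proof -
  have "p \<le> measure (normal_law (\<theta> i) 1) {x. T + 1 \<le> \<bar>x\<bar>}" if i: "i \<in> supp n \<theta>" for i
  proof -
    interpret N: prob_space "normal_law (\<theta> i) 1" by (rule prob_space_normal_law) simp
    have [measurable]: "{x::real. \<bar>x\<bar> < T + 1} \<in> sets borel" by measurable
    have "measure (normal_law (\<theta> i) 1) {x. \<bar>x\<bar> < T + 1} \<le> Phi_bar (\<bar>\<theta> i\<bar> - (T + 1))"
      by (rule measure_normal_law_small)
    also have "\<dots> \<le> Phi_bar (b - 1)" using supp(4)[OF i] by (intro Phi_bar_antimono) simp
    finally have "p \<le> 1 - measure (normal_law (\<theta> i) 1) {x. \<bar>x\<bar> < T + 1}" by (simp add: p)
    also have "\<dots> = measure (normal_law (\<theta> i) 1) (space (normal_law (\<theta> i) 1) - {x. \<bar>x\<bar> < T + 1})"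
      by (rule N.prob_compl[symmetric]) simp
    also have "space (normal_law (\<theta> i) 1) - {x. \<bar>x\<bar> < T + 1} = {x. T + 1 \<le> \<bar>x\<bar>}" by auto
    finally show ?thesis .
  qed
  from count_chernoff[OF supp(1) _ this] show ?thesis
    unfolding few_detections_def supp(2) by simp
qed

lemma mmle_upper: "X \<in> space (seq_law n \<theta>) \<Longrightarrow> X \<notin> overfit_event n s R \<theta> \<Longrightarrow> \<tau>h X \<le> real R * exp (- L)"
  using mmle_le_if_not_overfit[OF mmle _ s supp(2) R, of X] unfolding sn(3)[symmetric] by simp

lemma mmle_pos:
  assumes "X \<in> space (seq_law n \<theta>)"
  shows "0 < \<tau>h X" "\<tau>h X \<le> 1"
proof -
  have "0 < 1 / real n" using sn by simp
  moreover have "1 / real n \<le> \<tau>h X" "\<tau>h X \<le> 1" using mmle_range[OF mmle, of X] assms by simp_all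
  ultimately show "0 < \<tau>h X" "\<tau>h X \<le> 1" by linarith+
qed

lemma mmle_lower:
  assumes X: "X \<in> space (seq_law n \<theta>)" "X \<notin> few_detections \<theta>"
  shows "exp (- L) / \<kappa> < 2322432 * \<tau>h X"
proof (rule mmle_lower_bound[OF mmle])
  let ?G = "{i \<in> supp n \<theta>. X i \<in> {x. T + 1 \<le> \<bar>x\<bar>}}"
  have k: "0 < \<kappa>" "1 \<le> \<kappa>" using \<kappa>_ge_1 by simp_all
  show "1 / real n \<le> exp (- L) / \<kappa>"
    unfolding sn(3)[symmetric] using \<kappa> k sn by (simp add: field_simps)
  have "exp (- L) \<le> 1" using T_sq by simp
  then have "exp (- L) \<le> \<kappa>" using k by linarith
  then show "exp (- L) / \<kappa> \<le> 1" using k by (simp only: divide_le_eq_1_pos)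
  show "?G \<subseteq> {..<n}" using supp by auto
  show "1 \<le> \<bar>X i\<bar>" if "i \<in> ?G" for i using that T by auto
  show "2688 * (X i)\<^sup>2 * std_normal_density (X i) \<le> exp (- L) / \<kappa>" if "i \<in> ?G" for i
  proof -
    have "2688 * (X i)\<^sup>2 * std_normal_density (X i) \<le> 2688 * ((T + 1)\<^sup>2 * exp (- (1 * T)) * exp (- L))"
      unfolding mult.assoc using that by (intro mult_left_mono gauss_beyond_T[unfolded mult.assoc]) auto
    also have "\<dots> = 2688 * (T + 1)\<^sup>2 * exp (- T) * exp (- L)" by simp
    also have "\<dots> \<le> 1 / \<kappa> * exp (- L)" using weak by (intro mult_right_mono) auto
    finally show ?thesis by simp
  qed
  \<comment> \<open>The almost-monotonicity cost over all n coordinates against the guaranteed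
    number of large signals.\<close>
  have "150 * real n * (exp (- L) / \<kappa>) = 150 * real s / \<kappa>"
    unfolding sn(3)[symmetric] using sn(1,2) by simp
  also have "\<dots> < p * real s / 4"
    using \<kappa>(1) k sn by (simp add: field_simps)
  also have "\<dots> < real (card ?G)" using X by (simp add: few_detections_def)
  finally show "150 * real n * (exp (- L) / \<kappa>) < real (card ?G)" .
qed (use X sn in auto)

section \<open>Error rates of the procedure\<close>

abbreviation (input) "rejects \<equiv> s_procedure \<tau>h t"

lemma FNR_alt: "FNR n \<theta> rejects = (\<integral>X. real (card {i \<in> supp n \<theta>. \<not> rejects X i}) / real s \<partial>seq_law n \<theta>)"
proof -
  have "{i. i < n \<and> \<theta> i \<noteq> 0} = supp n \<theta>" "{i. i < n \<and> \<theta> i \<noteq> 0 \<and> \<not> rejects X i} = {i \<in> supp n \<theta>. \<not> rejects X i}" for X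
    by (auto simp: supp_def)
  then show ?thesis unfolding FNR_def using s supp(2) by simp
qed

lemma rejects_signal:
  assumes "X \<in> space (seq_law n \<theta>)" "X \<notin> few_detections \<theta>" "T + \<delta> \<le> \<bar>X i\<bar>"
  shows "rejects X i"
  unfolding s_procedure_def using detected[OF assms(3) mmle_lower[OF assms(1,2)]] mmle_pos[OF assms(1)] by simp

lemma rejects_imp:
  assumes "X \<in> space (seq_law n \<theta>)" "X \<notin> overfit_event n s R \<theta>" "rejects X i"
  shows "T < \<bar>X i\<bar>"
  using undetected[OF _ mmle_pos(1)[OF assms(1)] mmle_upper[OF assms(1,2)], of "X i"] assms(3)
  by (force simp: s_procedure_def)

lemma FNR_upper: "FNR n \<theta> rejects \<le> exp (- (p * real s / 4)) + Phi_bar (b - \<delta>)"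
proof -
  interpret P: prob_space "seq_law n \<theta>" by (rule prob_space_seq_law)
  let ?A = "{x. \<bar>x\<bar> < T + \<delta>}" and ?D = "few_detections \<theta>"
  have [measurable]: "?A \<in> sets borel" by measurable
  have in_n: "i \<in> supp n \<theta> \<Longrightarrow> i < n" for i using supp by auto
  note int = integral_coord_indicator[OF in_n \<open>?A \<in> sets borel\<close>, of _ \<theta>]
  have iD: "integrable (seq_law n \<theta>) (indicator ?D :: _ \<Rightarrow> real)"
    using few_detections_sets by (intro integrable_real_indicator) (auto simp: less_top[symmetric])
  have iS: "integrable (seq_law n \<theta>) (\<lambda>X. 1 / real s * (\<Sum>i\<in>supp n \<theta>. indicator ?A (X i)))"
    by (intro integrable_mult_right Bochner_Integration.integrable_sum int)
  have "FNR n \<theta> rejects \<le> (\<integral>X. indicator ?D X + 1 / real s * (\<Sum>i\<in>supp n \<theta>. indicator ?A (X i)) \<partial>seq_law n \<theta>)"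
    unfolding FNR_alt
  \<comment> \<open>A non-integrable function has integral 0, so an upper bound only asks for a
    nonnegative integrable majorant.\<close>
  proof (rule integral_mono')
    show "integrable (seq_law n \<theta>) (\<lambda>X. indicator ?D X + 1 / real s * (\<Sum>i\<in>supp n \<theta>. indicator ?A (X i)))"
      using iD iS by (rule Bochner_Integration.integrable_add)
    fix X assume X: "X \<in> space (seq_law n \<theta>)"
    show "0 \<le> indicator ?D X + 1 / real s * (\<Sum>i\<in>supp n \<theta>. indicator ?A (X i))"
      by (intro add_nonneg_nonneg mult_nonneg_nonneg sum_nonneg) auto
    show "real (card {i \<in> supp n \<theta>. \<not> rejects X i}) / real s
        \<le> indicator ?D X + 1 / real s * (\<Sum>i\<in>supp n \<theta>. indicator ?A (X i))"
    proof (cases "X \<in> ?D")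
      case True
      have "card {i \<in> supp n \<theta>. \<not> rejects X i} \<le> s"
        using card_mono[OF supp(3), of "{i \<in> supp n \<theta>. \<not> rejects X i}"] supp(2) by simp
      then have "real (card {i \<in> supp n \<theta>. \<not> rejects X i}) / real s \<le> 1" using sn by simp
      moreover have "0 \<le> 1 / real s * (\<Sum>i\<in>supp n \<theta>. indicator ?A (X i) :: real)"
        by (intro mult_nonneg_nonneg sum_nonneg) auto
      ultimately show ?thesis using True by simp
    next
      case False
      have "{i \<in> supp n \<theta>. \<not> rejects X i} \<subseteq> {i \<in> supp n \<theta>. X i \<in> ?A}"
        using rejects_signal[OF X False] by force
      then have "real (card {i \<in> supp n \<theta>. \<not> rejects X i}) \<le> real (card {i \<in> supp n \<theta>. X i \<in> ?A})"
        using supp(3) by (intro of_nat_mono card_mono) auto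
      also have "\<dots> = (\<Sum>i\<in>supp n \<theta>. indicator ?A (X i))" by (rule card_filter_eq_sum[OF supp(3)])
      finally show ?thesis using sn False by (simp add: divide_right_mono)
    qed
  qed
  also have "\<dots> = measure (seq_law n \<theta>) ?D + 1 / real s * (\<Sum>i\<in>supp n \<theta>. measure (normal_law (\<theta> i) 1) ?A)"
  proof -
    have "(\<integral>X. indicator ?D X + 1 / real s * (\<Sum>i\<in>supp n \<theta>. indicator ?A (X i)) \<partial>seq_law n \<theta>)
      = (\<integral>X. indicator ?D X \<partial>seq_law n \<theta>) + (\<integral>X. 1 / real s * (\<Sum>i\<in>supp n \<theta>. indicator ?A (X i)) \<partial>seq_law n \<theta>)"
      using iD iS by (rule Bochner_Integration.integral_add)
    also have "(\<integral>X. indicator ?D X \<partial>seq_law n \<theta>) = measure (seq_law n \<theta>) ?D"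
      using few_detections_sets sets.sets_into_space[OF few_detections_sets]
      by (simp add: Int_absorb2 del: space_seq_law)
    also have "(\<integral>X. 1 / real s * (\<Sum>i\<in>supp n \<theta>. indicator ?A (X i)) \<partial>seq_law n \<theta>)
        = 1 / real s * (\<Sum>i\<in>supp n \<theta>. measure (normal_law (\<theta> i) 1) ?A)"
      by (subst integral_mult_right_zero, subst Bochner_Integration.integral_sum[OF int(1)])
        (auto intro!: sum.cong simp: int(2))
    finally show ?thesis .
  qed
  also have "\<dots> \<le> exp (- (p * real s / 4)) + 1 / real s * (\<Sum>i\<in>supp n \<theta>. Phi_bar (b - \<delta>))"
  proof (intro add_mono prob_few_detections mult_left_mono sum_mono)
    fix i assume i: "i \<in> supp n \<theta>"
    have "measure (normal_law (\<theta> i) 1) ?A \<le> Phi_bar (\<bar>\<theta> i\<bar> - (T + \<delta>))" by (rule measure_normal_law_small)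
    also have "\<dots> \<le> Phi_bar (b - \<delta>)" using supp(4)[OF i] by (intro Phi_bar_antimono) simp
    finally show "measure (normal_law (\<theta> i) 1) ?A \<le> Phi_bar (b - \<delta>)" .
  qed simp
  finally show ?thesis using supp(2) sn by simp
qed

text \<open>Off the exceptional events the number of rejections is at least p * s / 4, a
  deterministic bound, so the ratio reduces to the expected number of nulls beyond T. That number is
  at most 2 * s / T, and dividing gives 8 / (p * T).\<close>

lemma FDR_upper: "FDR n \<theta> rejects \<le> 1 / real R + exp (- (p * real s / 4)) + 8 / (p * T)"
proof -
  interpret P: prob_space "seq_law n \<theta>" by (rule prob_space_seq_law)
  let ?A = "{x. T < \<bar>x\<bar>}" and ?D = "few_detections \<theta>" and ?U = "overfit_event n s R \<theta>"
    and ?N = "{..<n} - supp n \<theta>"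
  have [measurable]: "?A \<in> sets borel" by measurable
  have in_n: "i \<in> ?N \<Longrightarrow> i < n" for i by auto
  note int = integral_coord_indicator[OF in_n \<open>?A \<in> sets borel\<close>, of _ \<theta>]
  note sets = few_detections_sets overfit_event_sets[OF s(1), of n R \<theta>]
  have iD: "integrable (seq_law n \<theta>) (indicator ?D :: _ \<Rightarrow> real)" "integrable (seq_law n \<theta>) (indicator ?U :: _ \<Rightarrow> real)"
    using sets by (auto intro!: integrable_real_indicator simp: less_top[symmetric])
  define k where "k = 4 / (p * real s)"
  have k: "0 < k" using p_bounds sn by (simp add: k_def)
  have iS: "integrable (seq_law n \<theta>) (\<lambda>X. k * (\<Sum>i\<in>?N. indicator ?A (X i)))"
    by (intro integrable_mult_right Bochner_Integration.integrable_sum int)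
  have "FDR n \<theta> rejects \<le> (\<integral>X. (indicator ?U X + indicator ?D X) + k * (\<Sum>i\<in>?N. indicator ?A (X i)) \<partial>seq_law n \<theta>)"
    unfolding FDR_def
  proof (rule integral_mono')
    show "integrable (seq_law n \<theta>) (\<lambda>X. (indicator ?U X + indicator ?D X) + k * (\<Sum>i\<in>?N. indicator ?A (X i)))"
      using iD iS by (intro Bochner_Integration.integrable_add)
    fix X assume X: "X \<in> space (seq_law n \<theta>)"
    have sn0: "0 \<le> k * (\<Sum>i\<in>?N. indicator ?A (X i) :: real)"
      using k by (intro mult_nonneg_nonneg sum_nonneg) auto
    show "0 \<le> (indicator ?U X + indicator ?D X) + k * (\<Sum>i\<in>?N. indicator ?A (X i))"
      using sn0 by (intro add_nonneg_nonneg) auto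
    let ?F = "{i. i < n \<and> \<theta> i = 0 \<and> rejects X i}" and ?R = "{i. i < n \<and> rejects X i}"
    show "real (card ?F) / max 1 (real (card ?R))
        \<le> (indicator ?U X + indicator ?D X) + k * (\<Sum>i\<in>?N. indicator ?A (X i))"
    proof (cases "X \<in> ?D \<or> X \<in> ?U")
      case True
      have "card ?F \<le> card ?R" by (intro card_mono) auto
      then have "real (card ?F) \<le> max 1 (real (card ?R))" by (simp add: le_max_iff_disj)
      moreover have "0 < max 1 (real (card ?R))" by (simp add: less_max_iff_disj)
      ultimately have "real (card ?F) / max 1 (real (card ?R)) \<le> 1" by (simp only: divide_le_eq_1_pos)
      moreover have "1 \<le> indicator ?U X + (indicator ?D X :: real)" using True by (auto simp: indicator_def)
      ultimately show ?thesis using sn0 by linarith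
    next
      case False
      have "?F \<subseteq> {i \<in> ?N. X i \<in> ?A}"
        using rejects_imp[OF X] False by (auto simp: supp_def)
      then have "real (card ?F) \<le> real (card {i \<in> ?N. X i \<in> ?A})"
        by (intro of_nat_mono card_mono) auto
      also have "\<dots> = (\<Sum>i\<in>?N. indicator ?A (X i))" by (rule card_filter_eq_sum) simp
      finally have F: "real (card ?F) \<le> (\<Sum>i\<in>?N. indicator ?A (X i))" .
      have "{i \<in> supp n \<theta>. X i \<in> {x. T + 1 \<le> \<bar>x\<bar>}} \<subseteq> ?R"
        using rejects_signal[OF X] False \<delta> supp(1) by force
      then have "card {i \<in> supp n \<theta>. X i \<in> {x. T + 1 \<le> \<bar>x\<bar>}} \<le> card ?R"
        by (intro card_mono) auto
      moreover have "p * real s / 4 < real (card {i \<in> supp n \<theta>. X i \<in> {x. T + 1 \<le> \<bar>x\<bar>}})"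
        using False X by (simp add: few_detections_def)
      ultimately have Rj: "p * real s / 4 \<le> max 1 (real (card ?R))" by linarith
      have "real (card ?F) / max 1 (real (card ?R)) \<le> real (card ?F) / (p * real s / 4)"
        using Rj p_bounds sn by (intro divide_left_mono mult_pos_pos) auto
      also have "\<dots> = k * real (card ?F)" by (simp add: k_def)
      also have "\<dots> \<le> k * (\<Sum>i\<in>?N. indicator ?A (X i))" using F k by (intro mult_left_mono) auto
      finally show ?thesis using False by simp
    qed
  qed
  also have "\<dots> = measure (seq_law n \<theta>) ?U + measure (seq_law n \<theta>) ?D + k * (\<Sum>i\<in>?N. measure (normal_law (\<theta> i) 1) ?A)"
  proof -
    have "(\<integral>X. (indicator ?U X + indicator ?D X) + k * (\<Sum>i\<in>?N. indicator ?A (X i)) \<partial>seq_law n \<theta>)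
      = (\<integral>X. (indicator ?U X :: real) + indicator ?D X \<partial>seq_law n \<theta>) + (\<integral>X. k * (\<Sum>i\<in>?N. indicator ?A (X i)) \<partial>seq_law n \<theta>)"
      using iD iS by (intro Bochner_Integration.integral_add Bochner_Integration.integrable_add)
    also have "(\<integral>X. (indicator ?U X :: real) + indicator ?D X \<partial>seq_law n \<theta>)
        = (\<integral>X. indicator ?U X \<partial>seq_law n \<theta>) + (\<integral>X. indicator ?D X \<partial>seq_law n \<theta>)"
      using iD by (intro Bochner_Integration.integral_add)
    also have "\<dots> = measure (seq_law n \<theta>) ?U + measure (seq_law n \<theta>) ?D"
      using sets.sets_into_space[OF sets(1)] sets.sets_into_space[OF sets(2)]
      by (simp add: Int_absorb2 del: space_seq_law)
    also have "(\<integral>X. k * (\<Sum>i\<in>?N. indicator ?A (X i)) \<partial>seq_law n \<theta>)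
        = k * (\<Sum>i\<in>?N. measure (normal_law (\<theta> i) 1) ?A)"
      by (subst integral_mult_right_zero, subst Bochner_Integration.integral_sum[OF int(1)])
        (auto intro!: sum.cong simp: int(2))
    finally show ?thesis .
  qed
  also have "\<dots> \<le> 1 / real R + exp (- (p * real s / 4)) + k * (\<Sum>i\<in>?N. 2 * Phi_bar T)"
  proof (intro add_mono prob_few_detections prob_overfit_event mult_left_mono sum_mono)
    fix i assume "i \<in> ?N"
    then have "\<theta> i = 0" by (auto simp: supp_def)
    then show "measure (normal_law (\<theta> i) 1) ?A \<le> 2 * Phi_bar T"
      using measure_std_normal_large[of T] by simp
  qed (use k in simp)
  also have "k * (\<Sum>i\<in>?N. 2 * Phi_bar T) \<le> 8 / (p * T)"
  proof -
    have "Phi_bar T \<le> std_normal_density T / T" using T(2) by (intro Phi_bar_mills) simp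
    also have "\<dots> \<le> exp (- T\<^sup>2 / 2) / T" using T(2) by (intro divide_right_mono std_normal_density_le) simp
    also have "\<dots> = real s / real n / T" unfolding T_sq sn(3) by simp
    finally have Ph: "Phi_bar T \<le> real s / real n / T" .
    have "real (card ?N) \<le> real n" using card_mono[of "{..<n}" ?N] by simp
    then have "k * (real (card ?N) * (2 * Phi_bar T)) \<le> k * (real n * (2 * (real s / real n / T)))"
      using k Ph Phi_bar_nonneg[of T] by (intro mult_left_mono mult_mono) auto
    also have "\<dots> = 8 / (p * T)" using sn(1,2) by (simp add: k_def)
    finally show ?thesis by simp
  qed
  finally show ?thesis by simp
qed

text \<open>Signals on the boundary of the class are the least favourable. Unless the scale is
  overestimated, nothing within T of 0 is rejected, and a signal of size T + b falls there with
  probability close to Phi_bar b.\<close>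

lemma FNR_lower:
  assumes "\<And>i. i \<in> supp n \<theta> \<Longrightarrow> \<theta> i = T + b"
  shows "Phi_bar b - Phi_bar (2 * T + b) - 1 / real R \<le> FNR n \<theta> rejects"
proof -
  interpret P: prob_space "seq_law n \<theta>" by (rule prob_space_seq_law)
  let ?A = "{x. \<bar>x\<bar> \<le> T}" and ?U = "overfit_event n s R \<theta>"
  have [measurable]: "?A \<in> sets borel" by measurable
  have in_n: "i \<in> supp n \<theta> \<Longrightarrow> i < n" for i using supp by auto
  note int = integral_coord_indicator[OF in_n \<open>?A \<in> sets borel\<close>, of _ \<theta>]
  note sets = overfit_event_sets[OF s(1), of n R \<theta>]
  have iU: "integrable (seq_law n \<theta>) (indicator ?U :: _ \<Rightarrow> real)"
    using sets by (auto intro!: integrable_real_indicator simp: less_top[symmetric])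
  have iS: "integrable (seq_law n \<theta>) (\<lambda>X. 1 / real s * (\<Sum>i\<in>supp n \<theta>. indicator ?A (X i)))"
    by (intro integrable_mult_right Bochner_Integration.integrable_sum int)
  have "1 / real s * (\<Sum>i\<in>supp n \<theta>. Phi_bar b - Phi_bar (2 * T + b)) - 1 / real R
      \<le> 1 / real s * (\<Sum>i\<in>supp n \<theta>. measure (normal_law (\<theta> i) 1) ?A) - measure (seq_law n \<theta>) ?U"
    using measure_normal_law_boundary[of b T] assms
    by (intro diff_mono prob_overfit_event mult_left_mono sum_mono) auto
  also have "\<dots> = (\<integral>X. 1 / real s * (\<Sum>i\<in>supp n \<theta>. indicator ?A (X i)) \<partial>seq_law n \<theta>) - (\<integral>X. indicator ?U X \<partial>seq_law n \<theta>)"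
  proof -
    have "(\<integral>X. indicator ?U X \<partial>seq_law n \<theta>) = measure (seq_law n \<theta>) ?U"
      using sets.sets_into_space[OF sets] by (simp add: Int_absorb2 del: space_seq_law)
    moreover have "(\<integral>X. 1 / real s * (\<Sum>i\<in>supp n \<theta>. indicator ?A (X i)) \<partial>seq_law n \<theta>)
        = 1 / real s * (\<Sum>i\<in>supp n \<theta>. measure (normal_law (\<theta> i) 1) ?A)"
      by (subst integral_mult_right_zero, subst Bochner_Integration.integral_sum[OF int(1)])
        (auto intro!: sum.cong simp: int(2))
    ultimately show ?thesis by (simp only:)
  qed
  also have "\<dots> = (\<integral>X. 1 / real s * (\<Sum>i\<in>supp n \<theta>. indicator ?A (X i)) - indicator ?U X \<partial>seq_law n \<theta>)"
    using iS iU by (rule Bochner_Integration.integral_diff[symmetric])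
  also have "\<dots> \<le> FNR n \<theta> rejects"
    unfolding FNR_alt
  proof (rule integral_mono)
    show "integrable (seq_law n \<theta>) (\<lambda>X. 1 / real s * (\<Sum>i\<in>supp n \<theta>. indicator ?A (X i)) - indicator ?U X)"
      using iS iU by (rule Bochner_Integration.integrable_diff)
    have card_le: "card {i \<in> supp n \<theta>. \<not> rejects X i} \<le> s" for X
      using card_mono[OF supp(3), of "{i \<in> supp n \<theta>. \<not> rejects X i}"] supp(2) by simp
    \<comment> \<open>Here the risk is on the larger side, where the default value 0 would break the
      inequality; measurability of the estimator enters at this point.\<close>
    show "integrable (seq_law n \<theta>) (\<lambda>X. real (card {i \<in> supp n \<theta>. \<not> rejects X i}) / real s)"
    proof (rule P.integrable_const_bound[of _ 1])
      show "AE X in seq_law n \<theta>. norm (real (card {i \<in> supp n \<theta>. \<not> rejects X i}) / real s) \<le> 1"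
        using card_le sn by simp
      have "(\<lambda>X. \<Sum>i\<in>supp n \<theta>. 1 - indicator {X \<in> space (seq_law n \<theta>). rejects X i} X :: real) \<in> borel_measurable (seq_law n \<theta>)"
      proof (intro borel_measurable_sum borel_measurable_diff borel_measurable_const borel_measurable_indicator)
        fix i assume "i \<in> supp n \<theta>"
        then show "{X \<in> space (seq_law n \<theta>). rejects X i} \<in> sets (seq_law n \<theta>)"
          by (intro s_procedure_sets[OF mmle in_n])
      qed
      moreover have "(\<Sum>i\<in>supp n \<theta>. 1 - indicator {X \<in> space (seq_law n \<theta>). rejects X i} X)
          = real (card {i \<in> supp n \<theta>. \<not> rejects X i})" if "X \<in> space (seq_law n \<theta>)" for X
      proof -
        have "(\<Sum>i\<in>supp n \<theta>. 1 - indicator {X \<in> space (seq_law n \<theta>). rejects X i} X)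
          = (\<Sum>i\<in>supp n \<theta>. if \<not> rejects X i then 1 else 0 :: real)"
          using that by (intro sum.cong) (auto simp: indicator_def)
        then show ?thesis using supp(3) by (simp add: sum.inter_filter[symmetric])
      qed
      ultimately have "(\<lambda>X. real (card {i \<in> supp n \<theta>. \<not> rejects X i})) \<in> borel_measurable (seq_law n \<theta>)"
        by (subst (asm) measurable_cong) auto
      then show "(\<lambda>X. real (card {i \<in> supp n \<theta>. \<not> rejects X i}) / real s) \<in> borel_measurable (seq_law n \<theta>)"
        by (rule borel_measurable_divide) simp
    qed
    fix X assume X: "X \<in> space (seq_law n \<theta>)"
    have sum: "(\<Sum>i\<in>supp n \<theta>. indicator ?A (X i)) = real (card {i \<in> supp n \<theta>. X i \<in> ?A})"
      by (rule card_filter_eq_sum[OF supp(3), symmetric])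
    show "1 / real s * (\<Sum>i\<in>supp n \<theta>. indicator ?A (X i)) - indicator ?U X
        \<le> real (card {i \<in> supp n \<theta>. \<not> rejects X i}) / real s"
    proof (cases "X \<in> ?U")
      case True
      have "card {i \<in> supp n \<theta>. X i \<in> ?A} \<le> s"
        using card_mono[OF supp(3), of "{i \<in> supp n \<theta>. X i \<in> ?A}"] supp(2) by simp
      then have "1 / real s * (\<Sum>i\<in>supp n \<theta>. indicator ?A (X i)) \<le> 1" unfolding sum using sn by simp
      moreover have "0 \<le> real (card {i \<in> supp n \<theta>. \<not> rejects X i}) / real s" by simp
      moreover have "indicator ?U X = (1::real)" using True by simp
      ultimately show ?thesis by linarith
    next
      case False
      have "{i \<in> supp n \<theta>. X i \<in> ?A} \<subseteq> {i \<in> supp n \<theta>. \<not> rejects X i}"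
        using rejects_imp[OF X False] by force
      then have "card {i \<in> supp n \<theta>. X i \<in> ?A} \<le> card {i \<in> supp n \<theta>. \<not> rejects X i}"
        using supp(3) by (intro card_mono) auto
      then show ?thesis unfolding sum using False sn by (simp add: divide_right_mono)
    qed
  qed
  finally show ?thesis using supp(2) sn by simp
qed

lemma risk_upper:
  "FDR n \<theta> rejects + FNR n \<theta> rejects
    \<le> Phi_bar b + \<delta> + 1 / real R + 2 * exp (- (p * real s / 4)) + 8 / (p * T)"
  using FDR_upper FNR_upper Phi_bar_lipschitz[of "b - \<delta>" b] \<delta> by simp

lemma FDR_nonneg: "0 \<le> FDR n \<theta> rejects"
  unfolding FDR_def by (intro Bochner_Integration.integral_nonneg) simp

end

section \<open>Supremum over the class\<close>

lemma sup_risk_upper: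
  assumes "L0 n s b \<noteq> {}"
  shows "(SUP \<theta>\<in>L0 n s b. FDR n \<theta> (s_procedure \<tau>h t) + FNR n \<theta> (s_procedure \<tau>h t))
    \<le> Phi_bar b + \<delta> + 1 / real R + 2 * exp (- (p * real s / 4)) + 8 / (p * T)"
  using risk_upper by (intro cSUP_least[OF assms])

lemma sup_risk_lower:
  assumes "0 < T + b"
  shows "L0 n s b \<noteq> {}"
    "Phi_bar b - Phi_bar (2 * T + b) - 1 / real R
      \<le> (SUP \<theta>\<in>L0 n s b. FDR n \<theta> (s_procedure \<tau>h t) + FNR n \<theta> (s_procedure \<tau>h t))"
proof -
  \<comment> \<open>0 < T + b makes these entries nonzero, so the support has exactly s
    elements.\<close>
  define \<theta> where "\<theta> = (\<lambda>i\<in>{..<n}. if i < s then T + b else 0)"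
  have supp: "supp n \<theta> = {..<s}" using s assms by (auto simp: supp_def \<theta>_def)
  have "\<forall>i\<in>supp n \<theta>. sqrt (2 * ln (real n / real s)) + b \<le> \<bar>\<theta> i\<bar>"
    unfolding supp using s by (auto simp: \<theta>_def T L)
  moreover have "\<theta> \<in> {..<n} \<rightarrow>\<^sub>E UNIV" "card (supp n \<theta>) = s"
    unfolding supp by (simp_all add: \<theta>_def)
  ultimately have mem: "\<theta> \<in> L0 n s b"
    by (simp add: L0_def ell0_def)
  then show "L0 n s b \<noteq> {}" by auto
  have "Phi_bar b - Phi_bar (2 * T + b) - 1 / real R \<le> FNR n \<theta> (s_procedure \<tau>h t)"
    using FNR_lower[OF mem] s unfolding supp by (simp add: \<theta>_def)
  also have "\<dots> \<le> FDR n \<theta> (s_procedure \<tau>h t) + FNR n \<theta> (s_procedure \<tau>h t)"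
    using FDR_nonneg[OF mem] by simp
  also have "\<dots> \<le> (SUP \<theta>\<in>L0 n s b. FDR n \<theta> (s_procedure \<tau>h t) + FNR n \<theta> (s_procedure \<tau>h t))"
    \<comment> \<open>A real supremum dominates its members only over a bounded set; the uniform
      upper bound on the risk supplies this.\<close>
    using risk_upper by (intro cSUP_upper[OF mem] bdd_aboveI2)
  finally show "Phi_bar b - Phi_bar (2 * T + b) - 1 / real R
      \<le> (SUP \<theta>\<in>L0 n s b. FDR n \<theta> (s_procedure \<tau>h t) + FNR n \<theta> (s_procedure \<tau>h t))" .
qed

end

section \<open>Asymptotics\<close>

text \<open>For x \<ge> L powr (3 / 4) one has sqrt L \<le> x powr (2 / 3), so x / sqrt L is at
  least x powr (1 / 3). Uniformity in x thereby reduces to comparing a logarithm with a power of one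
  variable.\<close>

lemma eventually_growth:
  "\<forall>\<^sub>F L in at_top. \<forall>x \<ge> L powr (3 / 4). 76 + 5 / 2 * ln x \<le> x / (43008 * sqrt L)"
proof -
  have "\<forall>\<^sub>F x::real in at_top. 76 + 5 / 2 * ln x \<le> x powr (1 / 3) / 43008" by real_asymp
  then obtain x0 where x0: "\<And>x::real. x0 \<le> x \<Longrightarrow> 76 + 5 / 2 * ln x \<le> x powr (1 / 3) / 43008"
    by (auto simp: eventually_at_top_linorder)
  have "filterlim (\<lambda>L::real. L powr (3 / 4)) at_top at_top" by real_asymp
  then have "\<forall>\<^sub>F L::real in at_top. x0 \<le> L powr (3 / 4)" by (simp add: filterlim_at_top)
  moreover have "\<forall>\<^sub>F L::real in at_top. 1 \<le> L" by (rule eventually_ge_at_top)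
  ultimately show ?thesis
  proof eventually_elim
    case (elim L)
    show ?case
    proof (intro allI impI)
      fix x assume x: "L powr (3 / 4) \<le> x"
      have xp: "0 < x" using x elim by (smt (verit) powr_gt_zero)
      have "sqrt L = (L powr (3 / 4)) powr (2 / 3)"
        using elim by (simp add: powr_powr powr_half_sqrt)
      also have "\<dots> \<le> x powr (2 / 3)" using x by (intro powr_mono2) auto
      finally have sq: "sqrt L \<le> x powr (2 / 3)" .
      have "x powr (1 / 3) * sqrt L \<le> x powr (1 / 3) * x powr (2 / 3)"
        using sq by (intro mult_left_mono) auto
      also have "\<dots> = x" using xp by (simp flip: powr_add)
      finally have "x powr (1 / 3) \<le> x / sqrt L" using elim by (simp add: pos_le_divide_eq)
      then have "x powr (1 / 3) / 43008 \<le> x / sqrt L / 43008" by (intro divide_right_mono) auto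
      moreover have "76 + 5 / 2 * ln x \<le> x powr (1 / 3) / 43008" using elim x by (intro x0) auto
      ultimately show "76 + 5 / 2 * ln x \<le> x / (43008 * sqrt L)" by (simp add: mult.commute)
    qed
  qed
qed

text \<open>The conditions on \<open>R\<close> are stated for L powr (3 / 4) + 1, because
  \<open>R\<close> is the ceiling of L powr (3 / 4).\<close>

lemma eventually_thresholds:
  fixes b c \<delta> \<kappa> t p e :: real
  assumes "0 < c" "0 < \<delta>" "0 < \<kappa>" "0 < t" "0 < p" "0 < e"
  shows "\<forall>\<^sub>F L in at_top. 1 \<le> L \<and> 2 \<le> sqrt (2 * L) \<and> 0 < sqrt (2 * L) + b
    \<and> 2688 * (sqrt (2 * L) + 1)\<^sup>2 * exp (- sqrt (2 * L)) \<le> 1 / \<kappa>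
    \<and> 224 * (sqrt (2 * L) + 1)\<^sup>2 * exp (- (\<delta> * sqrt (2 * L))) * (2322432 * \<kappa>) < t
    \<and> (L powr (3 / 4) + 1) * exp (- L) * (1 + sqrt (2 * L))\<^sup>2 \<le> c
    \<and> 3 * (L powr (3 / 4) + 1) \<le> c * (2 + 2 * L)
    \<and> 1 / L powr (3 / 4) < e \<and> 8 / (p * sqrt (2 * L)) < e \<and> 1 / (2 * sqrt (2 * L) + b) < e"
proof -
  have "((\<lambda>L. 2688 * (sqrt (2 * L) + 1)\<^sup>2 * exp (- sqrt (2 * L))) \<longlongrightarrow> 0) at_top" by real_asymp
  then have 1: "\<forall>\<^sub>F L in at_top. 2688 * (sqrt (2 * L) + 1)\<^sup>2 * exp (- sqrt (2 * L)) < 1 / \<kappa>"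
    by (rule order_tendstoD) (use assms in simp)
  have "((\<lambda>L. 224 * (sqrt (2 * L) + 1)\<^sup>2 * exp (- (\<delta> * sqrt (2 * L))) * (2322432 * \<kappa>)) \<longlongrightarrow> 0) at_top"
    using assms by real_asymp
  then have 2: "\<forall>\<^sub>F L in at_top. 224 * (sqrt (2 * L) + 1)\<^sup>2 * exp (- (\<delta> * sqrt (2 * L))) * (2322432 * \<kappa>) < t"
    by (rule order_tendstoD) fact
  have "((\<lambda>L. (L powr (3 / 4) + 1) * exp (- L) * (1 + sqrt (2 * L))\<^sup>2) \<longlongrightarrow> 0) at_top" by real_asymp
  then have 3: "\<forall>\<^sub>F L in at_top. (L powr (3 / 4) + 1) * exp (- L) * (1 + sqrt (2 * L))\<^sup>2 < c"
    by (rule order_tendstoD) fact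
  have 4: "\<forall>\<^sub>F L in at_top. 3 * (L powr (3 / 4) + 1) \<le> c * (2 + 2 * L)"
    using assms by real_asymp
  have "((\<lambda>L::real. 1 / L powr (3 / 4)) \<longlongrightarrow> 0) at_top" by real_asymp
  then have 5: "\<forall>\<^sub>F L::real in at_top. 1 / L powr (3 / 4) < e" by (rule order_tendstoD) fact
  have "((\<lambda>L. 8 / (p * sqrt (2 * L))) \<longlongrightarrow> 0) at_top" using assms by real_asymp
  then have 6: "\<forall>\<^sub>F L in at_top. 8 / (p * sqrt (2 * L)) < e" by (rule order_tendstoD) fact
  have "((\<lambda>L. 1 / (2 * sqrt (2 * L) + b)) \<longlongrightarrow> 0) at_top" by real_asymp
  then have 7: "\<forall>\<^sub>F L in at_top. 1 / (2 * sqrt (2 * L) + b) < e" by (rule order_tendstoD) fact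
  have 8: "\<forall>\<^sub>F L in at_top. 2 \<le> sqrt (2 * L)" by real_asymp
  have 9: "\<forall>\<^sub>F L in at_top. 0 < sqrt (2 * L) + b" by real_asymp
  have 10: "\<forall>\<^sub>F L::real in at_top. 1 \<le> L" by (rule eventually_ge_at_top)
  from 1 2 3 4 5 6 7 8 9 10 show ?thesis
    by eventually_elim (intro conjI; simp)
qed

theorem theorem1:
  fixes b t :: real and s :: "nat \<Rightarrow> nat" and \<tau>h :: "nat \<Rightarrow> (nat \<Rightarrow> real) \<Rightarrow> real"
  assumes "0 < t" and "t < 1"
    and "\<And>n. n \<ge> 1 \<Longrightarrow> 1 \<le> s n \<and> s n \<le> n"
    and "filterlim s at_top sequentially"
    and "(\<lambda>n. real (s n) / real n) \<longlonglongrightarrow> 0"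
    and "\<And>n. n \<ge> 1 \<Longrightarrow> is_mmle n (\<tau>h n)"
  shows "(\<lambda>n. SUP \<theta>\<^sub>0\<in>L0 n (s n) b.
           FDR n \<theta>\<^sub>0 (s_procedure (\<tau>h n) t) + FNR n \<theta>\<^sub>0 (s_procedure (\<tau>h n) t))
         \<longlonglongrightarrow> Phi_bar b"
proof (rule tendstoI)
  fix e :: real assume e: "0 < e"
  \<comment> \<open>The upper bound on the risk has four error terms, each given e / 4: \<delta>, 1
    / R, the exponential term and 8 / (p * T).\<close>
  define \<delta> where "\<delta> = min 1 (e / 4)"
  have \<delta>: "0 < \<delta>" "\<delta> \<le> 1" and \<delta>_le: "\<delta> \<le> e / 4" using e by (auto simp: \<delta>_def)
  define p where "p = 1 - Phi_bar (b - 1)"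
  have p: "0 < p" using Phi_bar_less_1[of "b - 1"] by (simp add: p_def)
  \<comment> \<open>Anything above 600 / p would do; the value depends only on b, so it is
    eventually below s n.\<close>
  define \<kappa> where "\<kappa> = 601 / p"
  have \<kappa>: "0 < \<kappa>" "600 < \<kappa> * p" using p by (simp_all add: \<kappa>_def)
  obtain c where c: "0 < c" "\<And>\<tau> x. 0 < \<tau> \<Longrightarrow> \<tau> * (1 + \<bar>x\<bar>)\<^sup>2 \<le> c
      \<Longrightarrow> \<tau> \<le> c * (2 + x\<^sup>2) * std_normal_density x \<Longrightarrow> t \<le> s_value x \<tau>"
    using s_value_ge[OF assms(2)] by blast
  define L where "L n = ln (real n / real (s n))" for n
  have ge1: "\<forall>\<^sub>F n in sequentially. 1 \<le> n" by (rule eventually_ge_at_top)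
  have "filterlim (\<lambda>n. inverse (real (s n) / real n)) at_top sequentially"
  proof (rule filterlim_inverse_at_top[OF assms(5)])
    show "\<forall>\<^sub>F n in sequentially. 0 < real (s n) / real n"
      using ge1 by eventually_elim (use assms(3) in fastforce)
  qed
  then have lim: "filterlim L at_top sequentially"
    unfolding L_def by (intro filterlim_compose[OF ln_at_top]) simp
  have "\<forall>\<^sub>F n in sequentially. real (s n) / real n < 1 / 2"
    using assms(5) by (rule order_tendstoD) simp
  moreover have "\<forall>\<^sub>F n in sequentially. 2 * exp (- (p * real (s n) / 4)) < e / 4"
  proof -
    have "filterlim (\<lambda>n. real (s n)) at_top sequentially"
      using assms(4) by (rule filterlim_compose[OF filterlim_real_sequentially])
    moreover have "((\<lambda>x. 2 * exp (- (p * x / 4))) \<longlongrightarrow> 0) at_top" using p by real_asymp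
    then have "\<forall>\<^sub>F x in at_top. 2 * exp (- (p * x / 4)) < e / 4" by (rule order_tendstoD) (use e in simp)
    ultimately show ?thesis by (rule eventually_compose_filterlim[rotated])
  qed
  moreover have "\<forall>\<^sub>F n in sequentially. nat \<lceil>\<kappa>\<rceil> \<le> s n"
    using assms(4) unfolding filterlim_at_top by blast
  moreover note ge1
  moreover note eventually_compose_filterlim[OF hellinger_affinity_eventually lim]
  moreover note eventually_compose_filterlim[OF eventually_growth lim]
  moreover have "0 < e / 4" using e by simp
  note eventually_compose_filterlim[OF eventually_thresholds[OF c(1) \<delta>(1) \<kappa>(1) assms(1) p this, of b] lim]
  ultimately show "\<forall>\<^sub>F n in sequentially. dist (SUP \<theta>\<^sub>0\<in>L0 n (s n) b.
      FDR n \<theta>\<^sub>0 (s_procedure (\<tau>h n) t) + FNR n \<theta>\<^sub>0 (s_procedure (\<tau>h n) t)) (Phi_bar b) < e"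
  proof eventually_elim
    case (elim n)
    define T where "T = sqrt (2 * L n)"
    define R where "R = nat \<lceil>L n powr (3 / 4)\<rceil>"
    have th: "1 \<le> L n" "2 \<le> T" "0 < T + b"
      "2688 * (T + 1)\<^sup>2 * exp (- T) \<le> 1 / \<kappa>"
      "224 * (T + 1)\<^sup>2 * exp (- (\<delta> * T)) * (2322432 * \<kappa>) < t"
      "(L n powr (3 / 4) + 1) * exp (- L n) * (1 + T)\<^sup>2 \<le> c"
      "3 * (L n powr (3 / 4) + 1) \<le> c * (2 + 2 * L n)"
      "1 / L n powr (3 / 4) < e / 4" "8 / (p * T) < e / 4" "1 / (2 * T + b) < e / 4"
      using elim(7) unfolding T_def by blast+
    have Lp: "1 \<le> L n powr (3 / 4)" using th by (simp add: ge_one_powr_ge_zero)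
    have RL: "L n powr (3 / 4) \<le> real R" "real R \<le> L n powr (3 / 4) + 1" "1 \<le> R"
      using Lp unfolding R_def by linarith+
    interpret sparse_regime n "s n" R b t T \<delta> p c \<kappa> "L n" "\<tau>h n"
    proof
      show "is_mmle n (\<tau>h n)" "1 \<le> s n" using elim(4) assms(3,6) by auto
      show "2 * s n \<le> n" using elim(1,4) by (simp add: field_simps)
      show "\<kappa> \<le> real (s n)" using elim(3) by linarith
      show "(\<integral>\<^sup>+ x. ennreal (sqrt (marginal_ratio \<tau> x)) \<partial>normal_law 0 1) \<le> ennreal (exp (- (\<tau> / (21504 * sqrt (L n)))))"
        if "exp (- L n) \<le> \<tau>" "\<tau> \<le> 2" for \<tau> using elim(5) that by blast
      show "76 + 5 / 2 * ln (real j) \<le> real j / (43008 * sqrt (L n))" if "R < j" for j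
        using elim(6) RL(1) that by auto
      have "real R * exp (- L n) * (1 + T)\<^sup>2 \<le> (L n powr (3 / 4) + 1) * exp (- L n) * (1 + T)\<^sup>2"
        using RL by (intro mult_right_mono) auto
      then show "real R * exp (- L n) * (1 + T)\<^sup>2 \<le> c" using th by linarith
      have "3 * real R \<le> 3 * (L n powr (3 / 4) + 1)" using RL(2) by simp
      also note th(7)
      finally show "3 * real R \<le> c * (2 + 2 * L n)" .
      show "t \<le> s_value x \<tau>" if "0 < \<tau>" "\<tau> * (1 + \<bar>x\<bar>)\<^sup>2 \<le> c" "\<tau> \<le> c * (2 + x\<^sup>2) * std_normal_density x" for \<tau> x
        using c(2) that .
    qed (use th assms(1) \<delta> \<kappa> c RL in \<open>auto simp: L_def T_def p_def\<close>)
    have "1 / real R \<le> 1 / L n powr (3 / 4)" using RL Lp by (intro divide_left_mono mult_pos_pos) auto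
    then have R1: "1 / real R < e / 4" using th by linarith
    have ne: "L0 n (s n) b \<noteq> {}" using th by (intro sup_risk_lower) auto
    have "Phi_bar (2 * T + b) \<le> std_normal_density (2 * T + b) / (2 * T + b)"
      using th T(2) by (intro Phi_bar_mills) linarith
    also have "\<dots> \<le> 1 / (2 * T + b)"
      using th T(2) by (intro divide_right_mono std_normal_density_le_1) linarith
    finally have P: "Phi_bar (2 * T + b) < e / 4" using th by linarith
    have "0 < T + b" using th by simp
    from sup_risk_lower(2)[OF this] sup_risk_upper[OF ne] P R1 th elim(2) \<delta>_le e
    show ?case unfolding dist_real_def abs_less_iff by linarith
  qed
qed

end
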